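(* Let $l,k\ge 1$ be integers, $n=l+k$, $E=\mathbb{C}^n$ and $X=\operatorname{Gr}(l,E)$. Let $\lambda=(\lambda_1\ge\dots\ge\lambda_l\ge0)$ be a partition with at most $l$ parts (with no bound on $\lambda_1$). For each $1\le j\le l$, choose $I_j\in\mathbb{Z}$ such that $I_j\equiv\lambda_j \pmod n$ and $j-l\le I_j<j-l+n$. Then $$\sigma_\lambda=(-1)^{d(l-1)}\,q^d\,\sigma_I\in QH^*X,$$ where $I=(I_1,\dots,I_l)$ and $nd=|\lambda|-\sum_{j=1}^l I_j$.
   Context: $\operatorname{Gr}(l,E)$ is the Grassmannian of $l$-dimensional subspaces of $E=\mathbb{C}^n$. For a partition $\lambda$ write $|\lambda|=\sum\lambda_i$. For a complete flag $F_1\subset F_2\subset\dots\subset F_n=E$ ($\dim F_i=i$) and a partition $\lambda=(\lambda_1\ge\dots\ge\lambda_l\ge0)$ with $\lambda_1\le k$ (i.e. contained in the $l\times k$ rectangle), the Schubert variety is $\Omega_\lambda(F_\bullet)=\{V\in X\mid \dim(V\cap F_{k+i-\lambda_i})\ge i\ \ \forall\,1\le i\le l\}$; it has codimension $|\lambda|$, and $\Omega_\lambda\in H^*X=H^*(X;\mathbb{Z})$ denotes its class. The classes $\Omega_\lambda$, for $\lambda$ contained in the $l\times k$ rectangle, form a $\mathbb{Z}$-basis of $H^*X$. The degree of a regular map $f:\mathbb{P}^1\to\mathbb{P}^N$ is the number of points in the inverse image of a general hyperplane; the degree of a map $\mathbb{P}^1\to X$ is that of its composition with the Plücker embedding $X\subset\mathbb{P}(\bigwedge^l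 E)$. For partitions $\lambda,\mu,\nu$ in the $l\times k$ rectangle and $d\ge0$ with $|\lambda|+|\mu|+|\nu|=lk+dn$, the Gromov-Witten invariant $\langle\Omega_\lambda,\Omega_\mu,\Omega_\nu\rangle_d$ is the number of rational curves $f:\mathbb{P}^1\to X$ of degree $d$ which meet all of $\Omega_\lambda(F_\bullet),\Omega_\mu(G_\bullet),\Omega_\nu(H_\bullet)$ for general flags $F_\bullet,G_\bullet,H_\bullet$, up to automorphisms of $\mathbb{P}^1$. If $|\lambda|+|\mu|+|\nu|\ne lk+dn$ the invariant is $0$. The (small) quantum cohomology ring $QH^*X$ is $H^*X\otimes_{\mathbb{Z}}\mathbb{Z}[q]$ as a $\mathbb{Z}[q]$-module, with Schubert classes $\sigma_\lambda=\Omega_\lambda\otimes1$ (for $\lambda$ in the $l\times k$ rectangle) and $\mathbb{Z}[q]$-bilinear product $\sigma_\lambda\cdot\sigma_\mu=\sum_{\nu,\,d\ge0}\langle\Omega_\lambda,\Omega_\mu,\Omega_{\nu^\vee}\rangle_d\,q^d\,\sigma_\nu$, where $\nu^\vee=(k-\nu_l,\dots,k-\nu_1)$. It is a known fact, assumed here, that this defines an associative (commutative) ring. Extended notation: let $c_i=\sigma_{(1^i)}\in QH^*X$ for $0\le i\le l$ (so $c_0=1$; $(1^i)$ is the partition with $i$ parts equal to $1$) and $c_i=0$ for $i<0$ and $i>l$. For $p\ge1$ set $\sigma_p=\det(c_{1+j-i})_{1\le i,j\le p}\in QH^*X$; also $\sigma_0=1$ and $\sigma_p=0$ for $p<0$.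 (For $0\le p\le k$ this agrees with the Schubert class $\sigma_{(p)}$, and $\sigma_p=0$ for $k<p<n$.) For any integer sequence $I=(I_1,\dots,I_p)$ set $\sigma_I=\det(\sigma_{I_i+j-i})_{1\le i,j\le p}\in QH^*X$; in particular this defines $\sigma_\lambda$ for every partition $\lambda$, and it agrees with the Schubert class when $\lambda$ is contained in the $l\times k$ rectangle. *)

theory Defs
  imports "HOL-Analysis.Analysis" "HOL-Algebra.Module" "HOL-Computational_Algebra.Polynomial"
    "HOL-Combinatorics.Permutations" "HOL-Number_Theory.Cong"
begin

section \<open>General position\<close>

text \<open>The complex algebra of functions generated by the coordinate functions in \<open>C\<close>,
  i.e. the polynomial functions in these coordinates.\<close>

inductive_set poly_funs :: "('x \<Rightarrow> complex) set \<Rightarrow> ('x \<Rightarrow> complex) set"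
  for C :: "('x \<Rightarrow> complex) set" where
  const: "(\<lambda>_. c) \<in> poly_funs C"
| coord: "h \<in> C \<Longrightarrow> h \<in> poly_funs C"
| add: "g \<in> poly_funs C \<Longrightarrow> h \<in> poly_funs C \<Longrightarrow> (\<lambda>x. g x + h x) \<in> poly_funs C"
| mult: "g \<in> poly_funs C \<Longrightarrow> h \<in> poly_funs C \<Longrightarrow> (\<lambda>x. g x * h x) \<in> poly_funs C"

text \<open>\<open>P\<close> holds for general points of the affine space with coordinate functions \<open>C\<close>: it holds on
  a nonempty Zariski-open subset.\<close>

definition generally :: "('x \<Rightarrow> complex) set \<Rightarrow> ('x \<Rightarrow> bool) \<Rightarrow> bool" where
  "generally C P \<longleftrightarrow> (\<exists>h \<in> poly_funs C. (\<exists>x. h x \<noteq> 0) \<and> (\<forall>x. h x \<noteq> 0 \<longrightarrow> P x))"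


section \<open>Grassmannians and the Pluecker embedding\<close>

definition Gr :: "nat \<Rightarrow> (complex^'n) set set" where
  "Gr l = {V. vec.subspace V \<and> vec.dim V = l}"

definition basis_of :: "nat \<Rightarrow> (nat \<Rightarrow> complex^'n) \<Rightarrow> (complex^'n) set \<Rightarrow> bool" where
  "basis_of l v V \<longleftrightarrow>
    inj_on v {..<l} \<and> vec.independent (v ` {..<l}) \<and> vec.span (v ` {..<l}) = V"

text \<open>Coordinates of \<open>v\<^sub>0 \<and> \<dots> \<and> v\<^bsub>l-1\<^esub>\<close>. An element of the \<open>l\<close>-th exterior power is represented
  by its values on all \<open>l\<close>-tuples of coordinate forms (an alternating function on lists \<open>I\<close> of
  length \<open>l\<close>), so that no order on the index type is needed. If \<open>v\<close> ranges over the bases of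
  an \<open>l\<close>-dimensional space \<open>V\<close> with \<open>l \<ge> 1\<close>, these vectors are exactly the homogeneous
  coordinate vectors of the image of \<open>V\<close> under the Pluecker embedding.\<close>

definition plucker :: "nat \<Rightarrow> (nat \<Rightarrow> complex^'n) \<Rightarrow> 'n list \<Rightarrow> complex" where
  "plucker l v I = (\<Sum>\<pi> | \<pi> permutes {..<l}. of_int (sign \<pi>) * (\<Prod>i<l. v i $ (I ! \<pi> i)))"

text \<open>Every linear form on the exterior power is given by some coefficients \<open>a\<close> on the lists of
  length \<open>l\<close>.\<close>

definition on_hyperplane :: "nat \<Rightarrow> ('n list \<Rightarrow> complex) \<Rightarrow> (complex^'n) set \<Rightarrow> bool" where
  "on_hyperplane l a V \<longleftrightarrow>
    (\<forall>v. basis_of l v V \<longrightarrow> (\<Sum>I | length I = l. a I * plucker l v I) = 0)"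


section \<open>Rational curves\<close>

abbreviation P1 :: "(complex^2) set set" where
  "P1 \<equiv> Gr 1"

definition binary_form :: "nat \<Rightarrow> (nat \<Rightarrow> complex) \<Rightarrow> complex^2 \<Rightarrow> complex" where
  "binary_form m c w = (\<Sum>i\<le>m. c i * (w $ 1) ^ i * (w $ 2) ^ (m - i))"

text \<open>The composition with the Pluecker embedding is given by forms of a common degree \<open>m\<close>;
  they have no common zero on the projective line, since Pluecker coordinates are not all zero.\<close>

definition regular_map :: "nat \<Rightarrow> ((complex^2) set \<Rightarrow> (complex^'n) set) \<Rightarrow> bool" where
  "regular_map l f \<longleftrightarrow> (\<exists>m. \<exists>c :: 'n list \<Rightarrow> nat \<Rightarrow> complex. \<forall>w. w \<noteq> 0 \<longrightarrow>
    (\<exists>v. basis_of l v (f (vec.span {w})) \<and>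
      (\<forall>I. length I = l \<longrightarrow> plucker l v I = binary_form m (c I) w)))"

definition has_degree :: "nat \<Rightarrow> ((complex^2) set \<Rightarrow> (complex^'n) set) \<Rightarrow> nat \<Rightarrow> bool" where
  "has_degree l f d \<longleftrightarrow> generally {\<lambda>a :: 'n list \<Rightarrow> complex. a I | I. length I = l}
    (\<lambda>a. finite {p \<in> P1. on_hyperplane l a (f p)} \<and> card {p \<in> P1. on_hyperplane l a (f p)} = d)"

definition rational_curves :: "nat \<Rightarrow> nat \<Rightarrow> ((complex^2) set \<Rightarrow> (complex^'n) set) set" where
  "rational_curves l d = {f \<in> P1 \<rightarrow>\<^sub>E Gr l. regular_map l f \<and> has_degree l f d}"

definition P1_automorphisms :: "((complex^2) set \<Rightarrow> (complex^2) set) set" where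
  "P1_automorphisms =
    {\<phi>. bij_betw \<phi> P1 P1 \<and> regular_map 1 \<phi> \<and> regular_map 1 (inv_into P1 \<phi>)}"

definition reparametrization ::
  "(((complex^2) set \<Rightarrow> (complex^'n) set) \<times> ((complex^2) set \<Rightarrow> (complex^'n) set)) set" where
  "reparametrization = {(f, g). \<exists>\<phi> \<in> P1_automorphisms. g = compose P1 f \<phi>}"


section \<open>Schubert varieties and Gromov--Witten invariants\<close>

text \<open>A partition with at most \<open>l\<close> parts is a weakly decreasing list of length \<open>l\<close>, padded
  with zeros. List indices start at 0.\<close>

definition partitions :: "nat \<Rightarrow> nat list set" where
  "partitions l = {lam. length lam = l \<and> sorted_wrt (\<ge>) lam}"

definition rect_partitions :: "nat \<Rightarrow> nat \<Rightarrow> nat list set" where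
  "rect_partitions l k = {lam \<in> partitions l. \<forall>x \<in> set lam. x \<le> k}"

definition dual_partition :: "nat \<Rightarrow> nat list \<Rightarrow> nat list" where
  "dual_partition k \<nu> = map (\<lambda>x. k - x) (rev \<nu>)"

text \<open>Every complete flag arises in this way from a basis \<open>u\<close> of the ambient space.\<close>

definition flag :: "(nat \<Rightarrow> complex^'n) \<Rightarrow> nat \<Rightarrow> (complex^'n) set" where
  "flag u j = vec.span (u ` {..<j})"

definition schubert_variety ::
  "nat \<Rightarrow> nat \<Rightarrow> nat list \<Rightarrow> (nat \<Rightarrow> (complex^'n) set) \<Rightarrow> (complex^'n) set set" where
  "schubert_variety l k lam F =
    {V \<in> Gr l. \<forall>i \<in> {1..l}. vec.dim (V \<inter> F (k + i - lam ! (i - 1))) \<ge> i}"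

definition curves_meeting ::
  "nat \<Rightarrow> nat \<Rightarrow> (complex^'n) set set \<Rightarrow> (complex^'n) set set \<Rightarrow> (complex^'n) set set \<Rightarrow>
    ((complex^2) set \<Rightarrow> (complex^'n) set) set" where
  "curves_meeting l d A B C =
    {f \<in> rational_curves l d. f ` P1 \<inter> A \<noteq> {} \<and> f ` P1 \<inter> B \<noteq> {} \<and> f ` P1 \<inter> C \<noteq> {}}"

definition for_general_flags ::
  "((nat \<Rightarrow> (complex^'n) set) \<Rightarrow> (nat \<Rightarrow> (complex^'n) set) \<Rightarrow> (nat \<Rightarrow> (complex^'n) set) \<Rightarrow> bool)
    \<Rightarrow> bool" where
  "for_general_flags R \<longleftrightarrow> generally
    ({\<lambda>(u, v, w). u j $ a | j a. j < CARD('n)} \<union>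
     {\<lambda>(u, v, w). v j $ a | j a. j < CARD('n)} \<union>
     {\<lambda>(u, v, w). w j $ a | j a. j < CARD('n)})
    (\<lambda>(u, v, w). basis_of CARD('n) u UNIV \<and> basis_of CARD('n) v UNIV \<and> basis_of CARD('n) w UNIV
      \<longrightarrow> R (flag u) (flag v) (flag w))"

definition gromov_witten ::
  "'n::finite itself \<Rightarrow> nat \<Rightarrow> nat \<Rightarrow> nat \<Rightarrow> nat list \<Rightarrow> nat list \<Rightarrow> nat list \<Rightarrow> nat" where
  "gromov_witten _ l k d lam \<mu> \<nu> =
    (if sum_list lam + sum_list \<mu> + sum_list \<nu> = l * k + d * (l + k)
     then THE N. for_general_flags
       (\<lambda>F G (H :: nat \<Rightarrow> (complex^'n) set).
         let Q = curves_meeting l d (schubert_variety l k lam F) (schubert_variety l k \<mu> G)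
                   (schubert_variety l k \<nu> H) // reparametrization
         in finite Q \<and> card Q = N)
     else 0)"


section \<open>The small quantum cohomology ring\<close>

text \<open>The underlying \<open>\<int>[q]\<close>-module is the free module on the Schubert classes of the partitions
  in the \<open>l \<times> k\<close> rectangle: an element is its family of coefficients, and \<^typ>\<open>int poly\<close>
  is \<open>\<int>[q]\<close>.\<close>

definition schubert_class :: "nat list \<Rightarrow> nat list \<Rightarrow> int poly" where
  "schubert_class lam = (\<lambda>\<nu>. if \<nu> = lam then 1 else 0)"

text \<open>The invariants vanish for \<open>d > |lam| + |\<mu>| + |\<nu>|\<close>, so the sum runs over all relevant \<open>d\<close>.\<close>

definition structure_constant ::
  "'n::finite itself \<Rightarrow> nat \<Rightarrow> nat \<Rightarrow> nat list \<Rightarrow> nat list \<Rightarrow> nat list \<Rightarrow> int poly" where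
  "structure_constant T l k lam \<mu> \<nu> =
    (\<Sum>d \<le> sum_list lam + sum_list \<mu> + sum_list (dual_partition k \<nu>).
      monom (int (gromov_witten T l k d lam \<mu> (dual_partition k \<nu>))) d)"

definition QH :: "'n::finite itself \<Rightarrow> nat \<Rightarrow> nat \<Rightarrow> (int poly, nat list \<Rightarrow> int poly) module" where
  "QH T l k =
    \<lparr> carrier = {x. \<forall>\<nu>. \<nu> \<notin> rect_partitions l k \<longrightarrow> x \<nu> = 0},
      monoid.mult = (\<lambda>x y \<nu>. if \<nu> \<in> rect_partitions l k
        then \<Sum>lam\<in>rect_partitions l k. \<Sum>\<mu>\<in>rect_partitions l k.
          x lam * y \<mu> * structure_constant T l k lam \<mu> \<nu>
        else 0),
      one = schubert_class (replicate l 0),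
      zero = (\<lambda>\<nu>. 0),
      add = (\<lambda>x y \<nu>. x \<nu> + y \<nu>),
      smult = (\<lambda>c x \<nu>. c * x \<nu>) \<rparr>"

definition ring_det :: "('a, 'm) ring_scheme \<Rightarrow> nat \<Rightarrow> (nat \<Rightarrow> nat \<Rightarrow> 'a) \<Rightarrow> 'a" where
  "ring_det R p M = (\<Oplus>\<^bsub>R\<^esub>\<pi>\<in>{\<pi>. \<pi> permutes {..<p}}.
     if evenperm \<pi> then \<Otimes>\<^bsub>R\<^esub>i\<in>{..<p}. M i (\<pi> i)
     else \<ominus>\<^bsub>R\<^esub> (\<Otimes>\<^bsub>R\<^esub>i\<in>{..<p}. M i (\<pi> i)))"

definition chern :: "'n::finite itself \<Rightarrow> nat \<Rightarrow> nat \<Rightarrow> int \<Rightarrow> nat list \<Rightarrow> int poly" where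
  "chern T l k i =
    (if 0 \<le> i \<and> i \<le> int l then schubert_class (replicate (nat i) 1 @ replicate (l - nat i) 0)
     else \<zero>\<^bsub>QH T l k\<^esub>)"

text \<open>For \<open>p = 0\<close> the determinant is empty and equal to 1.\<close>

definition sigma1 :: "'n::finite itself \<Rightarrow> nat \<Rightarrow> nat \<Rightarrow> int \<Rightarrow> nat list \<Rightarrow> int poly" where
  "sigma1 T l k p =
    (if p < 0 then \<zero>\<^bsub>QH T l k\<^esub>
     else ring_det (QH T l k) (nat p) (\<lambda>i j. chern T l k (1 + int j - int i)))"

definition sigma :: "'n::finite itself \<Rightarrow> nat \<Rightarrow> nat \<Rightarrow> int list \<Rightarrow> nat list \<Rightarrow> int poly" where
  "sigma T l k I =
    ring_det (QH T l k) (length I) (\<lambda>i j. sigma1 T l k (I ! i + int j - int i))"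

end

(* The sigma_p are governed by the first column of the determinants E(r, p), whose first row is
   c_r, c_(r+1), ... and whose other rows are those of the matrix defining sigma_p: expansion gives
   E(r, p + 1) = c_r sigma_p - E(r + 1, p). Hence everything follows from the products of the c_i with
   the sigma_m for i <= l, m <= k, which involve only the Gromov-Witten invariants of degree 0 and one
   invariant of degree 1: the product is the sum of the hook classes (m + 1, 1^(i-1)) and (m, 1^i) that
   fit into the rectangle, plus q if i = l and m = k. So E(r, p) is the class of the hook
   (p, 1^(r-1)), sigma_p = 0 for k < p < n, and sigma_n = (-1)^(l-1) q; as the recursion is linear,
   sigma_(p+n) = (-1)^(l-1) q sigma_p for all p > -l. Replacing the parts of lambda by I extracts
   these factors from the rows of the determinant sigma_lambda.

   In degree 0 the curves are constant, and linear algebra shows that three Schubert varieties in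
   general position meet in at most one point. In degree 1 a curve is given by linear forms (otherwise
   a general hyperplane would meet it twice), and the three conditions leave only the pencil of the V
   with A < V < B, where A is the intersection of H_l with F_(n-1) and B = H_l + G_1. *)

theory Submission
  imports Defs "Jordan_Normal_Form.Determinant"
    "HOL-Computational_Algebra.Fundamental_Theorem_Algebra"
begin

no_notation vec_index (infixl "$" 100)

section \<open>General points\<close>

text \<open>The invariants are defined by a description operator over general flags, so a count
  determines them only if two generic conditions always share a point; polynomial curves joining any
  two points supply this irreducibility. Each condition on the flags says that a square linear
  system has trivial kernel, i.e. that a determinant is nonzero, so one explicit example establishes
  it.

  Degrees are balanced by \<open>|nu| + d * n = i + m\<close> with \<open>i <= l\<close> and
  \<open>m <= k\<close>. Hence \<open>d <= 1\<close>, and \<open>d = 1\<close> forces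
  \<open>i = l\<close>, \<open>m = k\<close> and empty \<open>nu\<close>: this is where the single
  invariant of degree 1 comes from. A column times a one-row class stays within the hooks, so the
  recursion closes up on them.

  The periodicity rests on the gap \<open>k < p < n\<close>, where sigma_p vanishes. The gap is
  matched by the negative indices \<open>-l < p < 0\<close>, and periodicity breaks at
  \<open>p = -l\<close>, where it would compare sigma_k with 0. The lower bound
  \<open>j - l <= I_j\<close> keeps every matrix entry above this threshold, and the upper bound
  makes the shift of each row nonnegative.\<close>

definition poly_curve :: "('x \<Rightarrow> complex) set \<Rightarrow> (complex \<Rightarrow> 'x) \<Rightarrow> bool" where
  "poly_curve C \<gamma> \<longleftrightarrow> (\<forall>c \<in> C. \<exists>p. \<forall>t. c (\<gamma> t) = poly p t)"

lemma poly_funs_along_curve: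
  assumes "h \<in> poly_funs C" "poly_curve C \<gamma>"
  shows "\<exists>p. \<forall>t. h (\<gamma> t) = poly p t"
  using assms(1)
proof induction
  case (const c)
  then show ?case by (intro exI[of _ "[:c:]"]) simp
next
  case (coord h)
  then show ?case using assms(2) by (auto simp: poly_curve_def)
next
  case (add g h)
  then show ?case by (metis poly_add)
next
  case (mult g h)
  then show ?case by (metis poly_mult)
qed

text \<open>Stands in for irreducibility of the parameter space, phrased with curves so that it
  applies to coordinates with any index set.\<close>

definition line_connected :: "('x \<Rightarrow> complex) set \<Rightarrow> bool" where
  "line_connected C \<longleftrightarrow> (\<forall>x y. \<exists>\<gamma>. poly_curve C \<gamma> \<and> \<gamma> 0 = x \<and> \<gamma> 1 = y)"

text \<open>Two nonempty open sets meet: along a curve from a point of the first to a point of the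
  second, both equations restrict to nonzero polynomials in one variable, and so does their
  product.\<close>

lemma generally_conj:
  assumes C: "line_connected C" and P: "generally C P" and Q: "generally C Q"
  shows "generally C (\<lambda>x. P x \<and> Q x)"
proof -
  obtain g x where g: "g \<in> poly_funs C" "g x \<noteq> 0" "\<And>x. g x \<noteq> 0 \<Longrightarrow> P x"
    using P unfolding generally_def by blast
  obtain h y where h: "h \<in> poly_funs C" "h y \<noteq> 0" "\<And>x. h x \<noteq> 0 \<Longrightarrow> Q x"
    using Q unfolding generally_def by blast
  obtain \<gamma> where \<gamma>: "poly_curve C \<gamma>" "\<gamma> 0 = x" "\<gamma> 1 = y"
    using C unfolding line_connected_def by blast
  obtain p where p: "\<And>t. g (\<gamma> t) = poly p t" using poly_funs_along_curve[OF g(1) \<gamma>(1)] by blast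
  obtain q where q: "\<And>t. h (\<gamma> t) = poly q t" using poly_funs_along_curve[OF h(1) \<gamma>(1)] by blast
  have "p * q \<noteq> 0" using p[of 0] q[of 1] \<gamma> g(2) h(2) by auto
  then obtain t where "poly (p * q) t \<noteq> 0"
    using poly_all_0_iff_0 by blast
  then have "g (\<gamma> t) * h (\<gamma> t) \<noteq> 0" by (simp add: p q)
  then show ?thesis unfolding generally_def
    using g h by (intro bexI[of _ "\<lambda>x. g x * h x"] conjI exI[of _ "\<gamma> t"]) (auto intro: poly_funs.mult)
qed

lemma generallyI: "h \<in> poly_funs C \<Longrightarrow> h x \<noteq> 0 \<Longrightarrow> (\<And>x. h x \<noteq> 0 \<Longrightarrow> P x) \<Longrightarrow> generally C P"
  unfolding generally_def by blast

lemma generally_mono: "generally C P \<Longrightarrow> (\<And>x. P x \<Longrightarrow> Q x) \<Longrightarrow> generally C Q"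
  unfolding generally_def by blast

lemma generally_True: "generally C (\<lambda>_. True)"
  unfolding generally_def by (intro bexI[of _ "\<lambda>_. 1"]) (auto intro: poly_funs.const)

lemma generally_ball:
  assumes "line_connected C" "finite A" "\<And>a. a \<in> A \<Longrightarrow> generally C (P a)"
  shows "generally C (\<lambda>x. \<forall>a \<in> A. P a x)"
  using assms(2,3)
proof (induction rule: finite_induct)
  case empty
  then show ?case by (simp add: generally_True)
next
  case (insert a A)
  then show ?case using generally_conj[OF assms(1), of "P a" "\<lambda>x. \<forall>a \<in> A. P a x"] by simp
qed

lemma generally_ex: "generally C P \<Longrightarrow> \<exists>x. P x"
  unfolding generally_def by blast

lemma poly_funs_sum:
  assumes "\<And>a. a \<in> A \<Longrightarrow> f a \<in> poly_funs C"
  shows "(\<lambda>x. \<Sum>a\<in>A. f a x) \<in> poly_funs C"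
  using assms by (induction A rule: infinite_finite_induct)
    (auto intro: poly_funs.const poly_funs.add)

lemma poly_funs_prod:
  assumes "\<And>a. a \<in> A \<Longrightarrow> f a \<in> poly_funs C"
  shows "(\<lambda>x. \<Prod>a\<in>A. f a x) \<in> poly_funs C"
  using assms by (induction A rule: infinite_finite_induct)
    (auto intro: poly_funs.const poly_funs.mult)

lemma poly_funs_cmult: "f \<in> poly_funs C \<Longrightarrow> (\<lambda>x. c * f x) \<in> poly_funs C"
  by (rule poly_funs.mult[OF poly_funs.const])

lemma poly_funs_uminus: "f \<in> poly_funs C \<Longrightarrow> (\<lambda>x. - f x) \<in> poly_funs C"
  using poly_funs_cmult[of f C "-1"] by simp

lemma poly_funs_det:
  assumes "\<And>i j. i < N \<Longrightarrow> j < N \<Longrightarrow> e i j \<in> poly_funs C"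
  shows "(\<lambda>x. Determinant.det (mat N N (\<lambda>(i, j). e i j x))) \<in> poly_funs C"
proof -
  have "Determinant.det (mat N N (\<lambda>(i, j). e i j x)) =
      (\<Sum>p | p permutes {0..<N}. of_int (sign p) * (\<Prod>i = 0..<N. e i (p i) x))" for x
    by (subst det_def'[of _ N]) (auto intro!: sum.cong prod.cong simp: permutes_def)
  moreover have "(\<lambda>x. \<Sum>p | p permutes {0..<N}. of_int (sign p) * (\<Prod>i = 0..<N. e i (p i) x)) \<in> poly_funs C"
    by (intro poly_funs_sum poly_funs_cmult poly_funs_prod assms) (auto dest: permutes_in_image)
  ultimately show ?thesis by simp
qed

text \<open>Links the kernel condition, which is how general position is used, to the nonvanishing
  of one polynomial, which is how \<open>generally\<close> is proved.\<close>

lemma det_nonzero_iff: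
  fixes e :: "nat \<Rightarrow> nat \<Rightarrow> complex"
  shows "Determinant.det (mat N N (\<lambda>(i, j). e i j)) \<noteq> 0 \<longleftrightarrow>
    (\<forall>x. (\<forall>i<N. (\<Sum>j<N. e i j * x j) = 0) \<longrightarrow> (\<forall>j<N. x j = 0))"
proof -
  let ?A = "mat N N (\<lambda>(i, j). e i j)"
  have A: "?A \<in> carrier_mat N N" by simp
  have mv: "?A *\<^sub>v v = 0\<^sub>v N \<longleftrightarrow> (\<forall>i<N. (\<Sum>j<N. e i j * vec_index v j) = 0)"
    if "v \<in> carrier_vec N" for v
    using that by (auto simp: vec_eq_iff scalar_prod_def lessThan_atLeast0)
  have "Determinant.det ?A = 0 \<longleftrightarrow> (\<exists>v \<in> carrier_vec N. v \<noteq> 0\<^sub>v N \<and> ?A *\<^sub>v v = 0\<^sub>v N)"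
    using det_0_iff_vec_prod_zero[OF A] by auto
  also have "\<dots> \<longleftrightarrow> (\<exists>x. (\<forall>i<N. (\<Sum>j<N. e i j * x j) = 0) \<and> (\<exists>j<N. x j \<noteq> 0))"
  proof
    assume "\<exists>v \<in> carrier_vec N. v \<noteq> 0\<^sub>v N \<and> ?A *\<^sub>v v = 0\<^sub>v N"
    then obtain v where v: "v \<in> carrier_vec N" "v \<noteq> 0\<^sub>v N" "?A *\<^sub>v v = 0\<^sub>v N" by blast
    have "\<exists>j<N. vec_index v j \<noteq> 0"
      using v(1,2) by (auto simp: vec_eq_iff)
    with mv[OF v(1)] v(3)
    show "\<exists>x. (\<forall>i<N. (\<Sum>j<N. e i j * x j) = 0) \<and> (\<exists>j<N. x j \<noteq> 0)" by blast
  next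
    assume "\<exists>x. (\<forall>i<N. (\<Sum>j<N. e i j * x j) = 0) \<and> (\<exists>j<N. x j \<noteq> 0)"
    then obtain x where x: "\<forall>i<N. (\<Sum>j<N. e i j * x j) = 0" "\<exists>j<N. x j \<noteq> 0" by blast
    let ?v = "Matrix.vec N x"
    have "(\<Sum>j<N. e i j * vec_index ?v j) = (\<Sum>j<N. e i j * x j)" for i
      by (rule sum.cong) auto
    then have "?A *\<^sub>v ?v = 0\<^sub>v N" using x(1) mv[of ?v] by simp
    moreover have "?v \<noteq> 0\<^sub>v N" using x(2) by (auto simp: vec_eq_iff)
    ultimately show "\<exists>v \<in> carrier_vec N. v \<noteq> 0\<^sub>v N \<and> ?A *\<^sub>v v = 0\<^sub>v N"
      by (intro bexI[of _ ?v]) auto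
  qed
  finally show ?thesis by blast
qed

section \<open>Generic conditions on three flags as square linear systems\<close>

definition flag_coords ::
  "((nat \<Rightarrow> complex^'n) \<times> (nat \<Rightarrow> complex^'n) \<times> (nat \<Rightarrow> complex^'n) \<Rightarrow> complex) set" where
  "flag_coords =
    {\<lambda>(u, v, w). u j $ a | j a. j < CARD('n)} \<union>
    {\<lambda>(u, v, w). v j $ a | j a. j < CARD('n)} \<union>
    {\<lambda>(u, v, w). w j $ a | j a. j < CARD('n)}"

lemma line_connected_flag_coords: "line_connected flag_coords"
  unfolding line_connected_def
proof (intro allI)
  fix x y :: "(nat \<Rightarrow> complex^'n) \<times> (nat \<Rightarrow> complex^'n) \<times> (nat \<Rightarrow> complex^'n)"
  obtain u v w u' v' w' where xy: "x = (u, v, w)" "y = (u', v', w')" by (cases x, cases y) auto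
  define L where "L = (\<lambda>(a :: nat \<Rightarrow> complex^'n) b t j. a j + t *s (b j - a j))"
  let ?\<gamma> = "\<lambda>t. (L u u' t, L v v' t, L w w' t)"
  have *: "\<exists>p. \<forall>t. L a b t j $ i = poly p t" for a b j i
    by (intro exI[of _ "[:a j $ i, b j $ i - a j $ i:]"]) (simp add: L_def algebra_simps)
  have "poly_curve flag_coords ?\<gamma>"
    unfolding poly_curve_def flag_coords_def using * by auto
  moreover have "?\<gamma> 0 = x" "?\<gamma> 1 = y" by (auto simp: L_def xy)
  ultimately show "\<exists>\<gamma>. poly_curve flag_coords \<gamma> \<and> \<gamma> 0 = x \<and> \<gamma> 1 = y" by blast
qed

lemma line_connected_list_coords:
  "line_connected {\<lambda>a :: 'i list \<Rightarrow> complex. a I | I. length I = l}"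
  unfolding line_connected_def
proof (intro allI)
  fix x y :: "'i list \<Rightarrow> complex"
  let ?\<gamma> = "\<lambda>t I. x I + t * (y I - x I)"
  have *: "\<exists>p. \<forall>t. ?\<gamma> t I = poly p t" for I
    by (intro exI[of _ "[:x I, y I - x I:]"]) simp
  then show "\<exists>\<gamma>. poly_curve {\<lambda>a. a I | I. length I = l} \<gamma> \<and> \<gamma> 0 = x \<and> \<gamma> 1 = y"
    by (intro exI[of _ ?\<gamma>]) (auto simp: poly_curve_def)
qed

text \<open>The \<open>2n\<close> by \<open>2n\<close> linear system \<open>\<alpha> v = \<beta> w = \<gamma> u + \<delta> w\<close> for coefficient vectors of total
  length \<open>2n\<close> has only the trivial solution. All the genericity that is needed is of this shape.\<close>

definition nondegenerate ::
  "nat \<Rightarrow> nat \<Rightarrow> nat \<Rightarrow> nat \<Rightarrow> (nat \<Rightarrow> complex^'n) \<times> (nat \<Rightarrow> complex^'n) \<times> (nat \<Rightarrow> complex^'n) \<Rightarrow> bool"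
  where
  "nondegenerate p q r s = (\<lambda>(u, v, w). \<forall>\<alpha> \<beta> \<gamma> \<delta>.
    (\<Sum>j<p. \<alpha> j *s v j) = (\<Sum>j<q. \<beta> j *s w j) \<longrightarrow>
    (\<Sum>j<p. \<alpha> j *s v j) = (\<Sum>j<r. \<gamma> j *s u j) + (\<Sum>j<s. \<delta> j *s w j) \<longrightarrow>
    (\<forall>j<p. \<alpha> j = 0) \<and> (\<forall>j<q. \<beta> j = 0) \<and> (\<forall>j<r. \<gamma> j = 0) \<and> (\<forall>j<s. \<delta> j = 0))"

lemma sum_lessThan_split:
  fixes f :: "nat \<Rightarrow> 'a::comm_monoid_add"
  shows "(\<Sum>j<p + q. f j) = (\<Sum>j<p. f j) + (\<Sum>j<q. f (p + j))"
  by (induction q) (auto simp: add.assoc)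

text \<open>As \<open>p + q + r + s = 2n\<close>, the system is square, and nondegeneracy is the
  nonvanishing of one determinant in the coordinates. The single nondegenerate triple
  \<open>z\<close> shows that this polynomial is not identically zero.\<close>

lemma generally_nondegenerate:
  fixes z :: "(nat \<Rightarrow> complex^'n::finite) \<times> (nat \<Rightarrow> complex^'n) \<times> (nat \<Rightarrow> complex^'n)"
  assumes N: "p + q + r + s = 2 * CARD('n)"
    and le: "p \<le> CARD('n)" "q \<le> CARD('n)" "r \<le> CARD('n)" "s \<le> CARD('n)"
    and z: "nondegenerate p q r s z"
  shows "generally flag_coords (nondegenerate p q r s :: (nat \<Rightarrow> complex^'n) \<times> _ \<Rightarrow> bool)"
proof -
  let ?n = "CARD('n)"
  obtain \<iota> :: "nat \<Rightarrow> 'n" where \<iota>: "bij_betw \<iota> {..<?n} UNIV"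
    using ex_bij_betw_nat_finite[of "UNIV :: 'n set"] by (auto simp: lessThan_atLeast0)
  have all_\<iota>: "(\<forall>i<?n. P (\<iota> i)) \<longleftrightarrow> (\<forall>a. P a)" for P
    using \<iota> by (metis bij_betw_iff_bijections iso_tuple_UNIV_I lessThan_iff)
  \<comment> \<open>The first n rows encode \<open>alpha v - beta w = 0\<close>, the last n rows
    \<open>alpha v - gamma u - delta w = 0\<close>. The columns form four blocks of widths
    \<open>p\<close>, \<open>q\<close>, \<open>r\<close>, \<open>s\<close>, one for each coefficient
    vector.\<close>
  define e where "e = (\<lambda>i j (u :: nat \<Rightarrow> complex^'n, v :: nat \<Rightarrow> complex^'n, w :: nat \<Rightarrow> complex^'n).
    if i < ?n then
      (if j < p then v j $ \<iota> i else if j < p + q then - (w (j - p) $ \<iota> i) else 0)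
    else
      (if j < p then v j $ \<iota> (i - ?n) else if j < p + q then 0
       else if j < p + q + r then - (u (j - p - q) $ \<iota> (i - ?n))
       else - (w (j - p - q - r) $ \<iota> (i - ?n))))"
  have e_poly: "e i j \<in> poly_funs flag_coords" if "j < 2 * ?n" for i j
  proof -
    have c: "(\<lambda>(u, v, w). u j $ a) \<in> poly_funs flag_coords"
      "(\<lambda>(u, v, w). v j $ a) \<in> poly_funs flag_coords"
      "(\<lambda>(u, v, w). w j $ a) \<in> poly_funs flag_coords" if "j < ?n" for j and a :: 'n
      using that by (auto intro!: poly_funs.coord simp: flag_coords_def)
    have m: "(\<lambda>(u, v, w). - (u j $ a)) \<in> poly_funs flag_coords"
      "(\<lambda>(u, v, w). - (w j $ a)) \<in> poly_funs flag_coords" if "j < ?n" for j and a :: 'n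
      using poly_funs_uminus[OF c(1)[OF that]] poly_funs_uminus[OF c(3)[OF that]]
      by (simp_all add: case_prod_unfold)
    have z0: "(\<lambda>(u, v, w). 0) \<in> poly_funs flag_coords"
      using poly_funs.const[of 0] by (simp add: case_prod_unfold)
    consider "j < p" | "\<not> j < p" "j < p + q" | "\<not> j < p + q" "j < p + q + r" | "\<not> j < p + q + r" by linarith
    then show ?thesis
    proof cases
      case 1
      then show ?thesis using le c(2)[of j] by (cases "i < ?n") (simp_all add: e_def)
    next
      case 2
      then have "j - p < ?n" using le by linarith
      with 2 show ?thesis using m(2)[of "j - p"] z0 by (cases "i < ?n") (simp_all add: e_def)
    next
      case 3
      then have "j - p - q < ?n" using le by linarith
      with 3 show ?thesis using m(1)[of "j - p - q"] z0 by (cases "i < ?n") (simp_all add: e_def)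
    next
      case 4
      then have "j - p - q - r < ?n" using le that N by linarith
      with 4 show ?thesis using m(2)[of "j - p - q - r"] z0 by (cases "i < ?n") (simp_all add: e_def)
    qed
  qed
  have key: "Determinant.det (mat (2 * ?n) (2 * ?n) (\<lambda>(i, j). e i j x)) \<noteq> 0 \<longleftrightarrow> nondegenerate p q r s x" for x
  proof -
    obtain u v w where x: "x = (u, v, w)" by (cases x)
    have sys: "(\<forall>i<2 * ?n. (\<Sum>j<2 * ?n. e i j x * \<xi> j) = 0) \<longleftrightarrow>
      (\<Sum>j<p. \<xi> j *s v j) = (\<Sum>j<q. \<xi> (p + j) *s w j) \<and>
      (\<Sum>j<p. \<xi> j *s v j) = (\<Sum>j<r. \<xi> (p + q + j) *s u j) + (\<Sum>j<s. \<xi> (p + q + r + j) *s w j)"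
      (is "?L \<longleftrightarrow> ?R1 \<and> ?R2") for \<xi>
    proof -
      have sp: "(\<Sum>j<2 * ?n. e i j x * \<xi> j) = (\<Sum>j<p. e i j x * \<xi> j) + (\<Sum>j<q. e i (p + j) x * \<xi> (p + j))
        + (\<Sum>j<r. e i (p + q + j) x * \<xi> (p + q + j)) + (\<Sum>j<s. e i (p + q + r + j) x * \<xi> (p + q + r + j))" for i
        unfolding N[symmetric] by (simp add: sum_lessThan_split)
      have top: "(\<Sum>j<2 * ?n. e i j x * \<xi> j) =
        ((\<Sum>j<p. \<xi> j *s v j) - (\<Sum>j<q. \<xi> (p + j) *s w j)) $ \<iota> i" if "i < ?n" for i
        unfolding sp using that by (simp add: e_def x sum_negf mult.commute)
      have bot: "(\<Sum>j<2 * ?n. e (?n + i) j x * \<xi> j) =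
        ((\<Sum>j<p. \<xi> j *s v j) - ((\<Sum>j<r. \<xi> (p + q + j) *s u j) + (\<Sum>j<s. \<xi> (p + q + r + j) *s w j))) $ \<iota> i" for i
        unfolding sp by (simp add: e_def x sum_negf mult.commute)
      have "?L \<longleftrightarrow> (\<forall>i<?n. (\<Sum>j<2 * ?n. e i j x * \<xi> j) = 0) \<and> (\<forall>i<?n. (\<Sum>j<2 * ?n. e (?n + i) j x * \<xi> j) = 0)"
      proof safe
        fix i assume a: "\<forall>i<?n. (\<Sum>j<2 * ?n. e i j x * \<xi> j) = 0" "\<forall>i<?n. (\<Sum>j<2 * ?n. e (?n + i) j x * \<xi> j) = 0"
          "i < 2 * ?n"
        show "(\<Sum>j<2 * ?n. e i j x * \<xi> j) = 0"
        proof (cases "i < ?n")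
          case False
          then have "i - ?n < ?n" "?n + (i - ?n) = i" using a(3) by auto
          then show ?thesis using a(2) by metis
        qed (use a in auto)
      qed auto
      also have "(\<forall>i<?n. (\<Sum>j<2 * ?n. e i j x * \<xi> j) = 0) \<longleftrightarrow> ?R1"
        using top all_\<iota>[of "\<lambda>a. ((\<Sum>j<p. \<xi> j *s v j) - (\<Sum>j<q. \<xi> (p + j) *s w j)) $ a = 0"]
        by (simp add: Finite_Cartesian_Product.vec_eq_iff)
      also have "(\<forall>i<?n. (\<Sum>j<2 * ?n. e (?n + i) j x * \<xi> j) = 0) \<longleftrightarrow> ?R2"
        using bot all_\<iota>[of "\<lambda>a. ((\<Sum>j<p. \<xi> j *s v j) - ((\<Sum>j<r. \<xi> (p + q + j) *s u j) + (\<Sum>j<s. \<xi> (p + q + r + j) *s w j))) $ a = 0"]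
        by (simp add: Finite_Cartesian_Product.vec_eq_iff)
      finally show ?thesis .
    qed
    show ?thesis
    proof
      assume d: "Determinant.det (mat (2 * ?n) (2 * ?n) (\<lambda>(i, j). e i j x)) \<noteq> 0"
      show "nondegenerate p q r s x"
        unfolding nondegenerate_def x prod.case
      proof (intro allI impI)
        fix \<alpha> \<beta> \<gamma> \<delta>
        assume a: "(\<Sum>j<p. \<alpha> j *s v j) = (\<Sum>j<q. \<beta> j *s w j)"
          "(\<Sum>j<p. \<alpha> j *s v j) = (\<Sum>j<r. \<gamma> j *s u j) + (\<Sum>j<s. \<delta> j *s w j)"
        define \<xi> where "\<xi> j = (if j < p then \<alpha> j else if j < p + q then \<beta> (j - p)
          else if j < p + q + r then \<gamma> (j - p - q) else \<delta> (j - p - q - r))" for j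
        have \<xi>: "\<And>j. j < p \<Longrightarrow> \<xi> j = \<alpha> j" "\<And>j. j < q \<Longrightarrow> \<xi> (p + j) = \<beta> j"
          "\<And>j. j < r \<Longrightarrow> \<xi> (p + q + j) = \<gamma> j" "\<And>j. j < s \<Longrightarrow> \<xi> (p + q + r + j) = \<delta> j"
          by (auto simp: \<xi>_def)
        have "\<forall>i<2 * ?n. (\<Sum>j<2 * ?n. e i j x * \<xi> j) = 0"
          unfolding sys using a by (simp add: \<xi> cong: sum.cong_simp)
        then have 0: "\<forall>j<2 * ?n. \<xi> j = 0" using d[unfolded det_nonzero_iff] by blast
        have "j < 2 * ?n" if "j < p" for j using that N by linarith
        moreover have "p + j < 2 * ?n" if "j < q" for j using that N by linarith
        moreover have "p + q + j < 2 * ?n" if "j < r" for j using that N by linarith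
        moreover have "p + q + r + j < 2 * ?n" if "j < s" for j using that N by linarith
        ultimately show "(\<forall>j<p. \<alpha> j = 0) \<and> (\<forall>j<q. \<beta> j = 0) \<and> (\<forall>j<r. \<gamma> j = 0) \<and> (\<forall>j<s. \<delta> j = 0)"
          using 0 \<xi> by metis
      qed
    next
      assume nd: "nondegenerate p q r s x"
      show "Determinant.det (mat (2 * ?n) (2 * ?n) (\<lambda>(i, j). e i j x)) \<noteq> 0"
        unfolding det_nonzero_iff sys
      proof (intro allI impI)
        fix \<xi> j
        assume a: "(\<Sum>j<p. \<xi> j *s v j) = (\<Sum>j<q. \<xi> (p + j) *s w j) \<and>
          (\<Sum>j<p. \<xi> j *s v j) = (\<Sum>j<r. \<xi> (p + q + j) *s u j) + (\<Sum>j<s. \<xi> (p + q + r + j) *s w j)"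
          and j: "j < 2 * ?n"
        have 0: "\<forall>j<p. \<xi> j = 0" "\<forall>j<q. \<xi> (p + j) = 0" "\<forall>j<r. \<xi> (p + q + j) = 0"
          "\<forall>j<s. \<xi> (p + q + r + j) = 0"
          using nd[unfolded nondegenerate_def x prod.case, rule_format, of \<xi> "\<lambda>j. \<xi> (p + j)"
            "\<lambda>j. \<xi> (p + q + j)" "\<lambda>j. \<xi> (p + q + r + j)"] a by blast+
        consider "j < p" | "j - p < q" "j = p + (j - p)" | "j - p - q < r" "j = p + q + (j - p - q)"
          | "j - p - q - r < s" "j = p + q + r + (j - p - q - r)"
          using j N by linarith
        then show "\<xi> j = 0" using 0 by cases metis+
      qed
    qed
  qed
  show ?thesis
    unfolding generally_def using key z e_poly
    by (intro bexI[of _ "\<lambda>x. Determinant.det (mat (2 * ?n) (2 * ?n) (\<lambda>(i, j). e i j x))"] conjI exI[of _ z]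
        poly_funs_det) auto
qed

text \<open>The three patterns are the transversality conditions used later: F against H, G against
  H, and the line \<open>G_(k+1-m) \<inter> H_(l+m)\<close> against the hyperplane
  \<open>F_(k+i-1) + H_(l-i)\<close>. Flags of coordinate subspaces realize each of them.\<close>

lemma nondegenerate_example:
  fixes k l :: nat
  assumes n: "CARD('n::finite) = l + k"
    and pqrs: "(p = 0 \<and> q = l + k \<and> r + s = l + k) \<or> (r = 0 \<and> s = l + k \<and> p + q = l + k) \<or>
      (1 \<le> i \<and> i \<le> l \<and> 1 \<le> m \<and> m \<le> k \<and> p = k + 1 - m \<and> q = l + m \<and> r = k + i - 1 \<and> s = l - i)"
  shows "\<exists>z :: (nat \<Rightarrow> complex^'n) \<times> (nat \<Rightarrow> complex^'n) \<times> (nat \<Rightarrow> complex^'n). nondegenerate p q r s z"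
proof -
  let ?n = "l + k"
  obtain \<iota> :: "nat \<Rightarrow> 'n" where \<iota>: "bij_betw \<iota> {..<?n} UNIV"
    using ex_bij_betw_nat_finite[of "UNIV :: 'n set"] n by (auto simp: lessThan_atLeast0)
  have inj: "\<iota> a = \<iota> b \<longleftrightarrow> a = b" if "a < ?n" "b < ?n" for a b
    using \<iota> that by (auto simp: bij_betw_def inj_on_def)
  define E :: "nat \<Rightarrow> complex^'n" where "E j = axis (\<iota> j) 1" for j
  have comp: "(\<Sum>j<a. c j *s E (\<theta> j)) $ \<iota> t = (\<Sum>j<a. if \<theta> j = t then c j else 0)"
    if "t < ?n" "\<And>j. j < a \<Longrightarrow> \<theta> j < ?n" for a :: nat and c \<theta> t
    using that by (auto simp: E_def axis_def inj intro!: sum.cong)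
  have comp1: "(\<Sum>j<a. c j *s E (\<theta> j)) $ \<iota> (\<theta> j') = c j'"
    if "j' < a" "\<And>j. j < a \<Longrightarrow> \<theta> j < ?n" "inj_on \<theta> {..<a}" for a :: nat and c \<theta> j'
  proof -
    have "(\<Sum>j<a. if \<theta> j = \<theta> j' then c j else 0) = (\<Sum>j<a. if j = j' then c j else 0)"
      using that by (intro sum.cong) (auto simp: inj_on_def)
    then show ?thesis using that by (subst comp) auto
  qed
  have comp0: "(\<Sum>j<a. c j *s E (\<theta> j)) $ \<iota> t = 0"
    if "t < ?n" "\<And>j. j < a \<Longrightarrow> \<theta> j < ?n" "\<And>j. j < a \<Longrightarrow> \<theta> j \<noteq> t" for a :: nat and c \<theta> t
    using that by (subst comp) (auto intro: sum.neutral)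
  have E_indep: "c j = 0" if "(\<Sum>j<a. c j *s E j) = 0" "j < a" "a \<le> ?n" for a :: nat and c j
  proof -
    have "(\<Sum>j<a. c j *s E j) $ \<iota> j = c j"
      using that by (intro comp1[of _ _ "\<lambda>j. j"]) auto
    then show ?thesis using that(1) by (metis zero_index)
  qed
  \<comment> \<open>The standard basis in reversed order: the flags of \<open>?u\<close> and
    \<open>E\<close> are opposite.\<close>
  define \<rho> where "\<rho> j = ?n - 1 - j" for j
  have \<rho>: "\<rho> j < ?n" "inj_on \<rho> {..<a}" if "j < a" "a \<le> ?n" for j a
    using that by (auto simp: \<rho>_def inj_on_def)
  let ?u = "\<lambda>j. E (\<rho> j)"
  consider "p = 0" "q = ?n" "r + s = ?n" | "r = 0" "s = ?n" "p + q = ?n"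
    | "1 \<le> i" "i \<le> l" "1 \<le> m" "m \<le> k" "p = k + 1 - m" "q = l + m" "r = k + i - 1" "s = l - i"
    using pqrs by blast
  then show ?thesis
  proof cases
    case 1
    have "nondegenerate p q r s (?u, ?u, E)"
      unfolding nondegenerate_def prod.case
    proof (intro allI impI conjI)
      fix \<alpha> \<beta> \<gamma> \<delta> j
      assume a: "(\<Sum>j<p. \<alpha> j *s ?u j) = (\<Sum>j<q. \<beta> j *s E j)"
        and b: "(\<Sum>j<p. \<alpha> j *s ?u j) = (\<Sum>j<r. \<gamma> j *s ?u j) + (\<Sum>j<s. \<delta> j *s E j)"
      show "\<alpha> j = 0" if "j < p" using that 1 by simp
      show "\<beta> j = 0" if "j < q"
        using E_indep[of \<beta> q j] a 1 that by simp
      show "\<gamma> j = 0" if "j < r"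
      proof -
        have "(\<Sum>j<s. \<delta> j *s E j) $ \<iota> (\<rho> j) = 0"
          using 1 that \<rho>[of j r] by (intro comp0) (auto simp: \<rho>_def)
        moreover have "(\<Sum>j<r. \<gamma> j *s ?u j) $ \<iota> (\<rho> j) = \<gamma> j"
          using 1 that \<rho>[of _ r] by (intro comp1) auto
        ultimately show ?thesis using arg_cong[OF b, of "\<lambda>x. x $ \<iota> (\<rho> j)"] 1 by (simp del: sum_component)
      qed
      show "\<delta> j = 0" if "j < s"
      proof -
        have "(\<Sum>j<r. \<gamma> j *s ?u j) $ \<iota> j = 0"
          using 1 that \<rho>[of _ r] by (intro comp0) (auto simp: \<rho>_def)
        moreover have "(\<Sum>j<s. \<delta> j *s E j) $ \<iota> j = \<delta> j"
          using 1 that by (intro comp1[of _ _ "\<lambda>j. j"]) auto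
        ultimately show ?thesis using arg_cong[OF b, of "\<lambda>x. x $ \<iota> j"] 1 by (simp del: sum_component)
      qed
    qed
    then show ?thesis by blast
  next
    case 2
    have "nondegenerate p q r s (?u, ?u, E)"
      unfolding nondegenerate_def prod.case
    proof (intro allI impI conjI)
      fix \<alpha> \<beta> \<gamma> \<delta> j
      assume a: "(\<Sum>j<p. \<alpha> j *s ?u j) = (\<Sum>j<q. \<beta> j *s E j)"
        and b: "(\<Sum>j<p. \<alpha> j *s ?u j) = (\<Sum>j<r. \<gamma> j *s ?u j) + (\<Sum>j<s. \<delta> j *s E j)"
      have \<alpha>: "\<alpha> j = 0" if "j < p" for j
      proof -
        have "(\<Sum>j<q. \<beta> j *s E j) $ \<iota> (\<rho> j) = 0"
          using 2 that \<rho>[of j p] by (intro comp0) (auto simp: \<rho>_def)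
        moreover have "(\<Sum>j<p. \<alpha> j *s ?u j) $ \<iota> (\<rho> j) = \<alpha> j"
          using 2 that \<rho>[of _ p] by (intro comp1) auto
        ultimately show ?thesis using arg_cong[OF a, of "\<lambda>x. x $ \<iota> (\<rho> j)"] by (simp del: sum_component)
      qed
      then show "\<alpha> j = 0" if "j < p" using that .
      have z: "(\<Sum>j<p. \<alpha> j *s ?u j) = 0" by (simp add: \<alpha>)
      show "\<beta> j = 0" if "j < q"
        using E_indep[of \<beta> q j] a z 2 that by simp
      show "\<gamma> j = 0" if "j < r" using that 2 by simp
      show "\<delta> j = 0" if "j < s"
        using E_indep[of \<delta> s j] b z 2 that by simp
    qed
    then show ?thesis by blast
  next
    case 3
    \<comment> \<open>The first \<open>r\<close> vectors of \<open>?u\<close> and the first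
      \<open>s\<close> vectors of \<open>E\<close> span the hyperplane that misses exactly the basis
      vector number \<open>s\<close>. So \<open>v\<close> begins with this vector and goes on with
      the last ones, down to number \<open>l + m\<close>, which stay clear of the first
      \<open>l + m\<close> vectors of \<open>E\<close>.\<close>
    define \<theta> where "\<theta> j = (if j = 0 then s else ?n - j)" for j
    have \<theta>: "\<theta> j < ?n" "inj_on \<theta> {..<p}" if "j < p" for j
      using that 3 by (auto simp: \<theta>_def inj_on_def split: if_splits)
    have "nondegenerate p q r s (?u, \<lambda>j. E (\<theta> j), E)"
      unfolding nondegenerate_def prod.case
    proof (intro allI impI conjI)
      fix \<alpha> \<beta> \<gamma> \<delta> j
      assume a: "(\<Sum>j<p. \<alpha> j *s E (\<theta> j)) = (\<Sum>j<q. \<beta> j *s E j)"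
        and b: "(\<Sum>j<p. \<alpha> j *s E (\<theta> j)) = (\<Sum>j<r. \<gamma> j *s ?u j) + (\<Sum>j<s. \<delta> j *s E j)"
      have \<alpha>: "\<alpha> j = 0" if "j < p" for j
      proof (cases "j = 0")
        case True
        have "(\<Sum>j<r. \<gamma> j *s ?u j) $ \<iota> s = 0"
          using 3 \<rho>[of _ r] by (intro comp0) (auto simp: \<rho>_def)
        moreover have "(\<Sum>j<s. \<delta> j *s E j) $ \<iota> s = 0"
          using 3 by (intro comp0) auto
        moreover have "(\<Sum>j<p. \<alpha> j *s E (\<theta> j)) $ \<iota> (\<theta> j) = \<alpha> j"
          using that \<theta> by (intro comp1) auto
        ultimately show ?thesis using arg_cong[OF b, of "\<lambda>x. x $ \<iota> s"] True by (simp add: \<theta>_def del: sum_component)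
      next
        case False
        have "(\<Sum>j<q. \<beta> j *s E j) $ \<iota> (\<theta> j) = 0"
          using 3 that \<theta>[of j] False by (intro comp0) (auto simp: \<theta>_def)
        moreover have "(\<Sum>j<p. \<alpha> j *s E (\<theta> j)) $ \<iota> (\<theta> j) = \<alpha> j"
          using that \<theta> by (intro comp1) auto
        ultimately show ?thesis using arg_cong[OF a, of "\<lambda>x. x $ \<iota> (\<theta> j)"] by (simp del: sum_component)
      qed
      then show "\<alpha> j = 0" if "j < p" using that .
      have z: "(\<Sum>j<p. \<alpha> j *s E (\<theta> j)) = 0" by (simp add: \<alpha>)
      show "\<beta> j = 0" if "j < q"
        using E_indep[of \<beta> q j] a z 3 that by simp
      show "\<gamma> j = 0" if "j < r"
      proof -
        have "(\<Sum>j<s. \<delta> j *s E j) $ \<iota> (\<rho> j) = 0"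
          using 3 that \<rho>[of j r] by (intro comp0) (auto simp: \<rho>_def)
        moreover have "(\<Sum>j<r. \<gamma> j *s ?u j) $ \<iota> (\<rho> j) = \<gamma> j"
          using 3 that \<rho>[of _ r] by (intro comp1) auto
        ultimately show ?thesis using arg_cong[OF b, of "\<lambda>x. x $ \<iota> (\<rho> j)"] z by (simp del: sum_component)
      qed
      show "\<delta> j = 0" if "j < s"
      proof -
        have "(\<Sum>j<r. \<gamma> j *s ?u j) $ \<iota> j = 0"
          using 3 that \<rho>[of _ r] by (intro comp0) (auto simp: \<rho>_def)
        moreover have "(\<Sum>j<s. \<delta> j *s E j) $ \<iota> j = \<delta> j"
          using 3 that by (intro comp1[of _ _ "\<lambda>j. j"]) auto
        ultimately show ?thesis using arg_cong[OF b, of "\<lambda>x. x $ \<iota> j"] z by (simp del: sum_component)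
      qed
    qed
    then show ?thesis by blast
  qed
qed

section \<open>Bases and flags\<close>

lemma span_family:
  fixes u :: "nat \<Rightarrow> complex^'n"
  shows "vec.span (u ` {..<a}) = {x. \<exists>\<alpha>. x = (\<Sum>j<a. \<alpha> j *s u j)}"
proof (induction a)
  case (Suc a)
  have "vec.span (u ` {..<Suc a}) = {x. \<exists>c. x - c *s u a \<in> vec.span (u ` {..<a})}"
    by (simp add: lessThan_Suc vec.span_insert)
  also have "\<dots> = {x. \<exists>\<alpha>. x = (\<Sum>j<Suc a. \<alpha> j *s u j)}"
  proof safe
    fix x c assume "x - c *s u a \<in> vec.span (u ` {..<a})"
    then obtain \<alpha> where \<alpha>: "x - c *s u a = (\<Sum>j<a. \<alpha> j *s u j)" using Suc by auto
    have "(\<Sum>j<a. (\<alpha>(a := c)) j *s u j) = (\<Sum>j<a. \<alpha> j *s u j)" by (rule sum.cong) auto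
    then show "\<exists>\<alpha>. x = (\<Sum>j<Suc a. \<alpha> j *s u j)"
      using \<alpha> by (intro exI[of _ "\<alpha>(a := c)"]) (simp add: algebra_simps)
  next
    fix \<alpha>
    show "\<exists>c. (\<Sum>j<Suc a. \<alpha> j *s u j) - c *s u a \<in> vec.span (u ` {..<a})"
      using Suc by (intro exI[of _ "\<alpha> a"]) auto
  qed
  finally show ?case .
qed simp

text \<open>Flags and Pluecker coordinates are built on indexed families, the dimension theory on
  sets; the absence of relations also rules out repeated vectors.\<close>

lemma independent_family_iff:
  fixes v :: "nat \<Rightarrow> complex^'n"
  shows "inj_on v {..<l} \<and> vec.independent (v ` {..<l}) \<longleftrightarrow>
    (\<forall>\<alpha>. (\<Sum>j<l. \<alpha> j *s v j) = 0 \<longrightarrow> (\<forall>j<l. \<alpha> j = 0))"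
proof (intro iffI)
  assume a: "inj_on v {..<l} \<and> vec.independent (v ` {..<l})"
  show "\<forall>\<alpha>. (\<Sum>j<l. \<alpha> j *s v j) = 0 \<longrightarrow> (\<forall>j<l. \<alpha> j = 0)"
  proof (intro allI impI)
    fix \<alpha> j assume 0: "(\<Sum>j<l. \<alpha> j *s v j) = 0" and j: "j < l"
    have "(\<Sum>x\<in>v ` {..<l}. \<alpha> (inv_into {..<l} v x) *s x) = (\<Sum>j<l. \<alpha> j *s v j)"
      using a by (subst sum.reindex) auto
    with 0 have "(\<Sum>x\<in>v ` {..<l}. \<alpha> (inv_into {..<l} v x) *s x) = 0" by metis
    then have "\<alpha> (inv_into {..<l} v (v j)) = 0"
      by (rule vec.independentD[rotated 3]) (use a j in auto)
    then show "\<alpha> j = 0" using a j by simp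
  qed
next
  assume a: "\<forall>\<alpha>. (\<Sum>j<l. \<alpha> j *s v j) = 0 \<longrightarrow> (\<forall>j<l. \<alpha> j = 0)"
  have inj: "inj_on v {..<l}"
  proof (rule inj_onI, rule ccontr)
    fix i j assume ij: "i \<in> {..<l}" "j \<in> {..<l}" "v i = v j" "i \<noteq> j"
    define \<alpha> where "\<alpha> = (\<lambda>t. if t = i then 1 else if t = j then -1 else (0::complex))"
    have "(\<Sum>t<l. \<alpha> t *s v t) = (\<Sum>t\<in>{i, j}. \<alpha> t *s v t)"
      using ij by (intro sum.mono_neutral_right) (auto simp: \<alpha>_def)
    also have "\<dots> = 0" using ij by (simp add: \<alpha>_def)
    finally have "\<alpha> i = 0" using a ij by blast
    then show False by (simp add: \<alpha>_def)
  qed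
  moreover have "vec.independent (v ` {..<l})"
  proof (subst vec.independent_explicit_finite_subsets, intro allI impI ballI)
    fix A c x assume A: "A \<subseteq> v ` {..<l}" "finite A" "(\<Sum>x\<in>A. c x *s x) = 0" "x \<in> A"
    define \<alpha> where "\<alpha> j = (if v j \<in> A then c (v j) else 0)" for j
    have "(\<Sum>j<l. \<alpha> j *s v j) = (\<Sum>x\<in>v ` {..<l}. (if x \<in> A then c x else 0) *s x)"
      using inj by (subst sum.reindex) (auto simp: \<alpha>_def)
    also have "\<dots> = (\<Sum>x\<in>A. c x *s x)"
      using A by (intro sum.mono_neutral_cong_right) auto
    finally have "\<forall>j<l. \<alpha> j = 0" using a A(3) by auto
    moreover obtain j where j: "x = v j" "j < l" using A(1,4) by auto
    ultimately have "\<alpha> j = 0" by blast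
    then show "c x = 0" using j(1) A(4) by (simp add: \<alpha>_def)
  qed
  ultimately show "inj_on v {..<l} \<and> vec.independent (v ` {..<l})" ..
qed

lemma basis_of_iff:
  "basis_of l v V \<longleftrightarrow> (\<forall>\<alpha>. (\<Sum>j<l. \<alpha> j *s v j) = 0 \<longrightarrow> (\<forall>j<l. \<alpha> j = 0)) \<and>
    V = {x. \<exists>\<alpha>. x = (\<Sum>j<l. \<alpha> j *s v j)}"
proof -
  have e: "vec.span (v ` {..<l}) = {x. \<exists>\<alpha>. x = (\<Sum>j<l. \<alpha> j *s v j)}"
    by (rule span_family)
  show ?thesis
    unfolding basis_of_def e independent_family_iff[symmetric]
    by (rule iffI; elim conjE; intro conjI; (assumption | rule sym, assumption))
qed

lemma basis_of_Gr: "basis_of l v V \<Longrightarrow> V \<in> Gr l"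
  unfolding basis_of_def Gr_def
  by (auto simp: vec.dim_eq_card_independent card_image)

lemma basis_of_mem: "basis_of l v V \<Longrightarrow> i < l \<Longrightarrow> v i \<in> V"
  unfolding basis_of_def by (auto intro: vec.span_base)

lemma exists_basis_of:
  assumes "V \<in> Gr l"
  obtains v where "basis_of l v V"
proof -
  from assms have V: "vec.subspace V" "vec.dim V = l" by (auto simp: Gr_def)
  obtain B where B: "B \<subseteq> V" "vec.independent B" "vec.span B = V" "card B = l"
    using vec.basis_subspace_exists[OF V(1)] V(2) by metis
  have "finite B" using B(2) by (rule vec.finiteI_independent)
  then obtain v where "bij_betw v {..<l} B"
    using B(4) ex_bij_betw_nat_finite by (metis lessThan_atLeast0)
  then show ?thesis using that[of v] B by (auto simp: basis_of_def bij_betw_def)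
qed

lemma basis_of_dim_eq:
  assumes "\<And>i. i < l \<Longrightarrow> v i \<in> V" "V \<in> Gr l"
    and "\<And>\<alpha> j. (\<Sum>j<l. \<alpha> j *s v j) = 0 \<Longrightarrow> j < l \<Longrightarrow> \<alpha> j = 0"
  shows "basis_of l v V"
proof -
  have i: "inj_on v {..<l}" "vec.independent (v ` {..<l})"
    using independent_family_iff[of v l] assms(3) by blast+
  have s: "vec.span (v ` {..<l}) \<subseteq> V"
    using assms(1,2) by (intro vec.span_minimal) (auto simp: Gr_def)
  have "vec.dim (vec.span (v ` {..<l})) = l"
    using i by (simp add: vec.dim_span_eq_card_independent card_image del: vec.dim_span)
  then have "vec.span (v ` {..<l}) = V"
    using vec.subspace_dim_equal[OF vec.subspace_span _ s] assms(2) by (auto simp: Gr_def)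
  then show ?thesis using i by (simp add: basis_of_def)
qed

text \<open>Collects the consequences of genericity that the counts use. The last clause says that
  the line \<open>G (k + 1 - m) \<inter> H (l + m)\<close> is not contained in the hyperplane
  \<open>F (k + i - 1) + H (l - i)\<close>, whose elements are written as
  \<open>x + y\<close>.\<close>

definition in_general_position ::
  "nat \<Rightarrow> nat \<Rightarrow> (nat \<Rightarrow> (complex^'n) set) \<Rightarrow> (nat \<Rightarrow> (complex^'n) set) \<Rightarrow> (nat \<Rightarrow> (complex^'n) set) \<Rightarrow> bool"
  where
  "in_general_position l k F G H \<longleftrightarrow>
    (\<forall>X \<in> {F, G, H}. mono X \<and> (\<forall>j \<le> l + k. vec.subspace (X j) \<and> vec.dim (X j) = j)) \<and>
    (\<forall>a b. a + b \<le> l + k \<longrightarrow> F a \<inter> H b \<subseteq> {0} \<and> G a \<inter> H b \<subseteq> {0}) \<and>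
    (\<forall>i m x y. 1 \<le> i \<longrightarrow> i \<le> l \<longrightarrow> 1 \<le> m \<longrightarrow> m \<le> k \<longrightarrow> x \<in> F (k + i - 1) \<longrightarrow> y \<in> H (l - i) \<longrightarrow>
      x + y \<in> G (k + 1 - m) \<inter> H (l + m) \<longrightarrow> x + y = 0)"

lemma flag_iff: "x \<in> flag u a \<longleftrightarrow> (\<exists>\<alpha>. x = (\<Sum>j<a. \<alpha> j *s u j))"
  unfolding flag_def span_family by simp

lemma mono_flag: "mono (flag u)"
  unfolding flag_def by (intro monoI vec.span_mono image_mono) auto

lemma nondegenerateD:
  assumes "nondegenerate p q r s (u, v, w)"
    and "(\<Sum>j<p. \<alpha> j *s v j) = (\<Sum>j<q. \<beta> j *s w j)"
    and "(\<Sum>j<p. \<alpha> j *s v j) = (\<Sum>j<r. \<gamma> j *s u j) + (\<Sum>j<s. \<delta> j *s w j)"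
  shows "\<forall>j<p. \<alpha> j = 0" "\<forall>j<q. \<beta> j = 0" "\<forall>j<r. \<gamma> j = 0" "\<forall>j<s. \<delta> j = 0"
proof -
  note * = assms(1)[unfolded nondegenerate_def prod.case, THEN spec, THEN spec, THEN spec, THEN spec,
      THEN mp, THEN mp, OF assms(2,3)]
  show "\<forall>j<p. \<alpha> j = 0" by (rule conjunct1[OF *])
  show "\<forall>j<q. \<beta> j = 0" by (rule conjunct1[OF conjunct2[OF *]])
  show "\<forall>j<r. \<gamma> j = 0" by (rule conjunct1[OF conjunct2[OF conjunct2[OF *]]])
  show "\<forall>j<s. \<delta> j = 0" by (rule conjunct2[OF conjunct2[OF conjunct2[OF *]]])
qed

lemma nondegenerate_flags:
  fixes u v w :: "nat \<Rightarrow> complex^'n::finite"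
  assumes n: "CARD('n) = l + k"
    and FH: "\<forall>r \<le> l + k. nondegenerate 0 (l + k) r (l + k - r) (u, v, w)"
    and GH: "\<forall>p \<le> l + k. nondegenerate p (l + k - p) 0 (l + k) (u, v, w)"
    and FGH: "\<forall>i \<in> {1..l}. \<forall>m \<in> {1..k}. nondegenerate (k + 1 - m) (l + m) (k + i - 1) (l - i) (u, v, w)"
  shows "basis_of (l + k) u UNIV" "basis_of (l + k) v UNIV" "basis_of (l + k) w UNIV"
    and "in_general_position l k (flag u) (flag v) (flag w)"
proof -
  have indep: "\<forall>\<alpha>. (\<Sum>j<l + k. \<alpha> j *s u j) = 0 \<longrightarrow> (\<forall>j<l + k. \<alpha> j = 0)"
    "\<forall>\<alpha>. (\<Sum>j<l + k. \<alpha> j *s v j) = 0 \<longrightarrow> (\<forall>j<l + k. \<alpha> j = 0)"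
    "\<forall>\<alpha>. (\<Sum>j<l + k. \<alpha> j *s w j) = 0 \<longrightarrow> (\<forall>j<l + k. \<alpha> j = 0)"
  proof -
    \<comment> \<open>For \<open>r = n\<close> and \<open>s = 0\<close> the second equation of the
      system is a relation among the vectors of \<open>u\<close> alone.\<close>
    show "\<forall>\<alpha>. (\<Sum>j<l + k. \<alpha> j *s u j) = 0 \<longrightarrow> (\<forall>j<l + k. \<alpha> j = 0)"
    proof (intro allI impI)
      fix \<alpha> j assume "(\<Sum>j<l + k. \<alpha> j *s u j) = 0" "j < l + k"
      then show "\<alpha> j = 0"
        using FH[rule_format, of "l + k", unfolded nondegenerate_def prod.case, rule_format, of "\<lambda>_. 0" "\<lambda>_. 0" \<alpha> "\<lambda>_. 0"]
        by simp
    qed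
    show "\<forall>\<alpha>. (\<Sum>j<l + k. \<alpha> j *s v j) = 0 \<longrightarrow> (\<forall>j<l + k. \<alpha> j = 0)"
    proof (intro allI impI)
      fix \<alpha> j assume "(\<Sum>j<l + k. \<alpha> j *s v j) = 0" "j < l + k"
      then show "\<alpha> j = 0"
        using GH[rule_format, of "l + k", unfolded nondegenerate_def prod.case, rule_format, of \<alpha> "\<lambda>_. 0" "\<lambda>_. 0" "\<lambda>_. 0"]
        by simp
    qed
    show "\<forall>\<alpha>. (\<Sum>j<l + k. \<alpha> j *s w j) = 0 \<longrightarrow> (\<forall>j<l + k. \<alpha> j = 0)"
    proof (intro allI impI)
      fix \<alpha> j assume "(\<Sum>j<l + k. \<alpha> j *s w j) = 0" "j < l + k"
      then show "\<alpha> j = 0"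
        using FH[rule_format, of 0, unfolded nondegenerate_def prod.case, rule_format, of "\<lambda>_. 0" "\<alpha>" "\<lambda>_. 0" "\<lambda>_. 0"]
        by simp
    qed
  qed
  have U: "(UNIV :: (complex^'n) set) \<in> Gr (l + k)" by (simp add: Gr_def vec_dim_card n del: vec.dim_UNIV)
  show "basis_of (l + k) u UNIV" "basis_of (l + k) v UNIV" "basis_of (l + k) w UNIV"
    using indep U by (auto intro!: basis_of_dim_eq)
  have dim: "vec.dim (flag x j) = j"
    if x: "\<forall>\<alpha>. (\<Sum>j<l + k. \<alpha> j *s x j) = 0 \<longrightarrow> (\<forall>j<l + k. \<alpha> j = 0)" and j: "j \<le> l + k"
    for x :: "nat \<Rightarrow> complex^'n" and j
  proof -
    have "inj_on x {..<l + k}" "vec.independent (x ` {..<l + k})"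
      using x independent_family_iff[of x "l + k"] by blast+
    moreover have "{..<j} \<subseteq> {..<l + k}" using j by simp
    ultimately have xj: "inj_on x {..<j} \<and> vec.independent (x ` {..<j})"
      by (meson inj_on_subset image_mono vec.independent_mono)
    then have "vec.dim (vec.span (x ` {..<j})) = card (x ` {..<j})"
      by (intro vec.dim_span_eq_card_independent) simp
    then show ?thesis using xj by (simp add: flag_def card_image)
  qed
  have FH0: "flag u a \<inter> flag w b \<subseteq> {0}" if ab: "a + b \<le> l + k" for a b
  proof
    fix x assume "x \<in> flag u a \<inter> flag w b"
    then have "x \<in> flag u a" "x \<in> flag w b" by auto
    \<comment> \<open>Enlarging \<open>b\<close> to \<open>n - a\<close> makes the system
      square.\<close>
    moreover have "flag w b \<subseteq> flag w (l + k - a)" by (rule monoD[OF mono_flag]) (use ab in simp)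
    ultimately have "x \<in> flag u a" "x \<in> flag w (l + k - a)" by auto
    then obtain \<alpha> \<beta> where x: "x = (\<Sum>j<a. \<alpha> j *s u j)" "x = (\<Sum>j<l + k - a. \<beta> j *s w j)"
      unfolding flag_iff by blast
    have "(\<Sum>j<a. \<alpha> j *s u j) + (\<Sum>j<l + k - a. (- \<beta> j) *s w j) = 0"
      using x by (simp add: sum_negf vec.scale_minus_left)
    then have "\<forall>j<a. \<alpha> j = 0"
      by (intro nondegenerateD(3)[OF FH[rule_format, of a], of "\<lambda>_. 0" "\<lambda>_. 0" \<alpha> "\<lambda>j. - \<beta> j"])
        (use ab in simp_all)
    then show "x \<in> {0}" using x(1) by simp
  qed
  have GH0: "flag v a \<inter> flag w b \<subseteq> {0}" if ab: "a + b \<le> l + k" for a b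
  proof
    fix x assume "x \<in> flag v a \<inter> flag w b"
    then have "x \<in> flag v a" "x \<in> flag w b" by auto
    moreover have "flag w b \<subseteq> flag w (l + k - a)" by (rule monoD[OF mono_flag]) (use ab in simp)
    ultimately have "x \<in> flag v a" "x \<in> flag w (l + k - a)" by auto
    then obtain \<alpha> \<beta> where x: "x = (\<Sum>j<a. \<alpha> j *s v j)" "x = (\<Sum>j<l + k - a. \<beta> j *s w j)"
      unfolding flag_iff by blast
    \<comment> \<open>Here \<open>r = 0\<close> and \<open>s = n\<close>: the second equation merely
      expresses \<open>x\<close> in the full basis \<open>w\<close>, so it can always be solved, and
      the first one carries the condition.\<close>
    have "flag w (l + k - a) \<subseteq> flag w (l + k)" by (rule monoD[OF mono_flag]) simp
    then obtain \<delta> where "x = (\<Sum>j<l + k. \<delta> j *s w j)" using x(2) by (metis flag_iff subsetD)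
    then have "\<forall>j<a. \<alpha> j = 0"
      by (intro nondegenerateD(1)[OF GH[rule_format, of a], of \<alpha> \<beta> "\<lambda>_. 0" \<delta>])
        (use ab x in simp_all)
    then show "x \<in> {0}" using x(1) by simp
  qed
  have FGH0: "x + y = 0" if im: "1 \<le> i" "i \<le> l" "1 \<le> m" "m \<le> k"
    and xy: "x \<in> flag u (k + i - 1)" "y \<in> flag w (l - i)" "x + y \<in> flag v (k + 1 - m) \<inter> flag w (l + m)"
    for i m x y
  proof -
    have "x + y \<in> flag v (k + 1 - m)" "x + y \<in> flag w (l + m)" using xy(3) by auto
    then obtain \<alpha> \<beta> \<gamma> \<delta> where e: "x = (\<Sum>j<k + i - 1. \<gamma> j *s u j)" "y = (\<Sum>j<l - i. \<delta> j *s w j)"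
      "x + y = (\<Sum>j<k + 1 - m. \<alpha> j *s v j)" "x + y = (\<Sum>j<l + m. \<beta> j *s w j)"
      using xy(1,2) unfolding flag_iff by blast
    have "\<forall>j<k + 1 - m. \<alpha> j = 0"
    proof (intro nondegenerateD(1)[OF FGH[rule_format, of i m], of \<alpha> \<beta> \<gamma> \<delta>])
      show "(\<Sum>j<k + 1 - m. \<alpha> j *s v j) = (\<Sum>j<l + m. \<beta> j *s w j)"
        by (rule trans[OF e(3)[symmetric] e(4)])
      show "(\<Sum>j<k + 1 - m. \<alpha> j *s v j) = (\<Sum>j<k + i - 1. \<gamma> j *s u j) + (\<Sum>j<l - i. \<delta> j *s w j)"
        unfolding e(3)[symmetric] e(1)[symmetric] e(2)[symmetric] by (rule refl)
    qed (use im in auto)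
    then show ?thesis using e(3) by simp
  qed
  show "in_general_position l k (flag u) (flag v) (flag w)"
    unfolding in_general_position_def
    using FH0 GH0 FGH0 dim indep by (auto simp: mono_flag flag_def)
qed

text \<open>Only finitely many index pairs occur, so the conjunction of all the determinantal
  conditions is still generic.\<close>

lemma generally_in_general_position:
  assumes n: "CARD('n::finite) = l + k"
  shows "generally flag_coords (\<lambda>(u :: nat \<Rightarrow> complex^'n, v, w).
    basis_of CARD('n) u UNIV \<and> basis_of CARD('n) v UNIV \<and> basis_of CARD('n) w UNIV \<and>
    in_general_position l k (flag u) (flag v) (flag w))"
proof -
  let ?ND = "\<lambda>p q r s. nondegenerate p q r s :: (nat \<Rightarrow> complex^'n) \<times> _ \<Rightarrow> bool"
  have 1: "generally flag_coords (?ND 0 (l + k) r (l + k - r))" if "r \<in> {..l + k}" for r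
  proof -
    have "\<exists>z :: (nat \<Rightarrow> complex^'n) \<times> (nat \<Rightarrow> complex^'n) \<times> (nat \<Rightarrow> complex^'n). nondegenerate 0 (l + k) r (l + k - r) z"
      by (rule nondegenerate_example[OF n, of 0 "l + k" r "l + k - r" 0 0]) (use that in auto)
    then obtain z :: "(nat \<Rightarrow> complex^'n) \<times> (nat \<Rightarrow> complex^'n) \<times> (nat \<Rightarrow> complex^'n)"
      where z: "nondegenerate 0 (l + k) r (l + k - r) z" ..
    show ?thesis using that by (intro generally_nondegenerate[OF _ _ _ _ _ z]) (auto simp: n)
  qed
  have 2: "generally flag_coords (?ND p (l + k - p) 0 (l + k))" if "p \<in> {..l + k}" for p
  proof -
    have "\<exists>z :: (nat \<Rightarrow> complex^'n) \<times> (nat \<Rightarrow> complex^'n) \<times> (nat \<Rightarrow> complex^'n). nondegenerate p (l + k - p) 0 (l + k) z"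
      by (rule nondegenerate_example[OF n, of p "l + k - p" 0 "l + k" 0 0]) (use that in auto)
    then obtain z :: "(nat \<Rightarrow> complex^'n) \<times> (nat \<Rightarrow> complex^'n) \<times> (nat \<Rightarrow> complex^'n)"
      where z: "nondegenerate p (l + k - p) 0 (l + k) z" ..
    show ?thesis using that by (intro generally_nondegenerate[OF _ _ _ _ _ z]) (auto simp: n)
  qed
  have 3: "generally flag_coords (?ND (k + 1 - m) (l + m) (k + i - 1) (l - i))"
    if im: "i \<in> {1..l}" "m \<in> {1..k}" for i m
  proof -
    have "\<exists>z :: (nat \<Rightarrow> complex^'n) \<times> (nat \<Rightarrow> complex^'n) \<times> (nat \<Rightarrow> complex^'n). nondegenerate (k + 1 - m) (l + m) (k + i - 1) (l - i) z"
      by (rule nondegenerate_example[OF n, of "k + 1 - m" "l + m" "k + i - 1" "l - i" i m]) (use im in auto)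
    then obtain z :: "(nat \<Rightarrow> complex^'n) \<times> (nat \<Rightarrow> complex^'n) \<times> (nat \<Rightarrow> complex^'n)"
      where z: "nondegenerate (k + 1 - m) (l + m) (k + i - 1) (l - i) z" ..
    show ?thesis using im by (intro generally_nondegenerate[OF _ _ _ _ _ z]) (auto simp: n)
  qed
  note lc = line_connected_flag_coords
  have "generally flag_coords (\<lambda>z. (\<forall>r \<in> {..l + k}. ?ND 0 (l + k) r (l + k - r) z) \<and>
    (\<forall>p \<in> {..l + k}. ?ND p (l + k - p) 0 (l + k) z) \<and>
    (\<forall>i \<in> {1..l}. \<forall>m \<in> {1..k}. ?ND (k + 1 - m) (l + m) (k + i - 1) (l - i) z))"
    by (intro generally_conj[OF lc] generally_ball[OF lc] 1 2 3) auto
  then show ?thesis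
  proof (rule generally_mono, safe)
    fix u v w :: "nat \<Rightarrow> complex^'n"
    assume a: "\<forall>r\<in>{..l + k}. nondegenerate 0 (l + k) r (l + k - r) (u, v, w)"
       "\<forall>p\<in>{..l + k}. nondegenerate p (l + k - p) 0 (l + k) (u, v, w)"
       "\<forall>i\<in>{1..l}. \<forall>m\<in>{1..k}. nondegenerate (k + 1 - m) (l + m) (k + i - 1) (l - i) (u, v, w)"
    have "\<forall>r\<le>l + k. nondegenerate 0 (l + k) r (l + k - r) (u, v, w)"
       "\<forall>p\<le>l + k. nondegenerate p (l + k - p) 0 (l + k) (u, v, w)" using a(1,2) by auto
    note nondegenerate_flags[OF n this a(3)]
    then show "basis_of CARD('n) u UNIV" "basis_of CARD('n) v UNIV" "basis_of CARD('n) w UNIV"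
      "in_general_position l k (flag u) (flag v) (flag w)" by (simp_all only: n)
  qed
qed

text \<open>If \<open>M\<close> were another number that works for general flags, then, two generic
  conditions being compatible, it would be the count for some triple in general position, where the
  count is \<open>N\<close>. So the described number exists and is unique.\<close>

lemma gromov_witten_eqI:
  assumes n: "CARD('n::finite) = l + k"
    and s: "sum_list lam + sum_list \<mu> + sum_list \<nu> = l * k + d * (l + k)"
    and N: "\<And>F G (H :: nat \<Rightarrow> (complex^'n) set). in_general_position l k F G H \<Longrightarrow>
      finite (curves_meeting l d (schubert_variety l k lam F) (schubert_variety l k \<mu> G)
                   (schubert_variety l k \<nu> H) // reparametrization) \<and>
      card (curves_meeting l d (schubert_variety l k lam F) (schubert_variety l k \<mu> G)
                   (schubert_variety l k \<nu> H) // reparametrization) = N"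
  shows "gromov_witten TYPE('n) l k d lam \<mu> \<nu> = N"
proof -
  let ?R = "\<lambda>N F G (H :: nat \<Rightarrow> (complex^'n) set).
    let Q = curves_meeting l d (schubert_variety l k lam F) (schubert_variety l k \<mu> G)
              (schubert_variety l k \<nu> H) // reparametrization
    in finite Q \<and> card Q = N"
  note gen = generally_in_general_position[OF n]
  have "(THE N. for_general_flags (?R N)) = N"
  proof (rule the_equality)
    show "for_general_flags (?R N)"
      unfolding for_general_flags_def flag_coords_def[symmetric]
      using gen
    proof (rule generally_mono, clarify)
      fix u v w :: "nat \<Rightarrow> complex^'n" assume "in_general_position l k (flag u) (flag v) (flag w)"
      then show "?R N (flag u) (flag v) (flag w)" using N by (simp add: Let_def)
    qed
  next
    fix M assume "for_general_flags (?R M)"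
    from generally_conj[OF line_connected_flag_coords gen
        this[unfolded for_general_flags_def flag_coords_def[symmetric]]]
    obtain u v w :: "nat \<Rightarrow> complex^'n" where
      "in_general_position l k (flag u) (flag v) (flag w)" "?R M (flag u) (flag v) (flag w)"
      by (auto dest!: generally_ex)
    then show "M = N" using N by (auto simp: Let_def)
  qed
  then show ?thesis using s by (simp add: gromov_witten_def)
qed

section \<open>Pluecker coordinates\<close>

text \<open>Functionals are represented by vectors through the bilinear, not Hermitian, pairing, so
  that \<open>axis a 1\<close> is the coordinate functional \<open>a\<close>.\<close>

definition pairing :: "complex^'n::finite \<Rightarrow> complex^'n \<Rightarrow> complex" where
  "pairing x \<eta> = (\<Sum>a\<in>UNIV. x $ a * \<eta> $ a)"

lemma pairing_add: "pairing (x + y) \<eta> = pairing x \<eta> + pairing y \<eta>"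
  by (simp add: pairing_def sum.distrib distrib_right)

lemma pairing_scale: "pairing (c *s x) \<eta> = c * pairing x \<eta>"
  by (simp add: pairing_def sum_distrib_left mult.assoc)

lemma pairing_0: "pairing 0 \<eta> = 0"
  by (simp add: pairing_def)

lemma pairing_sum: "pairing (\<Sum>r\<in>A. f r) \<eta> = (\<Sum>r\<in>A. pairing (f r) \<eta>)"
  by (induction A rule: infinite_finite_induct) (auto simp: pairing_add pairing_0)

lemma pairing_axis: "pairing x (axis a 1) = x $ a"
proof -
  have "pairing x (axis a 1) = (\<Sum>b\<in>UNIV. if b = a then x $ b else 0)"
    unfolding pairing_def by (rule sum.cong) (auto simp: axis_def)
  then show ?thesis by simp
qed

lemma subspace_annihilated: "vec.subspace {x. pairing x \<eta> = 0}"
  by (auto simp: vec.subspace_def pairing_add pairing_scale pairing_0)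

lemma exists_functional:
  assumes "vec.independent B"
  shows "\<exists>\<eta>. \<forall>b \<in> B. pairing b \<eta> = g b"
proof -
  obtain f :: "complex^'a \<Rightarrow> complex^1"
    where f: "Vector_Spaces.linear (*s) (*s) f" "\<forall>b\<in>B. f b = axis 1 (g b)"
    using vec.linear_independent_extend[OF assms, of "\<lambda>b. axis 1 (g b)"] by blast
  have "pairing b (matrix f $ 1) = g b" if "b \<in> B" for b
  proof -
    have "f b $ 1 = (matrix f *v b) $ 1" using matrix_works[OF f(1)] by simp
    then show ?thesis using that f(2)
      by (simp add: pairing_def matrix_vector_mult_def mult.commute)
  qed
  then show ?thesis by blast
qed

lemma exists_dual_family:
  assumes "basis_of l v V"
  shows "\<exists>\<eta>. \<forall>i<l. \<forall>j<l. pairing (v i) (\<eta> j) = (if i = j then 1 else 0)"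
proof -
  have v: "inj_on v {..<l}" "vec.independent (v ` {..<l})" using assms by (auto simp: basis_of_def)
  have "\<exists>\<eta>. \<forall>i<l. pairing (v i) \<eta> = (if i = j then 1 else 0)" if "j < l" for j
  proof -
    obtain \<eta> where \<eta>: "\<forall>b \<in> v ` {..<l}. pairing b \<eta> = (if b = v j then 1 else 0)"
      using exists_functional[OF v(2), of "\<lambda>b. if b = v j then 1 else 0"] by blast
    have "pairing (v i) \<eta> = (if i = j then 1 else 0)" if "i < l" for i
      using \<eta> that inj_onD[OF v(1), of i j] \<open>j < l\<close> by auto
    then show ?thesis by blast
  qed
  then show ?thesis by metis
qed

lemma exists_separating:
  assumes "vec.subspace S" "x \<notin> S"
  shows "\<exists>\<psi>. (\<forall>s \<in> S. pairing s \<psi> = 0) \<and> pairing x \<psi> = 1"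
proof -
  obtain B where B: "B \<subseteq> S" "vec.independent B" "vec.span B = S"
    using vec.basis_subspace_exists[OF assms(1)] by metis
  have "vec.independent (insert x B)" using B assms(2) by (simp add: vec.independent_insert)
  then obtain \<psi> where \<psi>: "\<forall>b \<in> insert x B. pairing b \<psi> = (if b = x then 1 else 0)"
    using exists_functional[of "insert x B" "\<lambda>b. if b = x then 1 else 0"] by blast
  have "S \<subseteq> {s. pairing s \<psi> = 0}"
    unfolding B(3)[symmetric] using B(1) assms(2) \<psi>
    by (intro vec.span_minimal subspace_annihilated) auto
  then show ?thesis using \<psi> by auto
qed

text \<open>The value of the alternating form \<open>v\<^sub>0 \<and> \<dots> \<and> v\<^bsub>l-1\<^esub>\<close> at arbitrary functionals \<open>\<eta>\<close>; the
  Pluecker coordinates are its values at coordinate functionals.\<close>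

definition wedge :: "nat \<Rightarrow> (nat \<Rightarrow> complex^'n::finite) \<Rightarrow> (nat \<Rightarrow> complex^'n) \<Rightarrow> complex" where
  "wedge l v \<eta> = (\<Sum>\<pi> | \<pi> permutes {..<l}. of_int (sign \<pi>) * (\<Prod>i<l. pairing (v i) (\<eta> (\<pi> i))))"

lemma wedge_det: "wedge l v \<eta> = Determinant.det (mat l l (\<lambda>(i, j). pairing (v i) (\<eta> j)))"
proof -
  have "Determinant.det (mat l l (\<lambda>(i, j). pairing (v i) (\<eta> j))) =
      (\<Sum>p | p permutes {0..<l}. of_int (sign p) * (\<Prod>i = 0..<l. pairing (v i) (\<eta> (p i))))"
    by (subst det_def'[of _ l]) (auto intro!: sum.cong prod.cong simp: permutes_def)
  then show ?thesis by (simp add: wedge_def lessThan_atLeast0)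
qed

lemma plucker_eq_wedge: "plucker l v I = wedge l v (\<lambda>j. axis (I ! j) 1)"
  by (simp add: plucker_def wedge_def pairing_axis)

lemma finite_lists_of_length: "finite {I :: 'n::finite list. length I = l}"
  using finite_lists_length_eq[of "UNIV :: 'n set" l] by simp

lemma prod_sum_lists:
  fixes g :: "nat \<Rightarrow> 'n::finite \<Rightarrow> complex"
  shows "(\<Prod>j<l. \<Sum>a\<in>UNIV. g j a) = (\<Sum>I | length I = l. \<Prod>j<l. g j (I ! j))"
proof (induction l)
  case 0
  have "{I :: 'n list. length I = 0} = {[]}" by auto
  then show ?case by simp
next
  case (Suc l)
  have bij: "bij_betw (\<lambda>(I, a). I @ [a]) ({I :: 'n list. length I = l} \<times> UNIV) {I. length I = Suc l}"
    by (rule bij_betw_byWitness[of _ "\<lambda>I. (butlast I, last I)"]) (auto simp: length_Suc_conv_rev)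
  have "(\<Sum>I | length I = Suc l. \<Prod>j<Suc l. g j (I ! j)) =
    (\<Sum>(I, a)\<in>{I :: 'n list. length I = l} \<times> UNIV. (\<Prod>j<l. g j (I ! j)) * g l a)"
    unfolding sum.reindex_bij_betw[OF bij, symmetric]
    by (intro sum.cong) (auto simp: nth_append)
  also have "\<dots> = (\<Sum>I | length I = l. \<Prod>j<l. g j (I ! j)) * (\<Sum>a\<in>UNIV. g l a)"
    by (simp add: sum_product sum.cartesian_product)
  finally show ?case using Suc by simp
qed

text \<open>Multilinearity in the functionals: expanding each \<open>\<eta> j\<close> in coordinate
  functionals expresses every value of the form through Pluecker coordinates. This permits arguments
  with functionals adapted to the subspaces at hand.\<close>

lemma wedge_plucker:
  "wedge l v \<eta> = (\<Sum>I | length I = l. (\<Prod>j<l. \<eta> j $ (I ! j)) * plucker l v I)"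
proof -
  \<comment> \<open>Indexes the factors by columns, so that the product can be expanded in
    \<open>\<eta> j\<close> for each fixed \<open>j\<close>.\<close>
  have perm: "(\<Prod>i<l. f i (\<pi> i)) = (\<Prod>j<l. f (inv_into UNIV \<pi> j) j)" if "\<pi> permutes {..<l}"
    for \<pi> and f :: "nat \<Rightarrow> nat \<Rightarrow> complex"
  proof -
    have "(\<Prod>j<l. f (inv_into UNIV \<pi> j) j) = (\<Prod>i<l. f (inv_into UNIV \<pi> (\<pi> i)) (\<pi> i))"
      using prod.permute[OF that, of "\<lambda>j. f (inv_into UNIV \<pi> j) j"] by (simp add: comp_def)
    then show ?thesis using that by (simp add: permutes_inverses)
  qed
  have "wedge l v \<eta> = (\<Sum>\<pi> | \<pi> permutes {..<l}. of_int (sign \<pi>) *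
    (\<Sum>I | length I = l. \<Prod>j<l. v (inv_into UNIV \<pi> j) $ (I ! j) * \<eta> j $ (I ! j)))"
    unfolding wedge_def
  proof (intro sum.cong refl arg_cong2[of _ _ _ _ "(*)"])
    fix \<pi> assume "\<pi> \<in> {\<pi>. \<pi> permutes {..<l}}"
    then have "(\<Prod>i<l. pairing (v i) (\<eta> (\<pi> i))) = (\<Prod>j<l. pairing (v (inv_into UNIV \<pi> j)) (\<eta> j))"
      using perm[of \<pi> "\<lambda>i j. pairing (v i) (\<eta> j)"] by simp
    then show "(\<Prod>i<l. pairing (v i) (\<eta> (\<pi> i))) =
        (\<Sum>I | length I = l. \<Prod>j<l. v (inv_into UNIV \<pi> j) $ (I ! j) * \<eta> j $ (I ! j))"
      unfolding pairing_def prod_sum_lists .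
  qed
  also have "\<dots> = (\<Sum>I | length I = l. \<Sum>\<pi> | \<pi> permutes {..<l}. of_int (sign \<pi>) *
    (\<Prod>j<l. v (inv_into UNIV \<pi> j) $ (I ! j) * \<eta> j $ (I ! j)))"
    unfolding sum_distrib_left by (rule sum.swap)
  also have "\<dots> = (\<Sum>I | length I = l. (\<Prod>j<l. \<eta> j $ (I ! j)) * plucker l v I)"
  proof (intro sum.cong refl)
    fix I :: "'a list"
    have "(\<Prod>j<l. v (inv_into UNIV \<pi> j) $ (I ! j)) = (\<Prod>i<l. v i $ (I ! \<pi> i))" if "\<pi> permutes {..<l}" for \<pi>
      using perm[OF that, of "\<lambda>i j. v i $ (I ! j)"] by simp
    then show "(\<Sum>\<pi> | \<pi> permutes {..<l}. of_int (sign \<pi>) *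
        (\<Prod>j<l. v (inv_into UNIV \<pi> j) $ (I ! j) * \<eta> j $ (I ! j))) = (\<Prod>j<l. \<eta> j $ (I ! j)) * plucker l v I"
      unfolding plucker_def sum_distrib_left
      by (intro sum.cong) (auto simp: prod.distrib algebra_simps)
  qed
  finally show ?thesis .
qed

lemma wedge_zero_column:
  assumes "c < l" "\<And>r. r < l \<Longrightarrow> pairing (v r) (\<eta> c) = 0"
  shows "wedge l v \<eta> = 0"
  unfolding wedge_def
proof (intro sum.neutral ballI)
  fix \<pi> assume "\<pi> \<in> {\<pi>. \<pi> permutes {..<l}}"
  then have \<pi>: "\<pi> permutes {..<l}" by simp
  have "inv_into UNIV \<pi> c < l" using permutes_in_image[OF permutes_inv[OF \<pi>]] assms(1) by simp
  moreover have "\<pi> (inv_into UNIV \<pi> c) = c" using \<pi> by (simp add: permutes_inverses)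
  ultimately have "(\<Prod>i<l. pairing (v i) (\<eta> (\<pi> i))) = 0"
    using assms(2) by (intro prod_zero) (auto intro!: bexI[of _ "inv_into UNIV \<pi> c"])
  then show "of_int (sign \<pi>) * (\<Prod>i<l. pairing (v i) (\<eta> (\<pi> i))) = 0" by simp
qed

text \<open>Outside column \<open>c\<close> the matrix is the identity. A permutation other than
  \<open>id\<close> sends some row \<open>r\<close> neither to \<open>r\<close> nor to
  \<open>c\<close>, and so picks up a zero.\<close>

lemma wedge_replaced_column:
  assumes c: "c < l"
    and d: "\<And>r j. r < l \<Longrightarrow> j < l \<Longrightarrow> j \<noteq> c \<Longrightarrow> pairing (v r) (\<eta> j) = (if r = j then 1 else 0)"
  shows "wedge l v \<eta> = pairing (v c) (\<eta> c)"
proof -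
  have "wedge l v \<eta> = (\<Sum>\<pi> \<in> {id}. of_int (sign \<pi>) * (\<Prod>i<l. pairing (v i) (\<eta> (\<pi> i))))"
    unfolding wedge_def
  proof (rule sum.mono_neutral_right)
    show "\<forall>\<pi>\<in>{\<pi>. \<pi> permutes {..<l}} - {id}. of_int (sign \<pi>) * (\<Prod>i<l. pairing (v i) (\<eta> (\<pi> i))) = 0"
    proof
      fix \<pi> assume "\<pi> \<in> {\<pi>. \<pi> permutes {..<l}} - {id}"
      then have \<pi>: "\<pi> permutes {..<l}" "\<pi> \<noteq> id" by auto
      have "\<exists>r. \<pi> r \<noteq> r \<and> \<pi> r \<noteq> c"
      proof (cases "\<pi> c = c")
        case True
        obtain r where "\<pi> r \<noteq> r" using \<pi>(2) by (auto simp: fun_eq_iff)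
        moreover have "\<pi> r \<noteq> c" using True permutes_inj[OF \<pi>(1)] \<open>\<pi> r \<noteq> r\<close> by (metis injD)
        ultimately show ?thesis by blast
      qed blast
      then obtain r where r: "\<pi> r \<noteq> r" "\<pi> r \<noteq> c" by blast
      then have "r < l" "\<pi> r < l"
        using \<pi>(1) permutes_in_image[OF \<pi>(1), of r] by (auto simp: permutes_def)
      then have "(\<Prod>i<l. pairing (v i) (\<eta> (\<pi> i))) = 0"
        using r d[of r "\<pi> r"] by (intro prod_zero) auto
      then show "of_int (sign \<pi>) * (\<Prod>i<l. pairing (v i) (\<eta> (\<pi> i))) = 0" by simp
    qed
  qed (auto simp: finite_permutations permutes_id)
  also have "\<dots> = (\<Prod>i<l. pairing (v i) (\<eta> i))" by simp
  also have "\<dots> = (\<Prod>i<l. if i = c then pairing (v c) (\<eta> c) else 1)"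
    using d by (intro prod.cong) auto
  also have "\<dots> = pairing (v c) (\<eta> c)" using c by simp
  finally show ?thesis .
qed

text \<open>Cramer's rule. Together with a separating functional \<psi> it converts statements on
  Pluecker coordinates into statements on membership.\<close>

lemma wedge_dual_replaced:
  assumes c: "c < l"
    and d: "\<And>i j. i < l \<Longrightarrow> j < l \<Longrightarrow> pairing (v i) (\<eta> j) = (if i = j then 1 else 0)"
  shows "wedge l v (\<eta>(c := \<psi>)) = pairing (v c) \<psi>"
  using wedge_replaced_column[OF c, of v "\<eta>(c := \<psi>)"] d by simp

lemma wedge_dual:
  assumes d: "\<And>i j. i < l \<Longrightarrow> j < l \<Longrightarrow> pairing (v i) (\<eta> j) = (if i = j then 1 else 0)"
  shows "wedge l v \<eta> = 1"
proof (cases l)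
  case 0
  then show ?thesis by (simp add: wedge_def)
next
  case (Suc l')
  then have "wedge l v \<eta> = pairing (v 0) (\<eta> 0)" using d by (intro wedge_replaced_column) auto
  then show ?thesis using d[of 0 0] Suc by simp
qed

text \<open>The factor is the determinant of the transition matrix. It is nonzero because the dual
  family of \<open>v'\<close> gives the value 1 on the left.\<close>

lemma wedge_change_basis:
  assumes v: "basis_of l v V" and v': "basis_of l v' V"
  shows "\<exists>\<kappa>. \<kappa> \<noteq> 0 \<and> (\<forall>\<eta>. wedge l v' \<eta> = \<kappa> * wedge l v \<eta>)"
proof -
  have "\<exists>\<alpha>. v' i = (\<Sum>r<l. \<alpha> r *s v r)" if "i < l" for i
    using basis_of_mem[OF v' that] v unfolding basis_of_iff by blast
  then obtain T where T: "\<And>i. i < l \<Longrightarrow> v' i = (\<Sum>r<l. T i r *s v r)" by metis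
  define \<kappa> where "\<kappa> = Determinant.det (mat l l (\<lambda>(i, r). T i r))"
  have eq: "wedge l v' \<eta> = \<kappa> * wedge l v \<eta>" for \<eta>
  proof -
    have "mat l l (\<lambda>(i, j). pairing (v' i) (\<eta> j)) =
        mat l l (\<lambda>(i, r). T i r) * mat l l (\<lambda>(i, j). pairing (v i) (\<eta> j))"
    proof (rule eq_matI)
      fix i j assume ij: "i < dim_row (mat l l (\<lambda>(i, r). T i r) * mat l l (\<lambda>(i, j). pairing (v i) (\<eta> j)))"
        "j < dim_col (mat l l (\<lambda>(i, r). T i r) * mat l l (\<lambda>(i, j). pairing (v i) (\<eta> j)))"
      then have "pairing (v' i) (\<eta> j) = (\<Sum>r<l. T i r * pairing (v r) (\<eta> j))"
        by (simp add: T pairing_sum pairing_scale)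
      then show "mat l l (\<lambda>(i, j). pairing (v' i) (\<eta> j)) $$ (i, j) =
          (mat l l (\<lambda>(i, r). T i r) * mat l l (\<lambda>(i, j). pairing (v i) (\<eta> j))) $$ (i, j)"
        using ij by (simp add: scalar_prod_def lessThan_atLeast0)
    qed auto
    then show ?thesis unfolding wedge_det \<kappa>_def by (simp add: det_mult[of _ l])
  qed
  obtain \<eta> where "\<forall>i<l. \<forall>j<l. pairing (v' i) (\<eta> j) = (if i = j then 1 else 0)"
    using exists_dual_family[OF v'] by blast
  then have "wedge l v' \<eta> = 1" by (intro wedge_dual) auto
  then have "\<kappa> \<noteq> 0" using eq[of \<eta>] by auto
  then show ?thesis using eq by blast
qed

text \<open>Another basis multiplies all Pluecker coordinates by a common factor, so a single basis
  decides.\<close>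

lemma on_hyperplane_iff:
  assumes "basis_of l v V"
  shows "on_hyperplane l a V \<longleftrightarrow> (\<Sum>I | length I = l. a I * plucker l v I) = 0"
proof
  assume 0: "(\<Sum>I | length I = l. a I * plucker l v I) = 0"
  show "on_hyperplane l a V"
    unfolding on_hyperplane_def
  proof (intro allI impI)
    fix v' assume "basis_of l v' V"
    then obtain \<kappa> where "\<forall>\<eta>. wedge l v' \<eta> = \<kappa> * wedge l v \<eta>"
      using wedge_change_basis[OF assms] by blast
    then have "(\<Sum>I | length I = l. a I * plucker l v' I) = \<kappa> * (\<Sum>I | length I = l. a I * plucker l v I)"
      by (simp add: plucker_eq_wedge sum_distrib_left mult_ac)
    then show "(\<Sum>I | length I = l. a I * plucker l v' I) = 0" using 0 by simp
  qed
qed (use assms in \<open>auto simp: on_hyperplane_def\<close>)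

lemma plucker_nonzero:
  assumes "basis_of l v V"
  shows "\<exists>I. length I = l \<and> plucker l v I \<noteq> 0"
proof (rule ccontr)
  assume "\<not> ?thesis"
  then have 0: "wedge l v \<eta> = 0" for \<eta> unfolding wedge_plucker by (intro sum.neutral) auto
  obtain \<eta> where "\<forall>i<l. \<forall>j<l. pairing (v i) (\<eta> j) = (if i = j then 1 else 0)"
    using exists_dual_family[OF assms] by blast
  then have "wedge l v \<eta> = 1" by (intro wedge_dual) auto
  then show False using 0 by simp
qed

lemma wedge_proportional:
  assumes "\<And>I. length I = l \<Longrightarrow> plucker l v' I = c * plucker l v I"
  shows "wedge l v' \<eta> = c * wedge l v \<eta>"
  unfolding wedge_plucker sum_distrib_left by (intro sum.cong) (auto simp: assms)

lemma subspaces_eq: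
  assumes "V \<subseteq> V'" "V \<in> Gr l" "V' \<in> Gr l"
  shows "V = V'"
  using vec.subspace_dim_equal[of V V'] assms by (auto simp: Gr_def)

text \<open>If some \<open>v' i\<close> lay outside \<open>V\<close>, a functional that vanishes on
  \<open>V\<close> but not on \<open>v' i\<close>, inserted into the dual family of
  \<open>v'\<close>, would give 1 for \<open>v'\<close> and 0 for \<open>v\<close>, whatever the
  factor \<open>c\<close>.\<close>

lemma plucker_injective:
  assumes v: "basis_of l v V" and v': "basis_of l v' V'"
    and p: "\<And>I. length I = l \<Longrightarrow> plucker l v' I = c * plucker l v I"
  shows "V = V'"
proof -
  have Gr: "V \<in> Gr l" "V' \<in> Gr l" using v v' basis_of_Gr by blast+
  obtain \<eta> where \<eta>: "\<forall>i<l. \<forall>j<l. pairing (v' i) (\<eta> j) = (if i = j then 1 else 0)"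
    using exists_dual_family[OF v'] by blast
  have "v' i \<in> V" if i: "i < l" for i
  proof (rule ccontr)
    assume "v' i \<notin> V"
    then obtain \<psi> where \<psi>: "\<forall>s \<in> V. pairing s \<psi> = 0" "pairing (v' i) \<psi> = 1"
      using exists_separating[of V "v' i"] Gr by (auto simp: Gr_def)
    have "wedge l v' (\<eta>(i := \<psi>)) = 1" using wedge_dual_replaced[OF i, of v' \<eta>] \<eta> \<psi>(2) by simp
    moreover have "wedge l v (\<eta>(i := \<psi>)) = 0"
      using \<psi>(1) basis_of_mem[OF v] by (intro wedge_zero_column[OF i]) auto
    ultimately show False using wedge_proportional[OF p, of "\<eta>(i := \<psi>)"] by simp
  qed
  then have "V' \<subseteq> V"
  proof -
    have "vec.span (v' ` {..<l}) \<subseteq> V"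
      using \<open>\<And>i. i < l \<Longrightarrow> v' i \<in> V\<close> Gr(1) by (intro vec.span_minimal) (auto simp: Gr_def)
    then show ?thesis using v' by (simp add: basis_of_def)
  qed
  then show ?thesis using subspaces_eq Gr by blast
qed


section \<open>Binary forms and curves of degree 0\<close>

lemma P1_iff: "p \<in> Gr 1 \<longleftrightarrow> (\<exists>w. w \<noteq> 0 \<and> p = vec.span {w})"
proof
  assume "p \<in> Gr 1"
  then obtain v where "basis_of 1 v p" by (rule exists_basis_of)
  then have "p = vec.span {v 0}" "v 0 \<noteq> 0" by (auto simp: basis_of_def lessThan_Suc)
  then show "\<exists>w. w \<noteq> 0 \<and> p = vec.span {w}" by blast
next
  assume "\<exists>w. w \<noteq> 0 \<and> p = vec.span {w}"
  then show "p \<in> Gr 1" by (auto simp: Gr_def)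
qed

lemma span_singleton_in_Gr: "w \<noteq> 0 \<Longrightarrow> vec.span {w} \<in> Gr 1"
  using P1_iff by blast

lemma span_singleton_iff: "x \<in> vec.span {w} \<longleftrightarrow> (\<exists>c. x = c *s w)"
  by (auto simp: vec.span_singleton)

lemma binary_form_sum:
  "(\<Sum>I\<in>A. a I * binary_form m (c I) w) = binary_form m (\<lambda>i. \<Sum>I\<in>A. a I * c I i) w"
proof -
  have "(\<Sum>I\<in>A. a I * binary_form m (c I) w) = (\<Sum>I\<in>A. \<Sum>i\<le>m. a I * c I i * (w $ 1) ^ i * (w $ 2) ^ (m - i))"
    by (simp add: binary_form_def sum_distrib_left mult.assoc)
  also have "\<dots> = (\<Sum>i\<le>m. \<Sum>I\<in>A. a I * c I i * (w $ 1) ^ i * (w $ 2) ^ (m - i))"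
    by (rule sum.swap)
  finally show ?thesis by (simp add: binary_form_def sum_distrib_right)
qed

lemma binary_form_infinity: "w $ 2 = 0 \<Longrightarrow> binary_form m c w = c m * (w $ 1) ^ m"
proof -
  assume w: "w $ 2 = 0"
  have "binary_form m c w = (\<Sum>i\<in>{m}. c i * (w $ 1) ^ i * (w $ 2) ^ (m - i))"
    unfolding binary_form_def using w by (intro sum.mono_neutral_right) auto
  then show ?thesis by simp
qed

definition dehomogenization :: "nat \<Rightarrow> (nat \<Rightarrow> complex) \<Rightarrow> complex poly" where
  "dehomogenization m c = (\<Sum>i\<le>m. monom (c i) i)"

lemma poly_dehomogenization: "poly (dehomogenization m c) x = (\<Sum>i\<le>m. c i * x ^ i)"
  by (simp add: dehomogenization_def poly_sum poly_monom)

lemma coeff_dehomogenization: "coeff (dehomogenization m c) i = (if i \<le> m then c i else 0)"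
  by (simp add: dehomogenization_def coeff_sum)

lemma binary_form_dehomogenization:
  assumes "w $ 2 \<noteq> 0"
  shows "binary_form m c w = (w $ 2) ^ m * poly (dehomogenization m c) (w $ 1 / w $ 2)"
  unfolding binary_form_def poly_dehomogenization sum_distrib_left
proof (rule sum.cong)
  fix i assume "i \<in> {..m}"
  then have "(w $ 2) ^ m = (w $ 2) ^ i * (w $ 2) ^ (m - i)" by (simp flip: power_add)
  then show "c i * w $ 1 ^ i * w $ 2 ^ (m - i) = w $ 2 ^ m * (c i * (w $ 1 / w $ 2) ^ i)"
    using assms by (simp add: power_divide)
qed simp

lemma binary_form_root:
  assumes "m \<ge> 1"
  shows "\<exists>w. w \<noteq> 0 \<and> binary_form m c w = 0"
proof (cases "c m = 0")
  \<comment> \<open>Without the top coefficient the form vanishes at the point at infinity; with it,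
    the dehomogenization has positive degree.\<close>
  case True
  let ?w = "vector [1, 0] :: complex^2"
  have "binary_form m c ?w = 0" using True by (simp add: binary_form_infinity)
  moreover have "?w $ 1 \<noteq> 0" by simp
  then have "?w \<noteq> 0" by (metis zero_index)
  ultimately show ?thesis by blast
next
  case False
  then have "degree (dehomogenization m c) \<ge> m" by (intro le_degree) (simp add: coeff_dehomogenization)
  then have "\<not> constant (poly (dehomogenization m c))" using assms by (simp add: constant_degree)
  then obtain x where x: "poly (dehomogenization m c) x = 0"
    using fundamental_theorem_of_algebra by blast
  let ?w = "vector [x, 1] :: complex^2"
  have "binary_form m c ?w = 0" using x by (simp add: binary_form_dehomogenization)
  moreover have "?w $ 2 \<noteq> 0" by simp
  then have "?w \<noteq> 0" by (metis zero_index)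
  ultimately show ?thesis by blast
qed

lemma P1_nonempty: "P1 \<noteq> {}"
  using span_singleton_in_Gr[of "axis 1 1 :: complex^2"] by (auto simp: axis_eq_0_iff)

text \<open>A form of positive degree has a root, so the curve meets every hyperplane.\<close>

lemma degree_0_forms:
  assumes f: "has_degree l f 0"
    and v: "\<And>w. w \<noteq> 0 \<Longrightarrow> \<exists>v. basis_of l v (f (vec.span {w})) \<and>
      (\<forall>I. length I = l \<longrightarrow> plucker l v I = binary_form m (c I) w)"
  shows "m = 0"
proof (rule ccontr)
  assume "m \<noteq> 0"
  obtain a where a: "finite {p \<in> P1. on_hyperplane l a (f p)}" "card {p \<in> P1. on_hyperplane l a (f p)} = 0"
    using generally_ex[OF f[unfolded has_degree_def]] by blast
  then have none: "\<not> on_hyperplane l a (f p)" if "p \<in> P1" for p using that by auto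
  obtain w where w: "w \<noteq> 0" "binary_form m (\<lambda>i. \<Sum>I | length I = l. a I * c I i) w = 0"
    using binary_form_root \<open>m \<noteq> 0\<close> by (metis One_nat_def Suc_leI neq0_conv)
  obtain v where v': "basis_of l v (f (vec.span {w}))"
    "\<forall>I. length I = l \<longrightarrow> plucker l v I = binary_form m (c I) w" using v[OF w(1)] by blast
  have "(\<Sum>I | length I = l. a I * plucker l v I) = (\<Sum>I | length I = l. a I * binary_form m (c I) w)"
    using v'(2) by (intro sum.cong) auto
  also have "\<dots> = 0" using w(2) by (simp add: binary_form_sum)
  finally have "on_hyperplane l a (f (vec.span {w}))" using on_hyperplane_iff[OF v'(1)] by blast
  then show False using none span_singleton_in_Gr[OF w(1)] by blast
qed

text \<open>Forms of degree 0 are constants, so all points of the curve have the same Pluecker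
  coordinates, and these determine the subspace.\<close>

lemma degree_0_curve_constant:
  fixes f :: "(complex^2) set \<Rightarrow> (complex^'n::finite) set"
  assumes "f \<in> rational_curves l 0"
  obtains V where "V \<in> Gr l" "f = (\<lambda>p\<in>P1. V)"
proof -
  from assms have f: "f \<in> P1 \<rightarrow>\<^sub>E Gr l" "regular_map l f" "has_degree l f 0"
    by (auto simp: rational_curves_def)
  obtain m and c :: "'n list \<Rightarrow> nat \<Rightarrow> complex" where c: "\<And>w. w \<noteq> 0 \<Longrightarrow> \<exists>v. basis_of l v (f (vec.span {w})) \<and>
      (\<forall>I. length I = l \<longrightarrow> plucker l v I = binary_form m (c I) w)"
    using f(2) unfolding regular_map_def by blast
  have m: "m = 0" by (rule degree_0_forms[OF f(3) c])
  obtain w0 :: "complex^2" where w0: "w0 \<noteq> 0" using P1_nonempty P1_iff by blast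
  have "f p = f (vec.span {w0})" if "p \<in> P1" for p
  proof -
    obtain w where w: "w \<noteq> 0" "p = vec.span {w}" using \<open>p \<in> P1\<close> P1_iff by blast
    obtain v v' where v: "basis_of l v (f p)" "basis_of l v' (f (vec.span {w0}))"
      "\<And>I. length I = l \<Longrightarrow> plucker l v I = binary_form 0 (c I) w"
      "\<And>I. length I = l \<Longrightarrow> plucker l v' I = binary_form 0 (c I) w0"
      using c[OF w(1)] c[OF w0] m w(2) by blast
    show ?thesis using v(3,4) by (intro plucker_injective[OF v(1,2), of 1]) (simp add: binary_form_def)
  qed
  then have "f = (\<lambda>p\<in>P1. f (vec.span {w0}))" using f(1) by (intro ext) (auto simp: restrict_def)
  moreover have "f (vec.span {w0}) \<in> Gr l" using f(1) span_singleton_in_Gr[OF w0] by auto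
  ultimately show ?thesis using that by blast
qed

text \<open>The degree is 0 because a general hyperplane avoids the point \<open>V\<close>; the
  polynomial \<open>?h\<close> is the linear form \<open>a\<close> evaluated at the Pluecker
  coordinates of \<open>V\<close>.\<close>

lemma constant_curve:
  fixes V :: "(complex^'n::finite) set"
  assumes "V \<in> Gr l"
  shows "(\<lambda>p\<in>P1. V) \<in> rational_curves l 0"
proof -
  obtain v where v: "basis_of l v V" using exists_basis_of[OF assms] .
  have "regular_map l (\<lambda>p\<in>P1. V)"
    unfolding regular_map_def using v
    by (intro exI[of _ 0] exI[of _ "\<lambda>I _. plucker l v I"] allI impI exI[of _ v])
      (auto simp: span_singleton_in_Gr[simplified] binary_form_def)
  moreover have "has_degree l (\<lambda>p\<in>P1. V) 0"
  proof -
    let ?h = "\<lambda>a. \<Sum>I | length I = l. plucker l v I * a I"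
    obtain J where J: "length J = l" "plucker l v J \<noteq> 0" using plucker_nonzero[OF v] by blast
    have h1: "?h \<in> poly_funs {\<lambda>a :: 'n list \<Rightarrow> complex. a I | I. length I = l}"
      by (intro poly_funs_sum poly_funs_cmult poly_funs.coord) auto
    have h2: "?h (\<lambda>I. if I = J then 1 else 0) \<noteq> 0"
      using J by (simp add: finite_lists_of_length if_distrib cong: if_cong)
    have h3: "finite {p \<in> P1. on_hyperplane l a ((\<lambda>p\<in>P1. V) p)} \<and>
      card {p \<in> P1. on_hyperplane l a ((\<lambda>p\<in>P1. V) p)} = 0" if "?h a \<noteq> 0" for a
    proof -
      have "\<not> on_hyperplane l a V" using that on_hyperplane_iff[OF v] by (simp add: mult.commute)
      then have E: "{p \<in> P1. on_hyperplane l a ((\<lambda>p\<in>P1. V) p)} = {}" by auto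
      show ?thesis unfolding E by simp
    qed
    show ?thesis
      unfolding has_degree_def generally_def
      by (rule bexI[OF _ h1], rule conjI, rule exI, rule h2) (use h3 in blast)
  qed
  ultimately show ?thesis using assms by (auto simp: rational_curves_def)
qed

text \<open>The three incidences may occur at different parameters, but a constant curve has only
  one value, so they merge into one intersection.\<close>

lemma curves_meeting_degree_0:
  fixes A :: "(complex^'n::finite) set set"
  assumes "A \<subseteq> Gr l"
  shows "curves_meeting l 0 A B C = (\<lambda>V. \<lambda>p\<in>P1. V) ` (A \<inter> B \<inter> C)"
proof -
  have im: "(\<lambda>p\<in>P1. V) ` P1 = {V}" for V :: "(complex^'n) set" using P1_nonempty by auto
  show ?thesis
  proof (intro equalityI subsetI)
    fix f assume f: "f \<in> curves_meeting l 0 A B C"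
    then have "f \<in> rational_curves l 0" by (simp add: curves_meeting_def)
    then obtain V where V: "f = (\<lambda>p\<in>P1. V)" by (rule degree_0_curve_constant)
    show "f \<in> (\<lambda>V. \<lambda>p\<in>P1. V) ` (A \<inter> B \<inter> C)"
    proof (rule image_eqI[where x = V], rule V)
      have "f ` P1 \<inter> A \<noteq> {} \<and> f ` P1 \<inter> B \<noteq> {} \<and> f ` P1 \<inter> C \<noteq> {}"
        using f unfolding curves_meeting_def by (elim CollectE conjE) (intro conjI)
      moreover have "f ` P1 = {V}" unfolding V by (rule im)
      ultimately show "V \<in> A \<inter> B \<inter> C" by simp
    qed
  next
    fix f assume "f \<in> (\<lambda>V. \<lambda>p\<in>P1. V) ` (A \<inter> B \<inter> C)"
    then obtain V where V: "f = (\<lambda>p\<in>P1. V)" "V \<in> A \<inter> B \<inter> C" by blast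
    have "V \<in> Gr l" using V(2) assms by auto
    then have "f \<in> rational_curves l 0" unfolding V(1) by (rule constant_curve)
    moreover have "f ` P1 = {V}" unfolding V by (rule im)
    ultimately show "f \<in> curves_meeting l 0 A B C"
      using V(2) unfolding curves_meeting_def by (intro CollectI conjI) simp_all
  qed
qed

text \<open>With at most one curve there are as many classes as points of \<open>S\<close>, however
  \<open>reparametrization\<close> acts on it.\<close>

lemma degree_0_quotient:
  assumes "A \<subseteq> Gr l" "A \<inter> B \<inter> C = S" "finite S" "card S \<le> 1"
  shows "finite (curves_meeting l 0 A B C // reparametrization) \<and>
    card (curves_meeting l 0 A B C // reparametrization) = card S"
proof (cases "S = {}")
  case True
  then show ?thesis using curves_meeting_degree_0[OF assms(1)] assms(2) by (simp add: quotient_def)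
next
  case False
  then obtain V where "S = {V}" using assms(3,4) by (metis card_1_singletonE card_gt_0_iff le_antisym less_eq_Suc_le One_nat_def)
  then show ?thesis using curves_meeting_degree_0[OF assms(1)] assms(2) by (simp add: quotient_def)
qed

section \<open>Degree 0: the classical Pieri rule for hooks\<close>

definition vsum :: "(complex^'n) set \<Rightarrow> (complex^'n) set \<Rightarrow> (complex^'n) set" where
  "vsum S T = {x + y | x y. x \<in> S \<and> y \<in> T}"

lemma subspace_vsum: "vec.subspace S \<Longrightarrow> vec.subspace T \<Longrightarrow> vec.subspace (vsum S T)"
  unfolding vsum_def by (rule vec.subspace_sums)

lemma dim_vsum_Int:
  "vec.subspace S \<Longrightarrow> vec.subspace T \<Longrightarrow> vec.dim (vsum S T) + vec.dim (S \<inter> T) = vec.dim S + vec.dim T"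
  unfolding vsum_def by (rule vec.dim_sums_Int)

lemma vsum_subset: "vec.subspace V \<Longrightarrow> S \<subseteq> V \<Longrightarrow> T \<subseteq> V \<Longrightarrow> vsum S T \<subseteq> V"
  unfolding vsum_def by (auto intro: vec.subspace_add)

lemma subset_vsum1: "vec.subspace T \<Longrightarrow> S \<subseteq> vsum S T"
  unfolding vsum_def using vec.subspace_0 by force

lemma subset_vsum2: "vec.subspace S \<Longrightarrow> T \<subseteq> vsum S T"
  unfolding vsum_def using vec.subspace_0 by force

lemma dim_vsum_direct:
  assumes "vec.subspace S" "vec.subspace T" "S \<inter> T \<subseteq> {0}"
  shows "vec.dim (vsum S T) = vec.dim S + vec.dim T"
proof -
  have "vec.dim (S \<inter> T) = 0" using assms(3) by simp
  then show ?thesis using dim_vsum_Int[OF assms(1,2)] by linarith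
qed

lemma span_singleton_Int_subspace:
  assumes "vec.subspace S" "x \<notin> S"
  shows "S \<inter> vec.span {x} \<subseteq> {0}"
proof
  fix y assume "y \<in> S \<inter> vec.span {x}"
  then obtain c where c: "y = c *s x" "c *s x \<in> S" by (auto simp: span_singleton_iff)
  have "c = 0"
  proof (rule ccontr)
    assume "c \<noteq> 0"
    then have "x = inverse c *s (c *s x)" by simp
    then show False using c(2) assms vec.subspace_scale by metis
  qed
  then show "y \<in> {0}" using c by simp
qed

lemma dim_vsum_singleton:
  assumes "vec.subspace S" "x \<notin> S"
  shows "vec.dim (vsum S (vec.span {x})) = vec.dim S + 1"
proof -
  have "x \<noteq> 0" using assms vec.subspace_0 by metis
  then show ?thesis
    using dim_vsum_direct[OF assms(1) vec.subspace_span span_singleton_Int_subspace[OF assms]] by simp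
qed

lemma span_singleton_subset: "vec.subspace V \<Longrightarrow> x \<in> V \<Longrightarrow> vec.span {x} \<subseteq> V"
  by (intro vec.span_minimal) auto

lemma dim_ge_1_obtains:
  assumes "vec.dim S \<ge> 1"
  obtains x where "x \<in> S" "x \<noteq> 0"
proof -
  have "\<not> S \<subseteq> {0}" using assms vec.dim_eq_0[of S] by linarith
  then show ?thesis using that by blast
qed

text \<open>\<open>a\<close> is the length of the first row and \<open>s\<close> the number of rows.
  For \<open>s > l\<close> the list is longer than \<open>l\<close>, hence not in
  \<open>rect_partitions l k\<close>; this makes the boundary terms of the Pieri rule drop
  out.\<close>

definition hook :: "nat \<Rightarrow> nat \<Rightarrow> nat \<Rightarrow> nat list" where
  "hook l a s = a # replicate (s - 1) 1 @ replicate (l - s) 0"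

lemma length_le_sum_list:
  fixes xs :: "nat list"
  assumes "\<forall>x\<in>set xs. x \<noteq> 0"
  shows "length xs \<le> sum_list xs"
  using assms
proof (induction xs)
  case (Cons a xs)
  then have "length xs \<le> sum_list xs" "a \<ge> 1" by auto
  then show ?case by simp
qed simp

lemma sum_list_eq_length:
  fixes xs :: "nat list"
  assumes "\<forall>x\<in>set xs. x \<noteq> 0" "sum_list xs = length xs"
  shows "xs = replicate (length xs) 1"
  using assms
proof (induction xs)
  case (Cons a xs)
  have "length xs \<le> sum_list xs" using Cons.prems(1) by (intro length_le_sum_list) simp
  moreover have "a \<ge> 1" using Cons.prems(1) by auto
  ultimately have "a = 1" "sum_list xs = length xs" using Cons.prems(2) by auto
  then show ?case using Cons by auto
qed simp

lemma partition_shape: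
  assumes "\<nu> \<in> partitions l" "sum_list \<nu> > 0"
  obtains a xs where "\<nu> = a # xs @ replicate (l - Suc (length xs)) 0" "a \<noteq> 0" "\<forall>x\<in>set xs. x \<noteq> 0"
    "length xs < l"
proof -
  define ys where "ys = takeWhile (\<lambda>x. x \<noteq> 0) \<nu>"
  define zs where "zs = dropWhile (\<lambda>x. x \<noteq> 0) \<nu>"
  have \<nu>: "\<nu> = ys @ zs" by (simp add: ys_def zs_def)
  have len: "length \<nu> = l" and srt: "sorted_wrt (\<ge>) \<nu>" using assms(1) by (auto simp: partitions_def)
  have "zs = replicate (length zs) 0"
  proof (cases zs)
    case (Cons z zs')
    have "z = 0" using Cons hd_dropWhile[of "\<lambda>x. x \<noteq> 0" \<nu>] unfolding zs_def by (metis list.sel(1) list.distinct(1))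
    moreover have "sorted_wrt (\<ge>) zs" using srt \<nu> by (simp add: sorted_wrt_append)
    ultimately have "\<forall>x\<in>set zs. x = 0" using Cons by auto
    then show ?thesis by (simp add: replicate_length_same)
  qed simp
  moreover have "ys \<noteq> []"
  proof
    assume "ys = []"
    then have "\<nu> = replicate (length zs) 0" using \<nu> calculation by simp
    then have "sum_list \<nu> = 0" by (metis sum_list_replicate mult_zero_right)
    then show False using assms(2) by linarith
  qed
  then obtain a xs where ys: "ys = a # xs" by (cases ys) auto
  have "\<forall>x\<in>set ys. x \<noteq> 0" by (auto simp: ys_def dest: set_takeWhileD)
  moreover have "length zs = l - Suc (length xs)" "length xs < l" using len \<nu> ys by auto
  ultimately show ?thesis using that[of a xs] \<nu> ys by auto
qed

lemma sum_list_dual_partition: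
  assumes "\<nu> \<in> rect_partitions l k"
  shows "sum_list (dual_partition k \<nu>) + sum_list \<nu> = l * k"
proof -
  have "\<forall>x\<in>set \<nu>. x \<le> k" "length \<nu> = l" using assms by (auto simp: rect_partitions_def partitions_def)
  moreover from this(1) have "sum_list (map (\<lambda>x. k - x) \<nu>) + sum_list \<nu> = length \<nu> * k"
    by (induction \<nu>) auto
  ultimately show ?thesis by (simp add: dual_partition_def rev_map[symmetric])
qed

section \<open>Incidence conditions for three flags in general position\<close>

locale general_flags =
  fixes l k :: nat and F G H :: "nat \<Rightarrow> (complex^'n::finite) set"
  assumes gp: "in_general_position l k F G H" and n: "CARD('n) = l + k"
    and l: "l \<ge> 1" and k: "k \<ge> 1"
begin

lemma subspaces: "j \<le> l + k \<Longrightarrow> vec.subspace (F j)" "j \<le> l + k \<Longrightarrow> vec.subspace (G j)"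
    "j \<le> l + k \<Longrightarrow> vec.subspace (H j)"
  and dims: "j \<le> l + k \<Longrightarrow> vec.dim (F j) = j" "j \<le> l + k \<Longrightarrow> vec.dim (G j) = j"
    "j \<le> l + k \<Longrightarrow> vec.dim (H j) = j"
  and chain: "mono F" "mono G" "mono H"
  and FH: "a + b \<le> l + k \<Longrightarrow> F a \<inter> H b \<subseteq> {0}"
  and GH: "a + b \<le> l + k \<Longrightarrow> G a \<inter> H b \<subseteq> {0}"
  and FGH: "1 \<le> i \<Longrightarrow> i \<le> l \<Longrightarrow> 1 \<le> m \<Longrightarrow> m \<le> k \<Longrightarrow> x \<in> F (k + i - 1) \<Longrightarrow> y \<in> H (l - i) \<Longrightarrow>
    x + y \<in> G (k + 1 - m) \<inter> H (l + m) \<Longrightarrow> x + y = 0"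
  using gp unfolding in_general_position_def by blast+

lemma dim_le: "vec.dim (S :: (complex^'n) set) \<le> l + k"
  using dim_subset_UNIV_cart_gen[of S] n by simp

lemma full_dim:
  fixes S :: "(complex^'n) set"
  assumes "vec.subspace S" "l + k \<le> vec.dim S"
  shows "S = UNIV"
proof -
  have "vec.dim (UNIV :: (complex^'n) set) \<le> l + k" by (rule dim_le)
  with assms(2) have "vec.dim (UNIV :: (complex^'n) set) \<le> vec.dim S" by linarith
  then show ?thesis using assms(1)
    by (intro vec.subspace_dim_equal) (simp_all only: vec.subspace_UNIV subset_UNIV)
qed

lemma top: "X \<in> {F, G, H} \<Longrightarrow> X (l + k) = UNIV"
  using subspaces dims by (intro full_dim) auto

lemma H_mono: "a \<le> b \<Longrightarrow> H a \<subseteq> H b"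
  by (rule monoD[OF chain(3)])

text \<open>\<open>V \<inter> X b\<close> and \<open>X a\<close> both lie in \<open>X b\<close>, so
  passing down to \<open>X a\<close> costs at most \<open>b - a\<close> dimensions.\<close>

lemma codim:
  assumes V: "vec.subspace V" and X: "X \<in> {F, G, H}" and ab: "a \<le> b" "b \<le> l + k"
  shows "vec.dim (V \<inter> X b) \<le> vec.dim (V \<inter> X a) + (b - a)"
proof -
  have s: "vec.subspace (X a)" "vec.subspace (X b)" "vec.dim (X a) = a" "vec.dim (X b) = b" "X a \<subseteq> X b"
    using subspaces dims chain X ab by (auto dest: monoD)
  have U: "vec.subspace (V \<inter> X b)" using V s by (intro vec.subspace_inter)
  have "vec.dim (vsum (V \<inter> X b) (X a)) \<le> b"
    using vec.dim_subset[OF vsum_subset[OF s(2), of "V \<inter> X b" "X a"]] s by auto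
  moreover have "(V \<inter> X b) \<inter> X a = V \<inter> X a" using s(5) by auto
  ultimately show ?thesis using dim_vsum_Int[OF U s(1)] s(3) ab by simp
qed

lemma expected_dim:
  assumes V: "vec.subspace V" and X: "X \<in> {F, G, H}" and a: "a \<le> l + k"
  shows "vec.dim V \<le> vec.dim (V \<inter> X a) + (l + k - a)"
  using codim[OF V X a order.refl] top[OF X] by simp

text \<open>Condition \<open>i\<close> is the one with content: the earlier ones follow from it, one
  dimension being lost per step of the flag, and the later ones hold for every \<open>V\<close> by a
  dimension count.\<close>

lemma schubert_column:
  assumes "1 \<le> i" "i \<le> l"
  shows "V \<in> schubert_variety l k (replicate i 1 @ replicate (l - i) 0) F \<longleftrightarrow>
    V \<in> Gr l \<and> i \<le> vec.dim (V \<inter> F (k + i - 1))"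
proof
  assume "V \<in> schubert_variety l k (replicate i 1 @ replicate (l - i) 0) F"
  then have "V \<in> Gr l" "i \<le> vec.dim (V \<inter> F (k + i - (replicate i 1 @ replicate (l - i) 0) ! (i - 1)))"
    using assms by (auto simp: schubert_variety_def)
  then show "V \<in> Gr l \<and> i \<le> vec.dim (V \<inter> F (k + i - 1))" using assms by (simp add: nth_append)
next
  assume a: "V \<in> Gr l \<and> i \<le> vec.dim (V \<inter> F (k + i - 1))"
  then have V: "vec.subspace V" "vec.dim V = l" by (auto simp: Gr_def)
  have "j \<le> vec.dim (V \<inter> F (k + j - (replicate i 1 @ replicate (l - i) 0) ! (j - 1)))"
    if j: "1 \<le> j" "j \<le> l" for j
  proof (cases "j \<le> i")
    case True
    have "i \<le> vec.dim (V \<inter> F (k + j - 1)) + (k + i - 1 - (k + j - 1))"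
      using a codim[OF V(1), of F "k + j - 1" "k + i - 1"] True assms by fastforce
    then show ?thesis using True j by (auto simp: nth_append)
  next
    case False
    have "l \<le> vec.dim (V \<inter> F (k + j)) + (l + k - (k + j))"
      using expected_dim[OF V(1), of F "k + j"] V(2) j by auto
    then show ?thesis using False j by (auto simp: nth_append)
  qed
  then show "V \<in> schubert_variety l k (replicate i 1 @ replicate (l - i) 0) F"
    using a by (auto simp: schubert_variety_def)
qed

lemma schubert_row:
  assumes "1 \<le> m" "m \<le> k"
  shows "V \<in> schubert_variety l k (hook l m 1) G \<longleftrightarrow> V \<in> Gr l \<and> 1 \<le> vec.dim (V \<inter> G (k + 1 - m))"
proof
  assume "V \<in> schubert_variety l k (hook l m 1) G"
  then show "V \<in> Gr l \<and> 1 \<le> vec.dim (V \<inter> G (k + 1 - m))"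
    using l by (force simp: schubert_variety_def hook_def)
next
  assume a: "V \<in> Gr l \<and> 1 \<le> vec.dim (V \<inter> G (k + 1 - m))"
  then have V: "vec.subspace V" "vec.dim V = l" by (auto simp: Gr_def)
  have "j \<le> vec.dim (V \<inter> G (k + j - hook l m 1 ! (j - 1)))" if j: "1 \<le> j" "j \<le> l" for j
  proof (cases "j = 1")
    case True
    then show ?thesis using a by (simp add: hook_def)
  next
    case False
    have "l \<le> vec.dim (V \<inter> G (k + j)) + (l + k - (k + j))"
      using expected_dim[OF V(1), of G "k + j"] V(2) j by auto
    then show ?thesis using False j by (auto simp: hook_def nth_Cons')
  qed
  then show "V \<in> schubert_variety l k (hook l m 1) G"
    using a by (auto simp: schubert_variety_def)
qed

lemma schubert_dual_iff:
  assumes "\<nu> \<in> rect_partitions l k"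
  shows "V \<in> schubert_variety l k (dual_partition k \<nu>) H \<longleftrightarrow>
    V \<in> Gr l \<and> (\<forall>j \<in> {1..l}. j \<le> vec.dim (V \<inter> H (j + \<nu> ! (l - j))))"
proof -
  have "k + j - dual_partition k \<nu> ! (j - 1) = j + \<nu> ! (l - j)" if "1 \<le> j" "j \<le> l" for j
  proof -
    have len: "length \<nu> = l" using assms by (auto simp: rect_partitions_def partitions_def)
    moreover have "\<nu> ! (l - j) \<le> k" using assms that len by (auto simp: rect_partitions_def)
    ultimately show ?thesis using that by (simp add: dual_partition_def rev_nth)
  qed
  then show ?thesis by (auto simp: schubert_variety_def)
qed

text \<open>The conditions \<open>j = l\<close>, belonging to the first part, and
  \<open>j = l - s\<close>, belonging to the first of the trailing zeros, demand full dimension, so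
  they are inclusions.\<close>

lemma schubert_dual_bounds:
  assumes \<nu>: "\<nu> \<in> rect_partitions l k" "\<nu> = a # xs @ replicate (l - s) 0" "s = Suc (length xs)" "s \<le> l"
    and V: "V \<in> schubert_variety l k (dual_partition k \<nu>) H"
  shows "V \<in> Gr l" "H (l - s) \<subseteq> V" "V \<subseteq> H (l + a)" "a \<le> k"
proof -
  have c: "V \<in> Gr l" "\<And>j. 1 \<le> j \<Longrightarrow> j \<le> l \<Longrightarrow> j \<le> vec.dim (V \<inter> H (j + \<nu> ! (l - j)))"
    using V unfolding schubert_dual_iff[OF \<nu>(1)] by auto
  then have V': "vec.subspace V" "vec.dim V = l" by (auto simp: Gr_def)
  show "V \<in> Gr l" by fact
  show ak: "a \<le> k" using \<nu>(1,2) by (auto simp: rect_partitions_def)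
  have "l \<le> vec.dim (V \<inter> H (l + a))" using c(2)[of l] l \<nu>(2) by simp
  then have "V \<inter> H (l + a) = V"
    using V' subspaces ak by (intro vec.subspace_dim_equal vec.subspace_inter) auto
  then show "V \<subseteq> H (l + a)" by blast
  have "l - s \<le> vec.dim (V \<inter> H (l - s))"
  proof (cases "s = l")
    case False
    then have "\<nu> ! (l - (l - s)) = 0" using \<nu>(2,3,4) by (simp add: nth_append)
    then show ?thesis using c(2)[of "l - s"] False \<nu>(4) by simp
  qed simp
  then have "V \<inter> H (l - s) = H (l - s)"
    using V' subspaces dims by (intro vec.subspace_dim_equal vec.subspace_inter) auto
  then show "H (l - s) \<subseteq> V" by blast
qed

text \<open>Besides the two inclusions, a second part 1 bounds \<open>V \<inter> H l\<close> through
  condition \<open>j = l - 1\<close>; the remaining conditions follow by the dimension drop along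
  \<open>H\<close>. For \<open>s = 1\<close> this bound already comes from
  \<open>H (l - 1) \<subseteq> V\<close>.\<close>

lemma schubert_dual_hook:
  assumes s: "1 \<le> s" "s \<le> l" and a: "1 \<le> a" "a \<le> k" and h: "hook l a s \<in> rect_partitions l k"
  shows "V \<in> schubert_variety l k (dual_partition k (hook l a s)) H \<longleftrightarrow>
    V \<in> Gr l \<and> H (l - s) \<subseteq> V \<and> V \<subseteq> H (l + a) \<and> l - 1 \<le> vec.dim (V \<inter> H l)"
proof
  assume V: "V \<in> schubert_variety l k (dual_partition k (hook l a s)) H"
  have b: "V \<in> Gr l" "H (l - s) \<subseteq> V" "V \<subseteq> H (l + a)"
    using schubert_dual_bounds[OF h _ _ s(2) V, of a "replicate (s - 1) 1"] s by (auto simp: hook_def)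
  have "l - 1 \<le> vec.dim (V \<inter> H l)"
  proof (cases "s = 1")
    case True
    have "H (l - 1) \<subseteq> V \<inter> H l" using b(2) True H_mono[of "l - 1" l] by auto
    then show ?thesis using vec.dim_subset[of "H (l - 1)" "V \<inter> H l"] dims by simp
  next
    case False
    then have "hook l a s ! (l - (l - 1)) = 1" using s by (simp add: hook_def nth_append)
    moreover have "\<forall>j \<in> {1..l}. j \<le> vec.dim (V \<inter> H (j + hook l a s ! (l - j)))"
      using V unfolding schubert_dual_iff[OF h] by blast
    ultimately show ?thesis using False s by (metis One_nat_def Suc_leI atLeastAtMost_iff diff_add
          diff_le_self le_antisym le_add_diff_inverse2 linorder_not_less l zero_less_diff)
  qed
  then show "V \<in> Gr l \<and> H (l - s) \<subseteq> V \<and> V \<subseteq> H (l + a) \<and> l - 1 \<le> vec.dim (V \<inter> H l)" using b by blast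
next
  assume b: "V \<in> Gr l \<and> H (l - s) \<subseteq> V \<and> V \<subseteq> H (l + a) \<and> l - 1 \<le> vec.dim (V \<inter> H l)"
  then have V: "vec.subspace V" "vec.dim V = l" by (auto simp: Gr_def)
  have "j \<le> vec.dim (V \<inter> H (j + hook l a s ! (l - j)))" if j: "1 \<le> j" "j \<le> l" for j
  proof -
    consider "j = l" | "j \<noteq> l" "l - s < j" | "j \<le> l - s" by linarith
    then show ?thesis
    proof cases
      case 1
      have "V \<inter> H (l + a) = V" using b by blast
      then show ?thesis using 1 V by (simp add: hook_def)
    next
      case 2
      then have "hook l a s ! (l - j) = 1" using j s by (auto simp: hook_def nth_Cons' nth_append)
      moreover have "l - 1 \<le> vec.dim (V \<inter> H (j + 1)) + (l - (j + 1))"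
        using b codim[OF V(1), of H "j + 1" l] 2 j by fastforce
      ultimately show ?thesis using 2 j by simp
    next
      case 3
      then have "hook l a s ! (l - j) = 0" using j s by (auto simp: hook_def nth_Cons' nth_append)
      moreover have "H j \<subseteq> V \<inter> H j" using b H_mono[OF 3] by auto
      then have "j \<le> vec.dim (V \<inter> H j)" using vec.dim_subset[of "H j" "V \<inter> H j"] dims j by simp
      ultimately show ?thesis by simp
    qed
  qed
  then show "V \<in> schubert_variety l k (dual_partition k (hook l a s)) H"
    unfolding schubert_dual_iff[OF h] using b by auto
qed

section \<open>Intersecting a column of height i with a row of length m\<close>

context
  fixes i m :: nat
  assumes i: "1 \<le> i" "i \<le> l" and m: "1 \<le> m" "m \<le> k"
begin

abbreviation (input) "F' \<equiv> F (k + i - 1)"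
abbreviation (input) "G' \<equiv> G (k + 1 - m)"
text \<open>\<open>Q\<close> is a hyperplane and \<open>P\<close> has dimension
  \<open>i - 1\<close>. For \<open>V\<close> of dimension \<open>l\<close> that meets
  \<open>F'\<close> in dimension at least \<open>i\<close>: it lies in \<open>Q\<close> if it
  contains \<open>H (l - i)\<close>, and it contains \<open>P\<close> if it meets \<open>H l\<close>
  in dimension at least \<open>l - 1\<close>.\<close>

abbreviation (input) "Q \<equiv> vsum F' (H (l - i))"
abbreviation (input) "P \<equiv> F' \<inter> H l"

lemma sub: "vec.subspace F'" "vec.subspace G'" "vec.subspace Q" "vec.subspace P"
  using i m subspaces by (auto intro!: subspace_vsum vec.subspace_inter)

lemma F_H_zero: "F' \<inter> H (l - i) \<subseteq> {0}"
  by (rule FH) (use i in linarith)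

text \<open>The upper bound comes from \<open>F' \<inter> H (l - i + 1) = 0\<close>, the lower one
  from the expected dimension.\<close>

lemma dim_P: "vec.dim P = i - 1"
proof -
  have "vec.dim P \<le> vec.dim (F' \<inter> H (l - i + 1)) + (l - (l - i + 1))"
    using codim[OF sub(1), of H "l - i + 1" l] i by simp
  moreover have "vec.dim (F' \<inter> H (l - i + 1)) = 0" using FH[of "k + i - 1" "l - i + 1"] i by simp
  moreover have "k + i - 1 \<le> vec.dim P + (l + k - l)"
    using expected_dim[OF sub(1), of H l] dims(1)[of "k + i - 1"] i by simp
  ultimately show ?thesis using i by linarith
qed

lemma Q_zero: "x \<in> G' \<inter> H (l + m) \<inter> Q \<Longrightarrow> x = 0"
  using FGH[OF i m] unfolding vsum_def by blast

text \<open>\<open>V \<inter> F'\<close> and \<open>H (l - i)\<close> are independent and their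
  dimensions add up to at least \<open>l\<close>, so together they fill \<open>V\<close>.\<close>

lemma subset_Q:
  assumes V: "V \<in> Gr l" "H (l - i) \<subseteq> V" "i \<le> vec.dim (V \<inter> F')"
  shows "V \<subseteq> Q"
proof -
  have sV: "vec.subspace V" "vec.dim V = l" using V by (auto simp: Gr_def)
  have s: "vec.subspace (V \<inter> F')" "vec.subspace (H (l - i))"
    using sV sub subspaces by (auto intro: vec.subspace_inter)
  have "(V \<inter> F') \<inter> H (l - i) \<subseteq> {0}" using F_H_zero by auto
  then have "l \<le> vec.dim (vsum (V \<inter> F') (H (l - i)))"
    using dim_vsum_direct[OF s] V(3) dims(3)[of "l - i"] i by simp
  then have "vsum (V \<inter> F') (H (l - i)) = V"
    using sV s V(2) by (intro vec.subspace_dim_equal subspace_vsum vsum_subset) auto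
  then show ?thesis unfolding vsum_def by blast
qed

text \<open>Within \<open>V\<close> the subspaces \<open>V \<inter> F'\<close> and
  \<open>V \<inter> H l\<close> meet in dimension at least \<open>i + (l - 1) - l\<close>, which is
  the dimension of \<open>P\<close>.\<close>

lemma P_subset:
  assumes V: "V \<in> Gr l" "i \<le> vec.dim (V \<inter> F')" "l - 1 \<le> vec.dim (V \<inter> H l)"
  shows "P \<subseteq> V"
proof -
  have sV: "vec.subspace V" "vec.dim V = l" using V by (auto simp: Gr_def)
  have s: "vec.subspace (V \<inter> F')" "vec.subspace (V \<inter> H l)"
    using sV sub subspaces by (auto intro: vec.subspace_inter)
  have "vec.dim (vsum (V \<inter> F') (V \<inter> H l)) \<le> l"
    using vec.dim_subset[OF vsum_subset[OF sV(1), of "V \<inter> F'" "V \<inter> H l"]] sV(2) by auto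
  then have "i - 1 \<le> vec.dim ((V \<inter> F') \<inter> (V \<inter> H l))" using dim_vsum_Int[OF s] V(2,3) l by linarith
  then have "(V \<inter> F') \<inter> (V \<inter> H l) = P"
    using s sV sub dim_P subspaces(3)[of l] by (intro vec.subspace_dim_equal vec.subspace_inter) auto
  then show ?thesis by blast
qed

text \<open>For \<open>s < i\<close> the space \<open>F' \<inter> H (l - s)\<close> has dimension at
  most \<open>i - s - 1\<close>, so \<open>V \<inter> F'\<close> and \<open>H (l - s)\<close> would
  span at least \<open>l + 1\<close> dimensions inside \<open>V\<close>.\<close>

lemma no_short_column:
  assumes V: "V \<in> Gr l" "H (l - s) \<subseteq> V" "i \<le> vec.dim (V \<inter> F')"
  shows "i \<le> s"
proof (rule ccontr)
  assume si: "\<not> i \<le> s"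
  have sV: "vec.subspace V" "vec.dim V = l" using V by (auto simp: Gr_def)
  have s: "vec.subspace (V \<inter> F')" "vec.subspace (H (l - s))"
    using sV sub subspaces by (auto intro: vec.subspace_inter)
  have "vec.dim (F' \<inter> H (l - s)) \<le> vec.dim (F' \<inter> H (l - i + 1)) + (l - s - (l - i + 1))"
    using codim[OF sub(1), of H "l - i + 1" "l - s"] si i by simp
  moreover have "vec.dim (F' \<inter> H (l - i + 1)) = 0" using FH[of "k + i - 1" "l - i + 1"] i by simp
  moreover have "vec.dim ((V \<inter> F') \<inter> H (l - s)) \<le> vec.dim (F' \<inter> H (l - s))"
    by (rule vec.dim_subset) auto
  moreover have "vec.dim (vsum (V \<inter> F') (H (l - s))) \<le> l"
    using vec.dim_subset[OF vsum_subset[OF sV(1), of "V \<inter> F'" "H (l - s)"]] sV(2) V(2) by auto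
  ultimately show False
    using dim_vsum_Int[OF s] dims(3)[of "l - s"] V(3) si i by linarith
qed

lemma no_short_row:
  assumes V: "V \<subseteq> H (l + a)" "1 \<le> vec.dim (V \<inter> G')"
  shows "m \<le> a"
proof (rule ccontr)
  assume am: "\<not> m \<le> a"
  obtain x where "x \<in> V \<inter> G'" "x \<noteq> 0" using V(2) by (rule dim_ge_1_obtains)
  moreover have "G' \<inter> H (l + a) \<subseteq> {0}" by (rule GH) (use am m in linarith)
  ultimately show False using V(1) by auto
qed

text \<open>Excludes partitions with first row \<open>m\<close> and exactly \<open>i\<close> rows: a
  nonzero vector of \<open>V \<inter> G'\<close> would lie on the line
  \<open>G' \<inter> H (l + m)\<close> and in the hyperplane \<open>Q\<close> at the same
  time.\<close>

lemma corner_empty: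
  assumes V: "V \<in> Gr l" "H (l - i) \<subseteq> V" "i \<le> vec.dim (V \<inter> F')" "V \<subseteq> H (l + m)" "1 \<le> vec.dim (V \<inter> G')"
  shows False
proof -
  obtain x where "x \<in> V \<inter> G'" "x \<noteq> 0" using V(5) by (rule dim_ge_1_obtains)
  then show False using Q_zero[of x] subset_Q[OF V(1-3)] V(4) by auto
qed

text \<open>The hook \<open>(m + 1, 1^(i-1))\<close>. All of \<open>V\<close> is forced: it contains
  \<open>H (l - i)\<close> and \<open>P\<close>, which span \<open>l - 1\<close> dimensions inside
  \<open>H l\<close>, and the line \<open>G' \<inter> Q \<inter> H (l + (m + 1))\<close>.\<close>

lemma longer_row:
  assumes mk: "m + 1 \<le> k"
  shows "\<exists>!V. V \<in> Gr l \<and> i \<le> vec.dim (V \<inter> F') \<and> 1 \<le> vec.dim (V \<inter> G') \<and>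
    H (l - i) \<subseteq> V \<and> V \<subseteq> H (l + (m + 1)) \<and> l - 1 \<le> vec.dim (V \<inter> H l)"
proof -
  let ?L = "G' \<inter> Q \<inter> H (l + (m + 1))"
  have sGQ: "vec.subspace (G' \<inter> Q)" using sub by (auto intro: vec.subspace_inter)
  have sL: "vec.subspace ?L" using sub mk subspaces by (auto intro!: vec.subspace_inter)
  have "vec.dim Q = k + i - 1 + (l - i)"
    using dim_vsum_direct[OF sub(1), of "H (l - i)"] F_H_zero subspaces dims i by simp
  moreover have "vec.dim (vsum G' Q) \<le> l + k" by (rule dim_le)
  ultimately have "k - m \<le> vec.dim (G' \<inter> Q)"
    using dim_vsum_Int[OF sub(2,3)] dims(2)[of "k + 1 - m"] m i by linarith
  moreover have "vec.dim (G' \<inter> Q) \<le> vec.dim ?L + (l + k - (l + (m + 1)))"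
    by (rule expected_dim[OF sGQ]) (use mk in auto)
  ultimately have "1 \<le> vec.dim ?L" using mk by linarith
  then obtain g where g: "g \<in> ?L" "g \<noteq> 0" by (rule dim_ge_1_obtains)
  have "vec.dim ?L \<le> vec.dim (G' \<inter> Q \<inter> H (l + m)) + 1"
    using codim[OF sGQ, of H "l + m" "l + (m + 1)"] mk by simp
  moreover have "vec.dim (G' \<inter> Q \<inter> H (l + m)) = 0" unfolding vec.dim_eq_0 using Q_zero by blast
  ultimately have L1: "vec.dim ?L \<le> 1" by linarith
  have span_g: "vec.span {g} = ?L"
    using g sL L1 by (intro vec.subspace_dim_equal span_singleton_subset) auto
  have gH: "g \<notin> H (l + m)" using Q_zero[of g] g by blast
  have lm: "H l \<subseteq> H (l + m)" "H (l - i) \<subseteq> H l" "H l \<subseteq> H (l + (m + 1))"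
    by (simp_all add: H_mono)
  \<comment> \<open>The component \<open>f\<close> supplies the dimension of
    \<open>V0 \<inter> F'\<close> that is missing in \<open>P\<close>.\<close>
  obtain f h where fh: "g = f + h" "f \<in> F'" "h \<in> H (l - i)" using g(1) unfolding vsum_def by blast
  define B where "B = vsum (H (l - i)) P"
  have sB: "vec.subspace B" unfolding B_def using sub subspaces by (intro subspace_vsum) auto
  have "H (l - i) \<inter> P \<subseteq> {0}" using F_H_zero by auto
  then have dB: "vec.dim B = l - 1"
    unfolding B_def using dim_vsum_direct[of "H (l - i)" P] sub subspaces dims dim_P i by simp
  have BH: "B \<subseteq> H l" unfolding B_def using lm subspaces by (intro vsum_subset) auto
  define V0 where "V0 = vsum B (vec.span {g})"
  have "g \<notin> B" using BH lm(1) gH by blast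
  then have dV0: "vec.dim V0 = l" unfolding V0_def using dim_vsum_singleton[OF sB] dB l by simp
  have sV0: "vec.subspace V0" unfolding V0_def using sB by (intro subspace_vsum) auto
  have in0: "B \<subseteq> V0" "g \<in> V0"
    unfolding V0_def using subset_vsum1[OF vec.subspace_span, of B "{g}"] subset_vsum2[OF sB, of "vec.span {g}"]
    by (auto intro: vec.span_base)
  have B0: "H (l - i) \<subseteq> B" "P \<subseteq> B"
    unfolding B_def using sub subspaces by (auto intro!: subset_vsum1 subset_vsum2)
  show ?thesis
  proof (rule ex1I[of _ V0])
    have "f \<in> V0"
    proof -
      have "g - h \<in> V0" using in0 B0 fh(3) sV0 by (intro vec.subspace_diff) auto
      then show ?thesis using fh(1) by simp
    qed
    have "f \<notin> H l"
    proof
      assume "f \<in> H l"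
      then have "g \<in> H l" unfolding fh(1) using fh(3) lm(2) subspaces by (intro vec.subspace_add) auto
      then show False using gH lm(1) by blast
    qed
    have "vec.dim (vsum P (vec.span {f})) = i"
      using dim_vsum_singleton[OF sub(4), of f] \<open>f \<notin> H l\<close> dim_P i by simp
    moreover have "vsum P (vec.span {f}) \<subseteq> V0 \<inter> F'"
      using sV0 sub in0 B0 fh(2) \<open>f \<in> V0\<close> by (intro vsum_subset vec.subspace_inter span_singleton_subset) auto
    ultimately have 1: "i \<le> vec.dim (V0 \<inter> F')" using vec.dim_subset by metis
    have "vec.span {g} \<subseteq> V0 \<inter> G'" using in0 g sub sV0 by (intro span_singleton_subset vec.subspace_inter) auto
    then have 2: "1 \<le> vec.dim (V0 \<inter> G')" using vec.dim_subset[of "vec.span {g}" "V0 \<inter> G'"] g(2) by simp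
    have "B \<subseteq> V0 \<inter> H l" using in0 BH by blast
    then have 3: "l - 1 \<le> vec.dim (V0 \<inter> H l)" using vec.dim_subset[of B "V0 \<inter> H l"] dB by simp
    have 4: "V0 \<subseteq> H (l + (m + 1))"
      unfolding V0_def using BH lm g mk subspaces by (intro vsum_subset span_singleton_subset) auto
    show "V0 \<in> Gr l \<and> i \<le> vec.dim (V0 \<inter> F') \<and> 1 \<le> vec.dim (V0 \<inter> G') \<and>
      H (l - i) \<subseteq> V0 \<and> V0 \<subseteq> H (l + (m + 1)) \<and> l - 1 \<le> vec.dim (V0 \<inter> H l)"
      using 1 2 3 4 sV0 dV0 in0 B0 by (auto simp: Gr_def)
  next
    fix V assume V: "V \<in> Gr l \<and> i \<le> vec.dim (V \<inter> F') \<and> 1 \<le> vec.dim (V \<inter> G') \<and>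
      H (l - i) \<subseteq> V \<and> V \<subseteq> H (l + (m + 1)) \<and> l - 1 \<le> vec.dim (V \<inter> H l)"
    then have sV: "vec.subspace V" by (auto simp: Gr_def)
    obtain g' where g': "g' \<in> V \<inter> G'" "g' \<noteq> 0" using V dim_ge_1_obtains by metis
    then have "g' \<in> ?L" using V subset_Q[of V] by auto
    then obtain c where c: "g' = c *s g" unfolding span_g[symmetric] span_singleton_iff by blast
    then have "g = inverse c *s g'" using g'(2) by auto
    then have "g \<in> V" using g'(1) sV by (auto intro: vec.subspace_scale)
    moreover have "P \<subseteq> V" using P_subset V by blast
    ultimately have "V0 \<subseteq> V"
      unfolding V0_def B_def using sV V by (intro vsum_subset span_singleton_subset) auto
    then show "V = V0" using subspaces_eq[of V0 V] V sV0 dV0 by (auto simp: Gr_def)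
  qed
qed

text \<open>The hook \<open>(m, 1^i)\<close>. Here \<open>V\<close> no longer lies in
  \<open>Q\<close>. The line \<open>G' \<inter> H (l + m)\<close> is forced into \<open>V\<close>,
  and splitting its generator as \<open>g = f + h\<close> along \<open>F'\<close> and
  \<open>H l\<close> gives the last vector \<open>h\<close>, which is determined modulo
  \<open>P\<close>.\<close>

lemma longer_column:
  assumes il: "i + 1 \<le> l"
  shows "\<exists>!V. V \<in> Gr l \<and> i \<le> vec.dim (V \<inter> F') \<and> 1 \<le> vec.dim (V \<inter> G') \<and>
    H (l - (i + 1)) \<subseteq> V \<and> V \<subseteq> H (l + m) \<and> l - 1 \<le> vec.dim (V \<inter> H l)"
proof -
  let ?L = "G' \<inter> H (l + m)"
  have sL: "vec.subspace ?L" using sub m subspaces by (auto intro!: vec.subspace_inter)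
  have "1 \<le> vec.dim ?L"
    using expected_dim[OF sub(2), of H "l + m"] dims(2)[of "k + 1 - m"] m l by fastforce
  then obtain g where g: "g \<in> ?L" "g \<noteq> 0" by (rule dim_ge_1_obtains)
  have "vec.dim ?L \<le> vec.dim (G' \<inter> H (l + m - 1)) + (l + m - (l + m - 1))"
    using codim[OF sub(2), of H "l + m - 1" "l + m"] m by simp
  moreover have "vec.dim (G' \<inter> H (l + m - 1)) = 0" using GH[of "k + 1 - m" "l + m - 1"] m by simp
  ultimately have L1: "vec.dim ?L \<le> 1" using m by linarith
  have span_g: "vec.span {g} = ?L"
    using g sL L1 by (intro vec.subspace_dim_equal span_singleton_subset) auto
  have "G' \<inter> H l \<subseteq> {0}" by (rule GH) (use m in linarith)
  then have gH: "g \<notin> H l" using g by blast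
  have lm: "H l \<subseteq> H (l + m)" "H (l - (i + 1)) \<subseteq> H (l - i)" "H (l - i) \<subseteq> H l"
    by (simp_all add: H_mono)
  have sFH: "vec.subspace (vsum F' (H l))" using sub subspaces by (intro subspace_vsum) auto
  have "vec.dim (vsum F' (H l)) = l + k"
    using dim_vsum_Int[OF sub(1), of "H l"] dim_P subspaces dims(1)[of "k + i - 1"] dims(3)[of l] i by simp
  then have "vsum F' (H l) = UNIV" using sFH by (intro full_dim) auto
  then obtain f h where fh: "g = f + h" "f \<in> F'" "h \<in> H l" unfolding vsum_def by blast
  define A where "A = vsum (H (l - (i + 1))) P"
  have sA: "vec.subspace A" unfolding A_def using sub subspaces by (intro subspace_vsum) auto
  have "H (l - (i + 1)) \<inter> P \<subseteq> {0}" using F_H_zero lm(2) by blast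
  then have dA: "vec.dim A = l - 2"
    unfolding A_def using dim_vsum_direct[of "H (l - (i + 1))" P] sub subspaces dims dim_P i il by simp
  have AH: "A \<subseteq> H l" unfolding A_def using lm subspaces by (intro vsum_subset) auto
  \<comment> \<open>Otherwise \<open>g\<close> would lie in \<open>Q\<close>, against general
    position.\<close>
  have hA: "h \<notin> A"
  proof
    assume "h \<in> A"
    then obtain h' p where hp: "h = h' + p" "h' \<in> H (l - (i + 1))" "p \<in> P" unfolding A_def vsum_def by blast
    have "f + p \<in> F'" using fh(2) hp(3) sub by (intro vec.subspace_add) auto
    moreover have "g = (f + p) + h'" using fh(1) hp(1) by simp
    ultimately have "g \<in> Q" using hp(2) lm(2) unfolding vsum_def by blast
    then show False using Q_zero[of g] g by blast
  qed
  define B where "B = vsum A (vec.span {h})"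
  have sB: "vec.subspace B" unfolding B_def using sA by (intro subspace_vsum) auto
  have dB: "vec.dim B = l - 1" unfolding B_def using dim_vsum_singleton[OF sA hA] dA il i by simp
  have BH: "B \<subseteq> H l" unfolding B_def using AH fh(3) subspaces by (intro vsum_subset span_singleton_subset) auto
  define V0 where "V0 = vsum B (vec.span {g})"
  have "g \<notin> B" using BH gH by blast
  then have dV0: "vec.dim V0 = l" unfolding V0_def using dim_vsum_singleton[OF sB] dB l by simp
  have sV0: "vec.subspace V0" unfolding V0_def using sB by (intro subspace_vsum) auto
  have in0: "B \<subseteq> V0" "g \<in> V0"
    unfolding V0_def using subset_vsum1[OF vec.subspace_span, of B "{g}"] subset_vsum2[OF sB, of "vec.span {g}"]
    by (auto intro: vec.span_base)
  have AB: "A \<subseteq> B" "h \<in> B"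
    unfolding B_def using subset_vsum1[OF vec.subspace_span, of A "{h}"] subset_vsum2[OF sA, of "vec.span {h}"]
    by (auto intro: vec.span_base)
  have A0: "H (l - (i + 1)) \<subseteq> A" "P \<subseteq> A"
    unfolding A_def using sub subspaces by (auto intro!: subset_vsum1 subset_vsum2)
  show ?thesis
  proof (rule ex1I[of _ V0])
    have "f \<in> V0"
    proof -
      have "g - h \<in> V0" using in0 AB sV0 by (intro vec.subspace_diff) auto
      then show ?thesis using fh(1) by simp
    qed
    have "f \<notin> H l"
    proof
      assume "f \<in> H l"
      then have "g \<in> H l" unfolding fh(1) using fh(3) subspaces by (intro vec.subspace_add) auto
      then show False using gH by blast
    qed
    have "vec.dim (vsum P (vec.span {f})) = i"
      using dim_vsum_singleton[OF sub(4), of f] \<open>f \<notin> H l\<close> dim_P i by simp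
    moreover have "vsum P (vec.span {f}) \<subseteq> V0 \<inter> F'"
      using sV0 sub in0 A0 AB fh(2) \<open>f \<in> V0\<close> by (intro vsum_subset vec.subspace_inter span_singleton_subset) auto
    ultimately have 1: "i \<le> vec.dim (V0 \<inter> F')" using vec.dim_subset by metis
    have "vec.span {g} \<subseteq> V0 \<inter> G'" using in0 g sub sV0 by (intro span_singleton_subset vec.subspace_inter) auto
    then have 2: "1 \<le> vec.dim (V0 \<inter> G')" using vec.dim_subset[of "vec.span {g}" "V0 \<inter> G'"] g(2) by simp
    have "B \<subseteq> V0 \<inter> H l" using in0 BH by blast
    then have 3: "l - 1 \<le> vec.dim (V0 \<inter> H l)" using vec.dim_subset[of B "V0 \<inter> H l"] dB by simp
    have 4: "V0 \<subseteq> H (l + m)"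
      unfolding V0_def using BH lm g m subspaces by (intro vsum_subset span_singleton_subset) auto
    show "V0 \<in> Gr l \<and> i \<le> vec.dim (V0 \<inter> F') \<and> 1 \<le> vec.dim (V0 \<inter> G') \<and>
      H (l - (i + 1)) \<subseteq> V0 \<and> V0 \<subseteq> H (l + m) \<and> l - 1 \<le> vec.dim (V0 \<inter> H l)"
      using 1 2 3 4 sV0 dV0 in0 A0 AB by (auto simp: Gr_def)
  next
    fix V assume V: "V \<in> Gr l \<and> i \<le> vec.dim (V \<inter> F') \<and> 1 \<le> vec.dim (V \<inter> G') \<and>
      H (l - (i + 1)) \<subseteq> V \<and> V \<subseteq> H (l + m) \<and> l - 1 \<le> vec.dim (V \<inter> H l)"
    then have sV: "vec.subspace V" "vec.dim V = l" by (auto simp: Gr_def)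
    obtain g' where g': "g' \<in> V \<inter> G'" "g' \<noteq> 0" using V dim_ge_1_obtains by metis
    then have "g' \<in> ?L" using V by auto
    then obtain c where c: "g' = c *s g" unfolding span_g[symmetric] span_singleton_iff by blast
    then have "g = inverse c *s g'" using g'(2) by auto
    then have gV: "g \<in> V" using g'(1) sV by (auto intro: vec.subspace_scale)
    have PV: "P \<subseteq> V" using P_subset V by blast
    \<comment> \<open>\<open>V\<close> has a vector \<open>x\<close> of \<open>F'\<close> outside
      \<open>H l\<close>, and modulo \<open>V \<inter> H l\<close> it is a nonzero multiple of
      \<open>g\<close>. After rescaling, it differs from \<open>f\<close> by an element of
      \<open>F' \<inter> H l = P\<close>, which is contained in \<open>V\<close>; so
      \<open>h\<close> can be recovered within \<open>V\<close>.\<close>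
    have hV: "h \<in> V"
    proof -
      have "\<not> V \<inter> F' \<subseteq> P"
        using vec.dim_subset[of "V \<inter> F'" P] V dim_P i by fastforce
      then obtain x where x: "x \<in> V" "x \<in> F'" "x \<notin> H l" by blast
      have sVH: "vec.subspace (V \<inter> H l)" using sV subspaces by (intro vec.subspace_inter) auto
      have "vec.dim (vsum (V \<inter> H l) (vec.span {g})) = vec.dim (V \<inter> H l) + 1"
        using gH by (intro dim_vsum_singleton sVH) auto
      then have "vsum (V \<inter> H l) (vec.span {g}) = V"
        using sV sVH gV V by (intro vec.subspace_dim_equal subspace_vsum vsum_subset span_singleton_subset) auto
      then obtain y b where y: "x = y + b *s g" "y \<in> V" "y \<in> H l"
        using x(1) unfolding vsum_def span_singleton_iff by blast
      have b: "b \<noteq> 0" using y x(3) by auto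
      have p: "f - inverse b *s x = - (inverse b *s y) - h"
        using b unfolding y(1) fh(1) by (simp add: vec.scale_right_distrib algebra_simps)
      have "f - inverse b *s x \<in> F'"
        using fh(2) x(2) sub by (intro vec.subspace_diff vec.subspace_scale) auto
      moreover have "f - inverse b *s x \<in> H l"
        unfolding p using y(3) fh(3) subspaces
        by (intro vec.subspace_diff vec.subspace_neg vec.subspace_scale) auto
      ultimately have "- (inverse b *s y) - h \<in> V" unfolding p[symmetric] using PV by blast
      moreover have "- (inverse b *s y) \<in> V" using y(2) sV by (intro vec.subspace_neg vec.subspace_scale) auto
      ultimately have "- (inverse b *s y) - (- (inverse b *s y) - h) \<in> V" using sV by (metis vec.subspace_diff)
      then show ?thesis by simp
    qed
    have "V0 \<subseteq> V"
      unfolding V0_def B_def A_def using sV V PV hV gV by (intro vsum_subset span_singleton_subset) auto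
    then show "V = V0" using subspaces_eq[of V0 V] V sV0 dV0 by (auto simp: Gr_def)
  qed
qed

text \<open>If some \<open>V\<close> exists, the first row of \<nu> has length at least
  \<open>m\<close> and there are at least \<open>i\<close> rows. This accounts for
  \<open>i + m - 1\<close> of the \<open>i + m\<close> boxes. The last box lengthens the row, or the
  column, or lies off the hook, and \<open>corner_empty\<close> excludes the third
  possibility.\<close>

lemma hook_intersection:
  fixes \<nu> :: "nat list"
  assumes \<nu>: "\<nu> \<in> rect_partitions l k" "sum_list \<nu> = i + m"
  defines "S \<equiv> schubert_variety l k (replicate i 1 @ replicate (l - i) 0) F \<inter>
    schubert_variety l k (hook l m 1) G \<inter> schubert_variety l k (dual_partition k \<nu>) H"
  shows "finite S \<and> card S = (if \<nu> = hook l (m + 1) i \<or> \<nu> = hook l m (i + 1) then 1 else 0)"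
proof -
  have \<nu>p: "\<nu> \<in> partitions l" using \<nu>(1) by (simp add: rect_partitions_def)
  obtain a xs where sh: "\<nu> = a # xs @ replicate (l - Suc (length xs)) 0" "a \<noteq> 0" "\<forall>x\<in>set xs. x \<noteq> 0"
    "length xs < l"
    using partition_shape[OF \<nu>p] \<nu>(2) i by auto
  have ak: "a \<le> k" using \<nu>(1) sh(1) by (auto simp: rect_partitions_def)
  have sum: "a + sum_list xs = i + m" using \<nu>(2) sh(1) by (simp add: sum_list_replicate)
  show ?thesis
  proof (cases "\<nu> = hook l (m + 1) i \<or> \<nu> = hook l m (i + 1)")
    case True
    have "\<exists>!V. V \<in> S"
    proof (cases "\<nu> = hook l (m + 1) i")
      case True
      have mk: "m + 1 \<le> k" using True sh(1) ak by (simp add: hook_def)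
      have h: "hook l (m + 1) i \<in> rect_partitions l k" using \<nu>(1) True by simp
      have "V \<in> S \<longleftrightarrow> V \<in> Gr l \<and> i \<le> vec.dim (V \<inter> F') \<and> 1 \<le> vec.dim (V \<inter> G') \<and>
        H (l - i) \<subseteq> V \<and> V \<subseteq> H (l + (m + 1)) \<and> l - 1 \<le> vec.dim (V \<inter> H l)" for V
        unfolding S_def True Int_iff schubert_column[OF i] schubert_row[OF m]
          schubert_dual_hook[OF i le_add2 mk h] by blast
      then show ?thesis using longer_row[OF mk] by (simp only:)
    next
      case False
      with True have h: "\<nu> = hook l m (i + 1)" by blast
      have il: "i + 1 \<le> l" using h \<nu>p i by (auto simp: hook_def partitions_def)
      have h': "hook l m (i + 1) \<in> rect_partitions l k" using \<nu>(1) h by simp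
      have "V \<in> S \<longleftrightarrow> V \<in> Gr l \<and> i \<le> vec.dim (V \<inter> F') \<and> 1 \<le> vec.dim (V \<inter> G') \<and>
        H (l - (i + 1)) \<subseteq> V \<and> V \<subseteq> H (l + m) \<and> l - 1 \<le> vec.dim (V \<inter> H l)" for V
        unfolding S_def h Int_iff schubert_column[OF i] schubert_row[OF m]
          schubert_dual_hook[OF le_add2 il m h'] by blast
      then show ?thesis using longer_column[OF il] by (simp only:)
    qed
    then obtain V where "S = {V}" by blast
    then show ?thesis using True by simp
  next
    case False
    have "S = {}"
    proof (rule ccontr)
      assume "S \<noteq> {}"
      then obtain V where V: "V \<in> S" by blast
      have c: "V \<in> Gr l" "i \<le> vec.dim (V \<inter> F')" "1 \<le> vec.dim (V \<inter> G')"
        using V unfolding S_def Int_iff schubert_column[OF i] schubert_row[OF m] by blast+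
      have b: "H (l - Suc (length xs)) \<subseteq> V" "V \<subseteq> H (l + a)"
        using schubert_dual_bounds[OF \<nu>(1) sh(1) refl _] sh(4) V unfolding S_def by auto
      have le: "i \<le> Suc (length xs)" "m \<le> a"
        using no_short_column[OF c(1) b(1) c(2)] no_short_row[OF b(2) c(3)] by auto
      have len: "length xs \<le> sum_list xs" using length_le_sum_list[OF sh(3)] .
      consider "a = m" "Suc (length xs) = i" | "a = m + 1" "Suc (length xs) = i" | "a = m" "length xs = i"
        using le len sum by linarith
      then show False
      proof cases
        case 1
        then show False using corner_empty[OF c(1) _ c(2) _ c(3)] b by auto
      next
        case 2
        then have "xs = replicate (i - 1) 1" using sum_list_eq_length[OF sh(3)] sum by auto
        then show False using False sh(1) 2 by (auto simp: hook_def)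
      next
        case 3
        then have "xs = replicate i 1" using sum_list_eq_length[OF sh(3)] sum by auto
        then show False using False sh(1) 3 by (auto simp: hook_def)
      qed
    qed
    then show ?thesis using False by simp
  qed
qed

end

end

lemma gromov_witten_hook:
  assumes n: "CARD('n::finite) = l + k" and i: "1 \<le> i" "i \<le> l" and m: "1 \<le> m" "m \<le> k"
    and \<nu>: "\<nu> \<in> rect_partitions l k" "sum_list \<nu> = i + m"
  shows "gromov_witten TYPE('n) l k 0 (replicate i 1 @ replicate (l - i) 0) (hook l m 1) (dual_partition k \<nu>) =
    (if \<nu> = hook l (m + 1) i \<or> \<nu> = hook l m (i + 1) then 1 else 0)"
proof (rule gromov_witten_eqI[OF n])
  show "sum_list (replicate i 1 @ replicate (l - i) 0) + sum_list (hook l m 1) +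
      sum_list (dual_partition k \<nu>) = l * k + 0 * (l + k)"
    using sum_list_dual_partition[OF \<nu>(1)] \<nu>(2) by (simp add: hook_def sum_list_replicate)
next
  fix F G H :: "nat \<Rightarrow> (complex^'n) set" assume gp: "in_general_position l k F G H"
  interpret general_flags l k F G H using gp n i m by unfold_locales auto
  note S = hook_intersection[OF i m \<nu>]
  show "finite (curves_meeting l 0 (schubert_variety l k (replicate i 1 @ replicate (l - i) 0) F)
          (schubert_variety l k (hook l m 1) G) (schubert_variety l k (dual_partition k \<nu>) H) // reparametrization) \<and>
    card (curves_meeting l 0 (schubert_variety l k (replicate i 1 @ replicate (l - i) 0) F)
          (schubert_variety l k (hook l m 1) G) (schubert_variety l k (dual_partition k \<nu>) H) // reparametrization) =
    (if \<nu> = hook l (m + 1) i \<or> \<nu> = hook l m (i + 1) then 1 else 0)"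
    unfolding conjunct2[OF S, symmetric]
    by (rule degree_0_quotient[OF _ refl conjunct1[OF S]]) (use conjunct2[OF S] in \<open>auto simp: schubert_variety_def\<close>)
qed

section \<open>Reparametrizations\<close>

text \<open>Hides the coefficients, so that closure under products and substitution needs no
  convolution formula.\<close>

definition is_form :: "nat \<Rightarrow> (complex^2 \<Rightarrow> complex) \<Rightarrow> bool" where
  "is_form m h \<longleftrightarrow> (\<exists>c. \<forall>w. h w = binary_form m c w)"

lemma is_form_sum:
  assumes "\<And>a. a \<in> A \<Longrightarrow> is_form m (f a)"
  shows "is_form m (\<lambda>w. \<Sum>a\<in>A. f a w)"
proof -
  obtain c where c: "\<And>a w. a \<in> A \<Longrightarrow> f a w = binary_form m (c a) w"
    using assms unfolding is_form_def by metis
  have "(\<Sum>a\<in>A. f a w) = binary_form m (\<lambda>i. \<Sum>a\<in>A. 1 * c a i) w" for w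
    unfolding binary_form_sum[symmetric] by (simp add: c)
  then show ?thesis unfolding is_form_def by blast
qed

lemma is_form_scale:
  assumes "is_form m f"
  shows "is_form m (\<lambda>w. a * f w)"
proof -
  obtain c where c: "\<And>w. f w = binary_form m c w" using assms unfolding is_form_def by blast
  have "a * f w = binary_form m (\<lambda>i. a * c i) w" for w
    by (simp add: c binary_form_def sum_distrib_left mult.assoc)
  then show ?thesis unfolding is_form_def by blast
qed

lemma is_form_monomial:
  assumes "i + j = m"
  shows "is_form m (\<lambda>w. w $ 1 ^ i * w $ 2 ^ j)"
proof -
  have "w $ 1 ^ i * w $ 2 ^ j = binary_form m (\<lambda>t. if t = i then 1 else 0) w" for w :: "complex^2"
  proof -
    have "binary_form m (\<lambda>t. if t = i then 1 else 0) w = (\<Sum>t\<in>{i}. w $ 1 ^ t * w $ 2 ^ (m - t))"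
      unfolding binary_form_def using assms by (intro sum.mono_neutral_cong_right) auto
    then show ?thesis using assms by auto
  qed
  then show ?thesis unfolding is_form_def by blast
qed

lemma is_form_mult:
  assumes "is_form m f" "is_form m' g"
  shows "is_form (m + m') (\<lambda>w. f w * g w)"
proof -
  obtain c d where c: "\<And>w. f w = binary_form m c w" "\<And>w. g w = binary_form m' d w"
    using assms unfolding is_form_def by blast
  have "f w * g w = (\<Sum>i\<in>{..m}. \<Sum>j\<in>{..m'}. (c i * d j) * (w $ 1 ^ (i + j) * w $ 2 ^ ((m - i) + (m' - j))))" for w
    unfolding c binary_form_def sum_product
    unfolding power_add by (intro sum.cong refl) (simp only: mult_ac)
  then show ?thesis
    by (simp only:) (intro is_form_sum is_form_scale is_form_monomial, simp)
qed

lemma is_form_power: "is_form m f \<Longrightarrow> is_form (i * m) (\<lambda>w. f w ^ i)"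
proof (induction i)
  case 0
  show ?case using is_form_monomial[of 0 0 0] by simp
next
  case (Suc i)
  then show ?case using is_form_mult[of m f "i * m" "\<lambda>w. f w ^ i"] by simp
qed

lemma is_form_compose:
  assumes "is_form m h" "is_form m' g1" "is_form m' g2"
  shows "is_form (m * m') (\<lambda>w. h (vector [g1 w, g2 w]))"
proof -
  obtain c where c: "\<And>w. h w = binary_form m c w" using assms unfolding is_form_def by blast
  have "is_form (m * m') (\<lambda>w. c i * (g1 w ^ i * g2 w ^ (m - i)))" if "i \<in> {..m}" for i
  proof -
    have "i * m' + (m - i) * m' = m * m'" using that by (simp flip: add_mult_distrib)
    then show ?thesis
      using is_form_scale[OF is_form_mult[OF is_form_power[OF assms(2), of i] is_form_power[OF assms(3), of "m - i"]], of "c i"]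
      by simp
  qed
  then have "is_form (m * m') (\<lambda>w. \<Sum>i\<in>{..m}. c i * (g1 w ^ i * g2 w ^ (m - i)))" by (rule is_form_sum)
  then show ?thesis by (simp add: c binary_form_def mult.assoc)
qed

lemma regular_map_iff:
  "regular_map l (f :: (complex^2) set \<Rightarrow> (complex^'n::finite) set) \<longleftrightarrow>
    (\<exists>m P. (\<forall>I. is_form m (P I)) \<and> (\<forall>w. w \<noteq> 0 \<longrightarrow>
      (\<exists>v. basis_of l v (f (vec.span {w})) \<and> (\<forall>I. length I = l \<longrightarrow> plucker l v I = P I w))))"
proof
  assume "regular_map l f"
  then obtain m and c :: "'n list \<Rightarrow> nat \<Rightarrow> complex" where "\<forall>w. w \<noteq> 0 \<longrightarrow>
    (\<exists>v. basis_of l v (f (vec.span {w})) \<and>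
      (\<forall>I. length I = l \<longrightarrow> plucker l v I = binary_form m (c I) w))"
    unfolding regular_map_def by blast
  moreover have "\<forall>I. is_form m (binary_form m (c I))" unfolding is_form_def by blast
  ultimately show "\<exists>m P. (\<forall>I. is_form m (P I)) \<and> (\<forall>w. w \<noteq> 0 \<longrightarrow>
      (\<exists>v. basis_of l v (f (vec.span {w})) \<and> (\<forall>I. length I = l \<longrightarrow> plucker l v I = P I w)))"
    by (intro exI[of _ m] exI[of _ "\<lambda>I. binary_form m (c I)"] conjI)
next
  assume "\<exists>m P. (\<forall>I. is_form m (P I)) \<and> (\<forall>w. w \<noteq> 0 \<longrightarrow>
      (\<exists>v. basis_of l v (f (vec.span {w})) \<and> (\<forall>I. length I = l \<longrightarrow> plucker l v I = P I w)))"
  then obtain m P where P: "\<forall>I. is_form m (P I)" "\<And>w. w \<noteq> 0 \<Longrightarrow>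
      \<exists>v. basis_of l v (f (vec.span {w})) \<and> (\<forall>I. length I = l \<longrightarrow> plucker l v I = P I w)"
    by blast
  from P(1) obtain c where c: "\<And>I w. P I w = binary_form m (c I) w"
    unfolding is_form_def by metis
  show "regular_map l f"
    unfolding regular_map_def
    by (intro exI[of _ m] exI[of _ c] allI impI) (use P(2) c in simp)
qed

lemma regular_map_cong:
  assumes "regular_map l f" "\<And>p. p \<in> P1 \<Longrightarrow> f p = g p"
  shows "regular_map l g"
proof -
  have "f (vec.span {w}) = g (vec.span {w})" if "w \<noteq> 0" for w
    using assms(2) span_singleton_in_Gr[OF that] by blast
  then show ?thesis using assms(1) unfolding regular_map_def by simp
qed

lemma plucker_1: "plucker 1 v [a] = v 0 $ a"
proof -
  have "{\<pi>. \<pi> permutes {..<1::nat}} = {id}" by (auto simp: lessThan_Suc)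
  then show ?thesis by (simp add: plucker_def lessThan_Suc)
qed

lemma regular_map_1_point:
  assumes "basis_of 1 v p"
  shows "v 0 \<noteq> 0" "p = vec.span {v 0}"
  using assms by (auto simp: basis_of_def lessThan_Suc)

text \<open>The two coordinate forms of \<phi> are substituted into the Pluecker forms of
  \<open>f\<close>, and the degrees multiply.\<close>

lemma regular_map_compose:
  fixes f :: "(complex^2) set \<Rightarrow> (complex^'n::finite) set"
  assumes f: "regular_map l f" and \<phi>: "regular_map 1 \<phi>"
  shows "regular_map l (\<lambda>p. f (\<phi> p))"
proof -
  obtain m P where P: "\<forall>I. is_form m (P I)" "\<And>w. w \<noteq> 0 \<Longrightarrow>
      \<exists>v. basis_of l v (f (vec.span {w})) \<and> (\<forall>I. length I = l \<longrightarrow> plucker l v I = P I w)"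
    using f unfolding regular_map_iff by blast
  obtain m' R where R: "\<forall>I. is_form m' (R I)" "\<And>w. w \<noteq> 0 \<Longrightarrow>
      \<exists>v. basis_of 1 v (\<phi> (vec.span {w})) \<and> (\<forall>I. length I = 1 \<longrightarrow> plucker 1 v I = R I w)"
    using \<phi> unfolding regular_map_iff by blast
  have "\<exists>v. basis_of l v (f (\<phi> (vec.span {w}))) \<and>
      (\<forall>I. length I = l \<longrightarrow> plucker l v I = P I (vector [R [1] w, R [2] w]))" if "w \<noteq> 0" for w
  proof -
    obtain v where v: "basis_of 1 v (\<phi> (vec.span {w}))" "\<forall>I. length I = 1 \<longrightarrow> plucker 1 v I = R I w"
      using R(2)[OF \<open>w \<noteq> 0\<close>] by blast
    \<comment> \<open>On the projective line the Pluecker coordinates are just the homogeneous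
      coordinates of the point.\<close>
    have "v 0 $ a = R [a] w" for a using v(2) plucker_1 by (metis One_nat_def length_Cons list.size(3))
    then have "v 0 = vector [R [1] w, R [2] w]" by (simp add: Finite_Cartesian_Product.vec_eq_iff forall_2)
    then show ?thesis using P(2)[OF regular_map_1_point(1)[OF v(1)]] regular_map_1_point(2)[OF v(1)] by simp
  qed
  moreover have "\<forall>I. is_form (m * m') (\<lambda>w. P I (vector [R [1] w, R [2] w]))"
    using is_form_compose P(1) R(1) by blast
  ultimately show ?thesis
    unfolding regular_map_iff
    by (intro exI[of _ "m * m'"] exI[of _ "\<lambda>I w. P I (vector [R [1] w, R [2] w])"] conjI allI impI) simp_all
qed

lemma P1_automorphisms_compose:
  assumes "\<phi> \<in> P1_automorphisms" "\<psi> \<in> P1_automorphisms"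
  shows "(\<lambda>p. \<phi> (\<psi> p)) \<in> P1_automorphisms"
proof -
  have b: "bij_betw \<phi> P1 P1" "bij_betw \<psi> P1 P1" and r: "regular_map 1 \<phi>" "regular_map 1 \<psi>"
    "regular_map 1 (inv_into P1 \<phi>)" "regular_map 1 (inv_into P1 \<psi>)"
    using assms by (auto simp: P1_automorphisms_def)
  have bc: "bij_betw (\<lambda>p. \<phi> (\<psi> p)) P1 P1" using bij_betw_trans[OF b(2,1)] by (simp add: comp_def)
  have "inv_into P1 \<psi> (inv_into P1 \<phi> p) = inv_into P1 (\<lambda>p. \<phi> (\<psi> p)) p" if "p \<in> P1" for p
  proof -
    have "inv_into P1 \<phi> p \<in> P1" using bij_betw_inv_into[OF b(1)] that by (rule bij_betwE[rule_format])
    then have "inv_into P1 \<psi> (inv_into P1 \<phi> p) \<in> P1"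
      using bij_betw_inv_into[OF b(2)] bij_betwE by blast
    moreover have "\<phi> (\<psi> (inv_into P1 \<psi> (inv_into P1 \<phi> p))) = p"
      using bij_betw_inv_into_right[OF b(2)] bij_betw_inv_into_right[OF b(1)] that
        \<open>inv_into P1 \<phi> p \<in> P1\<close> by simp
    ultimately show ?thesis
      using inv_into_f_f[of "\<lambda>p. \<phi> (\<psi> p)" P1 "inv_into P1 \<psi> (inv_into P1 \<phi> p)"] bc
      by (simp add: bij_betw_def)
  qed
  then have "regular_map 1 (inv_into P1 (\<lambda>p. \<phi> (\<psi> p)))"
    using regular_map_cong[OF regular_map_compose[OF r(4,3)]] by blast
  then show ?thesis using bc regular_map_compose[OF r(1,2)] by (simp add: P1_automorphisms_def)
qed

lemma P1_automorphisms_inverse: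
  assumes "\<phi> \<in> P1_automorphisms"
  shows "inv_into P1 \<phi> \<in> P1_automorphisms"
proof -
  have b: "bij_betw \<phi> P1 P1" and r: "regular_map 1 \<phi>" "regular_map 1 (inv_into P1 \<phi>)"
    using assms by (auto simp: P1_automorphisms_def)
  have "\<phi> p = inv_into P1 (inv_into P1 \<phi>) p" if "p \<in> P1" for p
    using inv_into_inv_into_eq[OF b that] by simp
  then have "regular_map 1 (inv_into P1 (inv_into P1 \<phi>))" using regular_map_cong[OF r(1)] by blast
  then show ?thesis using bij_betw_inv_into[OF b] r by (simp add: P1_automorphisms_def)
qed

text \<open>The automorphisms are closed under composition and inverses, so \<open>f\<close> and
  \<open>compose P1 f \<phi>\<close> have the same composites.\<close>

lemma reparametrization_class_eq:
  assumes \<phi>: "\<phi> \<in> P1_automorphisms"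
  shows "reparametrization `` {compose P1 f \<phi>} = reparametrization `` {f}"
proof -
  have b: "bij_betw \<phi> P1 P1" using \<phi> by (auto simp: P1_automorphisms_def)
  have maps: "\<psi> p \<in> P1" if "\<psi> \<in> P1_automorphisms" "p \<in> P1" for \<psi> p
    using that bij_betwE by (fastforce simp: P1_automorphisms_def)
  have cc: "compose P1 (compose P1 f \<phi>) \<psi> = compose P1 f (\<lambda>p. \<phi> (\<psi> p))"
    if "\<psi> \<in> P1_automorphisms" for \<psi>
    unfolding compose_def using maps[OF that] by (intro restrict_ext) (simp add: restrict_apply')
  show ?thesis
  proof (intro equalityI subsetI)
    fix g assume "g \<in> reparametrization `` {compose P1 f \<phi>}"
    then obtain \<psi> where "\<psi> \<in> P1_automorphisms" "g = compose P1 (compose P1 f \<phi>) \<psi>"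
      by (auto simp: reparametrization_def)
    then show "g \<in> reparametrization `` {f}"
      using cc P1_automorphisms_compose[OF \<phi>] by (auto simp: reparametrization_def)
  next
    fix g assume "g \<in> reparametrization `` {f}"
    then obtain \<theta> where \<theta>: "\<theta> \<in> P1_automorphisms" "g = compose P1 f \<theta>"
      by (auto simp: reparametrization_def)
    let ?\<psi> = "\<lambda>p. inv_into P1 \<phi> (\<theta> p)"
    have \<psi>: "?\<psi> \<in> P1_automorphisms" using P1_automorphisms_compose[OF P1_automorphisms_inverse[OF \<phi>] \<theta>(1)] .
    have "compose P1 (compose P1 f \<phi>) ?\<psi> = g"
      unfolding cc[OF \<psi>] \<theta>(2) unfolding compose_def
      by (intro restrict_ext) (simp only: bij_betw_inv_into_right[OF b maps[OF \<theta>(1)]])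
    then show "g \<in> reparametrization `` {compose P1 f \<phi>}"
      using \<psi> by (auto simp: reparametrization_def)
  qed
qed

lemma image_span_singleton: "(\<lambda>w. A *v w) ` vec.span {w} = vec.span {A *v w :: complex^2}"
  by (simp add: vec.span_singleton image_image vector_scalar_commute)

lemma matrix_automorphism:
  fixes A :: "complex^2^2"
  assumes "invertible A"
  shows "(\<lambda>p. (\<lambda>w. A *v w) ` p) \<in> P1_automorphisms"
proof -
  obtain B where AB: "A ** B = Finite_Cartesian_Product.mat 1" "B ** A = Finite_Cartesian_Product.mat 1" using assms unfolding invertible_def by blast
  have inv: "A *v (B *v w) = w" "B *v (A *v w) = w" for w :: "complex^2"
    using AB by (simp_all add: matrix_vector_mul_assoc)
  have nz: "A *v w \<noteq> 0" "B *v w \<noteq> 0" if "w \<noteq> 0" for w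
    using inv that by (metis matrix_vector_mult_0_right)+
  have im: "(\<lambda>w. A *v w) ` p \<in> P1" "(\<lambda>w. B *v w) ` p \<in> P1" if "p \<in> P1" for p
    using that nz unfolding P1_iff by (metis image_span_singleton)+
  have ii: "(\<lambda>w. A *v w) ` (\<lambda>w. B *v w) ` p = p" "(\<lambda>w. B *v w) ` (\<lambda>w. A *v w) ` p = p" for p
    by (simp_all add: image_image inv)
  have bij: "bij_betw (\<lambda>p. (\<lambda>w. A *v w) ` p) P1 P1"
    by (rule bij_betw_byWitness[where f' = "\<lambda>p. (\<lambda>w. B *v w) ` p"]) (use im ii in auto)
  have "(\<lambda>w. B *v w) ` p = inv_into P1 (\<lambda>p. (\<lambda>w. A *v w) ` p) p" if "p \<in> P1" for p
    using inv_into_f_f[of "\<lambda>p. (\<lambda>w. A *v w) ` p" P1 "(\<lambda>w. B *v w) ` p"] bij im(2)[OF that] ii(1)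
    by (simp add: bij_betw_def)
  moreover have reg: "regular_map 1 (\<lambda>p. (\<lambda>w. C *v w) ` p)" if C: "\<And>w. w \<noteq> 0 \<Longrightarrow> C *v w \<noteq> 0" for C :: "complex^2^2"
  proof -
    have "\<exists>v. basis_of 1 v ((\<lambda>w. C *v w) ` vec.span {w}) \<and> (\<forall>I. length I = 1 \<longrightarrow> plucker 1 v I = (C *v w) $ hd I)"
      if "w \<noteq> 0" for w
    proof (intro exI[of _ "\<lambda>_. C *v w"] conjI allI impI)
      show "basis_of 1 (\<lambda>_. C *v w) ((\<lambda>w. C *v w) ` vec.span {w})"
        using C[OF that] by (simp add: basis_of_def image_span_singleton lessThan_Suc)
      fix I :: "2 list" assume "length I = 1"
      then obtain a where "I = [a]" by (auto simp: length_Suc_conv)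
      then show "plucker 1 (\<lambda>_. C *v w) I = (C *v w) $ hd I" using plucker_1[of "\<lambda>_. C *v w" a] by simp
    qed
    moreover have "is_form 1 (\<lambda>w. (C *v w) $ a)" for a
    proof -
      have "(C *v w) $ a = binary_form 1 (\<lambda>i. if i = 0 then C $ a $ 2 else C $ a $ 1) w" for w
        by (simp add: binary_form_def matrix_vector_mult_def sum_2)
      then show ?thesis unfolding is_form_def by blast
    qed
    ultimately show ?thesis
      unfolding regular_map_iff by (intro exI[of _ 1] exI[of _ "\<lambda>I w. (C *v w) $ hd I"]) blast
  qed
  ultimately have "regular_map 1 (inv_into P1 (\<lambda>p. (\<lambda>w. A *v w) ` p))"
    using regular_map_cong[OF reg[OF nz(2)]] by blast
  then show ?thesis using bij reg[OF nz(1)] by (simp add: P1_automorphisms_def)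
qed


section \<open>Curves of degree 1\<close>

text \<open>All \<open>m\<close> roots coincide with \<open>w0\<close>. If \<open>w0\<close> is at
  infinity, the dehomogenization has no zero and is constant; if \<open>w0\<close> is finite, it has
  full degree \<open>m\<close> and factors completely.\<close>

lemma binary_form_single_root:
  assumes w0: "w0 \<noteq> 0" "binary_form m c w0 = 0"
    and u: "\<And>w. w \<noteq> 0 \<Longrightarrow> binary_form m c w = 0 \<Longrightarrow> w \<in> vec.span {w0}"
  shows "\<exists>\<alpha>. \<forall>w. binary_form m c w = \<alpha> * (w $ 1 * w0 $ 2 - w $ 2 * w0 $ 1) ^ m"
proof (cases "w0 $ 2 = 0")
  case True
  then have w01: "w0 $ 1 \<noteq> 0" using w0(1) by (auto simp: Finite_Cartesian_Product.vec_eq_iff forall_2)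
  have "poly (dehomogenization m c) x \<noteq> 0" for x
  proof
    assume "poly (dehomogenization m c) x = 0"
    then have "binary_form m c (vector [x, 1]) = 0" by (simp add: binary_form_dehomogenization)
    moreover have "(vector [x, 1] :: complex^2) \<noteq> 0"
      by (metis vector_2(2) zero_index zero_neq_one)
    ultimately have "vector [x, 1] \<in> vec.span {w0}" by (rule u[rotated])
    then obtain d where "(vector [x, 1] :: complex^2) = d *s w0" by (auto simp: span_singleton_iff)
    then have "(vector [x, 1] :: complex^2) $ 2 = (d *s w0) $ 2" by simp
    then show False using True by simp
  qed
  then have "constant (poly (dehomogenization m c))" using fundamental_theorem_of_algebra by blast
  then have deg: "degree (dehomogenization m c) = 0" by (simp add: constant_degree)
  have z: "c i = 0" if "i \<noteq> 0" "i \<le> m" for i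
    using coeff_eq_0[of "dehomogenization m c" i] deg that by (simp add: coeff_dehomogenization)
  have "binary_form m c w = c 0 * w $ 2 ^ m" for w
  proof -
    have "binary_form m c w = (\<Sum>i\<in>{0}. c i * w $ 1 ^ i * w $ 2 ^ (m - i))"
      unfolding binary_form_def using z by (intro sum.mono_neutral_right) auto
    then show ?thesis by simp
  qed
  moreover have "(w $ 1 * w0 $ 2 - w $ 2 * w0 $ 1) ^ m = w $ 2 ^ m * (- (w0 $ 1)) ^ m" for w :: "complex^2"
    using True by (simp flip: power_mult_distrib)
  ultimately show ?thesis using w01 by (intro exI[of _ "c 0 / (- (w0 $ 1)) ^ m"]) simp
next
  case False
  define r where "r = w0 $ 1 / w0 $ 2"
  \<comment> \<open>A vanishing top coefficient would produce a second root, at infinity.\<close>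
  have "c m \<noteq> 0"
  proof
    assume "c m = 0"
    then have "binary_form m c (vector [1, 0]) = 0" by (simp add: binary_form_infinity)
    moreover have "(vector [1, 0] :: complex^2) \<noteq> 0"
      by (metis vector_2(1) zero_index zero_neq_one)
    ultimately have "vector [1, 0] \<in> vec.span {w0}" by (rule u[rotated])
    then obtain d where d: "(vector [1, 0] :: complex^2) = d *s w0" by (auto simp: span_singleton_iff)
    then have "(vector [1, 0] :: complex^2) $ 2 = (d *s w0) $ 2" "(vector [1, 0] :: complex^2) $ 1 = (d *s w0) $ 1"
      by simp_all
    then show False using False by auto
  qed
  let ?P = "dehomogenization m c"
  have "degree ?P \<ge> m" using \<open>c m \<noteq> 0\<close> by (intro le_degree) (simp add: coeff_dehomogenization)
  moreover have "degree ?P \<le> m" by (rule degree_le) (simp add: coeff_dehomogenization)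
  ultimately have deg: "degree ?P = m" by simp
  have "binary_form m c w0 = w0 $ 2 ^ m * poly ?P r"
    using binary_form_dehomogenization[OF False] by (simp add: r_def)
  then have "poly ?P r = 0" using w0(2) False by simp
  moreover have "x = r" if "poly ?P x = 0" for x
  proof -
    have "binary_form m c (vector [x, 1]) = 0" using that by (simp add: binary_form_dehomogenization)
    moreover have "(vector [x, 1] :: complex^2) \<noteq> 0"
      by (metis vector_2(2) zero_index zero_neq_one)
    ultimately have "vector [x, 1] \<in> vec.span {w0}" by (rule u[rotated])
    then obtain d where d: "(vector [x, 1] :: complex^2) = d *s w0" by (auto simp: span_singleton_iff)
    then have "(vector [x, 1] :: complex^2) $ 2 = (d *s w0) $ 2" "(vector [x, 1] :: complex^2) $ 1 = (d *s w0) $ 1"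
      by simp_all
    then show ?thesis using False by (simp add: r_def field_simps)
  qed
  ultimately have roots: "{z. poly ?P z = 0} = {r}" by blast
  have "?P = Polynomial.smult (lead_coeff ?P) ([:- r, 1:] ^ order r ?P)"
    using complex_poly_decompose[of ?P] unfolding roots by simp
  moreover from this have "m = order r ?P"
    using deg \<open>c m \<noteq> 0\<close> by (metis coeff_dehomogenization degree_linear_power degree_smult_eq le_refl)
  ultimately have P: "poly ?P x = c m * (x - r) ^ m" for x
    using deg by (metis (no_types) coeff_dehomogenization diff_conv_add_uminus add.commute le_refl mult.right_neutral
        poly_0 poly_pCons poly_power poly_smult mult_zero_right add_0_right)
  show ?thesis
  proof (intro exI[of _ "c m / w0 $ 2 ^ m"] allI)
    fix w :: "complex^2"
    have L: "w $ 1 * w0 $ 2 - w $ 2 * w0 $ 1 = w0 $ 2 * (w $ 1 - r * w $ 2)"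
      using False by (simp add: r_def field_simps)
    have "binary_form m c w = c m * (w $ 1 - r * w $ 2) ^ m"
    proof (cases "w $ 2 = 0")
      case True
      then show ?thesis by (simp add: binary_form_infinity)
    next
      case w2: False
      have "w $ 2 * (w $ 1 / w $ 2 - r) = w $ 1 - r * w $ 2" using w2 by (simp add: field_simps)
      then show ?thesis
        unfolding binary_form_dehomogenization[OF w2] P by (metis mult.left_commute power_mult_distrib)
    qed
    then show "binary_form m c w = c m / w0 $ 2 ^ m * (w $ 1 * w0 $ 2 - w $ 2 * w0 $ 1) ^ m"
      unfolding L power_mult_distrib using False by simp
  qed
qed

lemma P1_two_points:
  fixes w0 :: "complex^2"
  assumes "w0 \<noteq> 0"
  shows "\<exists>w. w \<noteq> 0 \<and> w \<notin> vec.span {w0}"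
proof (rule ccontr)
  assume "\<not> ?thesis"
  then have "w \<in> vec.span {w0}" for w by (cases "w = 0") (auto simp: vec.span_zero)
  then have "vec.span {w0} = UNIV" by blast
  then have "vec.dim (UNIV :: (complex^2) set) = vec.dim {w0}" by (metis vec.dim_span)
  then have "CARD(2) \<le> (1::nat)" unfolding vec_dim_card by (auto split: if_splits)
  then show False by simp
qed

lemma plane_coordinates:
  fixes w0 w1 :: "complex^2"
  assumes "w0 \<noteq> 0" "w1 \<notin> vec.span {w0}"
  shows "\<exists>s t. w = s *s w0 + t *s w1"
proof -
  have "vec.dim (vsum (vec.span {w0}) (vec.span {w1})) = 2"
    using dim_vsum_singleton[OF vec.subspace_span assms(2)] assms(1) by simp
  moreover have "vec.dim (UNIV :: (complex^2) set) = 2" unfolding vec_dim_card by simp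
  ultimately have "vsum (vec.span {w0}) (vec.span {w1}) = UNIV"
    by (intro vec.subspace_dim_equal subspace_vsum) (simp_all only: vec.subspace_span vec.subspace_UNIV subset_UNIV order.refl)
  then have "w \<in> vsum (vec.span {w0}) (vec.span {w1})" by blast
  then show ?thesis unfolding vsum_def span_singleton_iff by blast
qed

text \<open>The determinant of the two vectors: as a function of \<open>w\<close>, a linear form
  whose root is \<open>w0\<close>.\<close>

definition bracket :: "complex^2 \<Rightarrow> complex^2 \<Rightarrow> complex" where
  "bracket w w0 = w $ 1 * w0 $ 2 - w $ 2 * w0 $ 1"

lemma bracket_linear: "bracket (s *s w + t *s w') w0 = s * bracket w w0 + t * bracket w' w0"
  by (simp add: bracket_def algebra_simps)

lemma bracket_self [simp]: "bracket w w = 0"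
  by (simp add: bracket_def)

text \<open>\<open>\<Phi> a\<close> is the form cut out on the curve by the hyperplane \<open>a\<close>. If it has a single root for
  general \<open>a\<close>, then it is the power of a linear form. Two independent such powers \<open>L\<^sup>m\<close> and
  \<open>M\<^sup>m\<close> span a pencil whose general member has \<open>m\<close> distinct roots, so \<open>m = 1\<close>.\<close>

lemma degree_1_forms:
  fixes f :: "(complex^2) set \<Rightarrow> (complex^'n::finite) set"
  assumes f: "has_degree l f 1"
    and v: "\<And>w. w \<noteq> 0 \<Longrightarrow> \<exists>v. basis_of l v (f (vec.span {w})) \<and>
      (\<forall>I. length I = l \<longrightarrow> plucker l v I = binary_form m (c I) w)"
  shows "m = 1"
proof -
  let ?C = "{\<lambda>a :: 'n list \<Rightarrow> complex. a I | I. length I = l}"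
  define \<Phi> where "\<Phi> = (\<lambda>a i. \<Sum>I | length I = l. a I * c I i)"
  have on: "on_hyperplane l a (f (vec.span {w})) \<longleftrightarrow> binary_form m (\<Phi> a) w = 0" if w: "w \<noteq> 0" for a w
  proof -
    obtain v where v': "basis_of l v (f (vec.span {w}))"
      "\<forall>I. length I = l \<longrightarrow> plucker l v I = binary_form m (c I) w" using v[OF w] by blast
    have "(\<Sum>I | length I = l. a I * plucker l v I) = (\<Sum>I | length I = l. a I * binary_form m (c I) w)"
      using v'(2) by (intro sum.cong) auto
    then show ?thesis unfolding on_hyperplane_iff[OF v'(1)] by (simp add: binary_form_sum \<Phi>_def)
  qed
  obtain h x where h: "h \<in> poly_funs ?C" "h x \<noteq> 0"
    "\<And>a. h a \<noteq> 0 \<Longrightarrow> card {p \<in> P1. on_hyperplane l a (f p)} = 1"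
    using f unfolding has_degree_def generally_def by blast
  have good: "\<exists>w0. w0 \<noteq> 0 \<and> binary_form m (\<Phi> a) w0 = 0 \<and>
      (\<forall>w. w \<noteq> 0 \<longrightarrow> binary_form m (\<Phi> a) w = 0 \<longrightarrow> w \<in> vec.span {w0})" if ha: "h a \<noteq> 0" for a
  proof -
    obtain p where p: "{p \<in> P1. on_hyperplane l a (f p)} = {p}" by (rule card_1_singletonE[OF h(3)[OF ha]])
    then have "p \<in> P1" "on_hyperplane l a (f p)" by auto
    then obtain w0 where w0: "w0 \<noteq> 0" "p = vec.span {w0}" using P1_iff by blast
    have "w \<in> vec.span {w0}" if w: "w \<noteq> 0" "binary_form m (\<Phi> a) w = 0" for w
    proof -
      have "vec.span {w} \<in> {p \<in> P1. on_hyperplane l a (f p)}"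
        using on[OF w(1)] w(2) span_singleton_in_Gr[OF w(1)] by blast
      then have "vec.span {w} = vec.span {w0}" using p w0(2) by blast
      then show ?thesis using vec.span_base[of w "{w}"] by blast
    qed
    then show ?thesis using w0 on[OF w0(1)] \<open>on_hyperplane l a (f p)\<close> by blast
  qed
  have pw: "\<exists>w0 \<alpha>. w0 \<noteq> 0 \<and> \<alpha> \<noteq> 0 \<and> (\<forall>w. binary_form m (\<Phi> a) w = \<alpha> * bracket w w0 ^ m)"
    if ha: "h a \<noteq> 0" for a
  proof -
    obtain w0 where w0: "w0 \<noteq> 0" "binary_form m (\<Phi> a) w0 = 0"
      "\<And>w. w \<noteq> 0 \<Longrightarrow> binary_form m (\<Phi> a) w = 0 \<Longrightarrow> w \<in> vec.span {w0}" using good[OF ha] by blast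
    obtain \<alpha> where \<alpha>: "\<And>w. binary_form m (\<Phi> a) w = \<alpha> * bracket w w0 ^ m"
      using binary_form_single_root[OF w0] unfolding bracket_def by blast
    obtain w where "w \<noteq> 0" "w \<notin> vec.span {w0}" using P1_two_points[OF w0(1)] by blast
    then have "\<alpha> \<noteq> 0" using w0(3)[of w] \<alpha>[of w] by auto
    then show ?thesis using w0(1) \<alpha> by blast
  qed
  have m0: "m \<noteq> 0"
  proof
    assume "m = 0"
    obtain w0 \<alpha> where "\<alpha> \<noteq> 0" "\<And>w. binary_form m (\<Phi> x) w = \<alpha> * bracket w w0 ^ m" using pw[OF h(2)] by blast
    moreover obtain w1 where "binary_form m (\<Phi> x) w1 = 0" using good[OF h(2)] by blast
    ultimately show False using \<open>m = 0\<close> by simp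
  qed
  obtain wa \<alpha> where a: "wa \<noteq> 0" "\<alpha> \<noteq> 0" "\<And>w. binary_form m (\<Phi> x) w = \<alpha> * bracket w wa ^ m"
    using pw[OF h(2)] by blast
  \<comment> \<open>Some Pluecker coordinate is nonzero at \<open>wa\<close>, so a general
    hyperplane \<open>y\<close> misses this point of the curve and has its root \<open>wb\<close>
    elsewhere.\<close>
  obtain J where J: "length J = l" "binary_form m (c J) wa \<noteq> 0"
    using v[OF a(1)] plucker_nonzero by metis
  let ?ev = "\<lambda>a. \<Sum>I | length I = l. binary_form m (c I) wa * a I"
  have ev: "?ev a = binary_form m (\<Phi> a) wa" for a
    by (simp add: \<Phi>_def binary_form_sum[symmetric] mult.commute)
  have e1: "?ev \<in> poly_funs ?C" by (intro poly_funs_sum poly_funs_cmult poly_funs.coord) auto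
  have e2: "?ev (\<lambda>I. if I = J then 1 else 0) \<noteq> 0"
    using J by (simp add: finite_lists_of_length if_distrib cong: if_cong)
  have g1: "generally ?C (\<lambda>a. ?ev a \<noteq> 0)"
    by (rule generallyI[where h = ?ev and x = "\<lambda>I. if I = J then 1 else 0", OF e1 e2])
  have g2: "generally ?C (\<lambda>a. h a \<noteq> 0)" by (rule generallyI[where h = h and x = x]) (use h(1,2) in simp_all)
  obtain y where y: "h y \<noteq> 0" "?ev y \<noteq> 0"
    using generally_ex[OF generally_conj[OF line_connected_list_coords g2 g1]] by auto
  obtain wb \<beta> where b: "wb \<noteq> 0" "\<beta> \<noteq> 0" "\<And>w. binary_form m (\<Phi> y) w = \<beta> * bracket w wb ^ m"
    using pw[OF y(1)] by blast
  have ab: "bracket wa wb \<noteq> 0" using y(2) m0 unfolding ev b(3) by auto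
  then have ba: "bracket wb wa \<noteq> 0" by (auto simp: bracket_def algebra_simps)
  define \<gamma> where "\<gamma> = (\<lambda>t (I :: 'n list). x I + t * y I)"
  have "poly_curve ?C \<gamma>"
    unfolding poly_curve_def
  proof
    fix g assume "g \<in> ?C"
    then obtain I where "g = (\<lambda>a. a I)" by blast
    then show "\<exists>p. \<forall>t. g (\<gamma> t) = poly p t" by (intro exI[of _ "[:x I, y I:]"]) (simp add: \<gamma>_def)
  qed
  then obtain p where p: "\<And>t. h (\<gamma> t) = poly p t" using poly_funs_along_curve[OF h(1)] by blast
  have "\<gamma> 0 = x" by (simp add: \<gamma>_def)
  then have "p \<noteq> 0" using p[of 0] h(2) by auto
  \<comment> \<open>The extra factor forces \<open>t \<noteq> 0\<close>, so that the hyperplane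
    \<open>\<gamma> t\<close> involves both powers.\<close>
  then have "[:0, 1:] * p \<noteq> 0" by simp
  then obtain t where "poly ([:0, 1:] * p) t \<noteq> 0" using poly_all_0_iff_0 by blast
  then have t: "t \<noteq> 0" "h (\<gamma> t) \<noteq> 0" by (auto simp: p)
  have \<Phi>t: "binary_form m (\<Phi> (\<gamma> t)) w = \<alpha> * bracket w wa ^ m + t * \<beta> * bracket w wb ^ m" for w
  proof -
    have "binary_form m (\<Phi> (\<gamma> t)) w = (\<Sum>I | length I = l. (x I + t * y I) * binary_form m (c I) w)"
      by (simp add: \<Phi>_def \<gamma>_def binary_form_sum)
    also have "\<dots> = binary_form m (\<Phi> x) w + t * binary_form m (\<Phi> y) w"
      by (simp add: \<Phi>_def binary_form_sum[symmetric] distrib_right sum.distrib sum_distrib_left mult.assoc)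
    finally show ?thesis by (simp add: a(3) b(3) mult.assoc)
  qed
  define z where "z = - (t * \<beta> / \<alpha>)"
  have z0: "z \<noteq> 0" using t b(2) a(2) by (simp add: z_def)
  \<comment> \<open>The point with brackets \<open>s\<close> and \<open>1\<close> against
    \<open>wa\<close> and \<open>wb\<close>. There the form of \<open>\<gamma> t\<close> takes the
    value \<open>\<alpha> * s ^ m + t * \<beta>\<close>, which vanishes iff
    \<open>s ^ m = z\<close>; distinct \<open>s\<close> give distinct points.\<close>
  define W where "W s = (s / bracket wb wa) *s wb + (1 / bracket wa wb) *s wa" for s
  have W: "bracket (W s) wa = s" "bracket (W s) wb = 1" for s
    unfolding W_def bracket_linear using ab ba by simp_all
  have Wroot: "W s \<noteq> 0 \<and> binary_form m (\<Phi> (\<gamma> t)) (W s) = 0" if "s ^ m = z" for s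
  proof
    show "W s \<noteq> 0" using W(2)[of s] by (auto simp: bracket_def)
    show "binary_form m (\<Phi> (\<gamma> t)) (W s) = 0" unfolding \<Phi>t W that using a(2) by (simp add: z_def)
  qed
  obtain w0 where w0: "\<And>w. w \<noteq> 0 \<Longrightarrow> binary_form m (\<Phi> (\<gamma> t)) w = 0 \<Longrightarrow> w \<in> vec.span {w0}"
    using good[OF t(2)] by blast
  have uniq: "s = s'" if st: "s ^ m = z" "s' ^ m = z" for s s'
  proof -
    obtain d d' where d: "W s = d *s w0" "W s' = d' *s w0"
      using w0 Wroot[OF st(1)] Wroot[OF st(2)] unfolding span_singleton_iff by meson
    have "d * bracket w0 wb = 1" "d' * bracket w0 wb = 1"
      using W(2)[of s] W(2)[of s'] unfolding d by (simp_all add: bracket_def algebra_simps)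
    then have "d = d'" by (metis mult_cancel_right mult_zero_right zero_neq_one)
    then have "W s = W s'" using d by simp
    then show ?thesis using W(1) by metis
  qed
  have cm: "card {s. s ^ m = z} = m" using card_nth_roots[OF z0] m0 by simp
  then have "finite {s. s ^ m = z}" using m0 by (intro card_ge_0_finite) simp
  then have "card {s. s ^ m = z} \<le> Suc 0" using uniq by (subst card_le_Suc0_iff_eq) auto
  then show ?thesis using m0 cm by linarith
qed

lemma plucker_linear:
  "plucker (Suc l) (case_nat (s *s x + t *s y) u) I =
    s * plucker (Suc l) (case_nat x u) I + t * plucker (Suc l) (case_nat y u) I"
  unfolding plucker_def sum_distrib_left sum.distrib[symmetric] prod.lessThan_Suc_shift
  by (intro sum.cong refl) (simp add: algebra_simps)

lemma basis_of_extend: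
  assumes u: "basis_of l u A" and x: "x \<notin> A"
  shows "basis_of (Suc l) (case_nat x u) (vsum A (vec.span {x}))"
proof (rule basis_of_dim_eq)
  have A: "vec.subspace A" "vec.dim A = l" using basis_of_Gr[OF u] by (auto simp: Gr_def)
  show "vsum A (vec.span {x}) \<in> Gr (Suc l)"
    using A dim_vsum_singleton[OF A(1) x] subspace_vsum[OF A(1) vec.subspace_span] by (simp add: Gr_def)
  show "case_nat x u i \<in> vsum A (vec.span {x})" if "i < Suc l" for i
  proof (cases i)
    case 0
    then show ?thesis using subset_vsum2[OF A(1), of "vec.span {x}"] vec.span_base[of x "{x}"] by auto
  next
    case (Suc j)
    then show ?thesis using subset_vsum1[OF vec.subspace_span, of A "{x}"] basis_of_mem[OF u, of j] that by auto
  qed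
  fix \<alpha> j assume 0: "(\<Sum>j<Suc l. \<alpha> j *s case_nat x u j) = 0" and j: "j < Suc l"
  have e: "\<alpha> 0 *s x + (\<Sum>j<l. \<alpha> (Suc j) *s u j) = 0" using 0 unfolding sum.lessThan_Suc_shift by simp
  have sA: "(\<Sum>j<l. \<alpha> (Suc j) *s u j) \<in> A"
    using basis_of_mem[OF u] A(1) by (auto intro!: vec.subspace_sum vec.subspace_scale)
  have \<alpha>0: "\<alpha> 0 = 0"
  proof (rule ccontr)
    assume "\<alpha> 0 \<noteq> 0"
    have "\<alpha> 0 *s x = - (\<Sum>j<l. \<alpha> (Suc j) *s u j)" using e by (simp add: eq_neg_iff_add_eq_0)
    then have "\<alpha> 0 *s x \<in> A" using sA A(1) by (simp add: vec.subspace_neg)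
    then have "inverse (\<alpha> 0) *s (\<alpha> 0 *s x) \<in> A" using A(1) by (rule vec.subspace_scale[rotated])
    then show False using x \<open>\<alpha> 0 \<noteq> 0\<close> by simp
  qed
  then have "(\<Sum>j<l. \<alpha> (Suc j) *s u j) = 0" using e by simp
  then have "\<forall>j<l. \<alpha> (Suc j) = 0" 
    by (rule conjunct1[OF u[unfolded basis_of_iff], THEN spec[of _ "\<lambda>j. \<alpha> (Suc j)"], THEN mp])
  then show "\<alpha> j = 0" using \<alpha>0 j by (cases j) auto
qed

lemma degree_1_linear:
  fixes f :: "(complex^2) set \<Rightarrow> (complex^'n::finite) set"
  assumes "f \<in> rational_curves l 1"
  obtains C0 C1 :: "'n list \<Rightarrow> complex" where
    "\<And>w. w \<noteq> 0 \<Longrightarrow> \<exists>v. basis_of l v (f (vec.span {w})) \<and>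
      (\<forall>I. length I = l \<longrightarrow> plucker l v I = w $ 1 * C1 I + w $ 2 * C0 I)"
proof -
  from assms have f: "regular_map l f" "has_degree l f 1" by (auto simp: rational_curves_def)
  obtain m and c :: "'n list \<Rightarrow> nat \<Rightarrow> complex" where c: "\<And>w. w \<noteq> 0 \<Longrightarrow> \<exists>v. basis_of l v (f (vec.span {w})) \<and>
      (\<forall>I. length I = l \<longrightarrow> plucker l v I = binary_form m (c I) w)"
    using f(1) unfolding regular_map_def by blast
  have m: "m = 1" by (rule degree_1_forms[OF f(2) c])
  show ?thesis
  proof (rule that[of "\<lambda>I. c I 1" "\<lambda>I. c I 0"])
    fix w :: "complex^2" assume "w \<noteq> 0"
    moreover have "binary_form 1 (c I) w = w $ 1 * c I 1 + w $ 2 * c I 0" for I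
      by (simp add: binary_form_def algebra_simps)
    ultimately show "\<exists>v. basis_of l v (f (vec.span {w})) \<and>
      (\<forall>I. length I = l \<longrightarrow> plucker l v I = w $ 1 * c I 1 + w $ 2 * c I 0)"
      using c[of w] unfolding m by simp
  qed
qed

text \<open>For \<open>x\<close>, \<open>y\<close> independent modulo \<open>A\<close>, the line of
  all members between \<open>A\<close> and its span with \<open>x\<close> and \<open>y\<close>,
  where the choice of \<open>x\<close> and \<open>y\<close> fixes the parametrization. The
  restriction to \<open>P1\<close> makes it extensional, as \<open>rational_curves\<close>
  demands.\<close>

definition pencil ::
  "(complex^'n) set \<Rightarrow> complex^'n \<Rightarrow> complex^'n \<Rightarrow> (complex^2) set \<Rightarrow> (complex^'n) set" where
  "pencil A x y = (\<lambda>p\<in>P1. {a + (z $ 1 *s x + z $ 2 *s y) | a z. a \<in> A \<and> z \<in> p})"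

lemma pencil_span:
  assumes "z \<noteq> 0"
  shows "pencil A x y (vec.span {z}) = vsum A (vec.span {z $ 1 *s x + z $ 2 *s y})"
proof -
  have e: "(c *s z) $ 1 *s x + (c *s z) $ 2 *s y = c *s (z $ 1 *s x + z $ 2 *s y)" for c
    by (simp add: vec.scale_right_distrib)
  have "pencil A x y (vec.span {z}) = {a + (z' $ 1 *s x + z' $ 2 *s y) | a z'. a \<in> A \<and> z' \<in> vec.span {z}}"
    unfolding pencil_def by (rule restrict_apply'[OF span_singleton_in_Gr[OF assms]])
  also have "\<dots> = {a + ((c *s z) $ 1 *s x + (c *s z) $ 2 *s y) | a c. a \<in> A}"
    unfolding span_singleton_iff by blast
  also have "\<dots> = vsum A (vec.span {z $ 1 *s x + z $ 2 *s y})"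
    unfolding e vsum_def span_singleton_iff by blast
  finally show ?thesis .
qed

text \<open>The Pluecker vector is linear in \<open>z\<close>, so a hyperplane gives one linear
  equation in \<open>z\<close>, with exactly one root as soon as it is nonzero. Genericity asks for
  a nonzero coefficient at \<open>z $ 1\<close>.\<close>

lemma pencil_rational:
  fixes u :: "nat \<Rightarrow> complex^'n::finite"
  assumes u: "basis_of l u A" and indep: "\<And>z :: complex^2. z \<noteq> 0 \<Longrightarrow> z $ 1 *s x + z $ 2 *s y \<notin> A"
  shows "pencil A x y \<in> rational_curves (Suc l) 1"
proof -
  define v where "v z = case_nat (z $ 1 *s x + z $ 2 *s y) u" for z :: "complex^2"
  define R where "R = (\<lambda>I. plucker (Suc l) (case_nat x u) I)"
  define S where "S = (\<lambda>I. plucker (Suc l) (case_nat y u) I)"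
  have v: "basis_of (Suc l) (v z) (pencil A x y (vec.span {z}))" if "z \<noteq> 0" for z
    unfolding pencil_span[OF that] v_def by (rule basis_of_extend[OF u indep[OF that]])
  have pl: "plucker (Suc l) (v z) I = z $ 1 * R I + z $ 2 * S I" for z I
    unfolding v_def R_def S_def by (rule plucker_linear)
  have "pencil A x y \<in> P1 \<rightarrow>\<^sub>E Gr (Suc l)"
  proof (rule PiE_I)
    fix p assume "p \<in> P1"
    then obtain z where "z \<noteq> 0" "p = vec.span {z}" using P1_iff by blast
    then show "pencil A x y p \<in> Gr (Suc l)" using basis_of_Gr[OF v] by simp
  next
    fix p assume "p \<notin> P1"
    then show "pencil A x y p = undefined" unfolding pencil_def restrict_def by (rule if_not_P)
  qed
  moreover have "regular_map (Suc l) (pencil A x y)"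
    unfolding regular_map_def
  proof (intro exI[of _ 1] exI[of _ "\<lambda>I i. if i = 0 then S I else R I"] allI impI)
    fix w :: "complex^2" assume "w \<noteq> 0"
    then show "\<exists>v. basis_of (Suc l) v (pencil A x y (vec.span {w})) \<and>
      (\<forall>I. length I = Suc l \<longrightarrow> plucker (Suc l) v I = binary_form 1 (\<lambda>i. if i = 0 then S I else R I) w)"
      by (intro exI[of _ "v w"] conjI v allI impI) (simp_all add: pl binary_form_def)
  qed
  moreover have "has_degree (Suc l) (pencil A x y) 1"
  proof -
    let ?h = "\<lambda>a. \<Sum>I | length I = Suc l. R I * a I"
    have e1_nz: "axis 1 1 \<noteq> (0 :: complex^2)" by (simp add: axis_eq_0_iff)
    obtain J where J: "length J = Suc l" "plucker (Suc l) (v (axis 1 1)) J \<noteq> 0"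
      using plucker_nonzero[OF v[OF e1_nz]] by blast
    then have RJ: "R J \<noteq> 0" by (simp add: pl axis_def)
    show ?thesis
      unfolding has_degree_def
    proof (rule generallyI[where h = ?h and x = "\<lambda>I. if I = J then 1 else 0"])
      show "?h \<in> poly_funs {\<lambda>a :: 'n list \<Rightarrow> complex. a I | I. length I = Suc l}"
        by (intro poly_funs_sum poly_funs_cmult poly_funs.coord) auto
      show "?h (\<lambda>I. if I = J then 1 else 0) \<noteq> 0"
        using J(1) RJ by (simp add: finite_lists_of_length if_distrib cong: if_cong)
      fix a assume ha: "?h a \<noteq> 0"
      let ?b = "\<Sum>I | length I = Suc l. S I * a I"
      have on: "on_hyperplane (Suc l) a (pencil A x y (vec.span {z})) \<longleftrightarrow> z $ 1 * ?h a + z $ 2 * ?b = 0"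
        if "z \<noteq> 0" for z
        unfolding on_hyperplane_iff[OF v[OF that]] pl
        by (simp add: algebra_simps sum.distrib sum_distrib_left)
      define z0 :: "complex^2" where "z0 = vector [- ?b, ?h a]"
      have z0: "z0 $ 1 = - ?b" "z0 $ 2 = ?h a" by (simp_all add: z0_def)
      then have "z0 \<noteq> 0" using ha by (metis zero_index)
      have "{p \<in> P1. on_hyperplane (Suc l) a (pencil A x y p)} = {vec.span {z0}}"
      proof (intro equalityI subsetI)
        fix p assume "p \<in> {p \<in> P1. on_hyperplane (Suc l) a (pencil A x y p)}"
        then have p: "p \<in> P1" "on_hyperplane (Suc l) a (pencil A x y p)" by blast+
        then obtain z where z: "z \<noteq> 0" "p = vec.span {z}" using P1_iff by blast
        have 0: "z $ 1 * ?h a + z $ 2 * ?b = 0" using on[OF z(1)] p(2) z(2) by blast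
        have "z = (z $ 2 / ?h a) *s z0"
          unfolding Finite_Cartesian_Product.vec_eq_iff forall_2 vector_smult_component z0
          using ha 0 by (simp add: field_simps eq_neg_iff_add_eq_0)
        then have "p \<subseteq> vec.span {z0}" unfolding z(2)
          by (intro span_singleton_subset vec.subspace_span) (auto simp: span_singleton_iff)
        then show "p \<in> {vec.span {z0}}"
          using subspaces_eq[OF _ p(1) span_singleton_in_Gr[OF \<open>z0 \<noteq> 0\<close>]] by blast
      next
        fix p assume "p \<in> {vec.span {z0}}"
        then show "p \<in> {p \<in> P1. on_hyperplane (Suc l) a (pencil A x y p)}"
          using on[OF \<open>z0 \<noteq> 0\<close>] span_singleton_in_Gr[OF \<open>z0 \<noteq> 0\<close>] by (simp add: z0)
      qed
      then show "finite {p \<in> P1. on_hyperplane (Suc l) a (pencil A x y p)} \<and>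
          card {p \<in> P1. on_hyperplane (Suc l) a (pencil A x y p)} = 1"
        by (simp only: finite.emptyI finite_insert card.insert card.empty empty_iff not_False_eq_True One_nat_def)
    qed
  qed
  ultimately show ?thesis unfolding rational_curves_def by blast
qed

text \<open>A curve with linear Pluecker coordinates is determined by its Pluecker vectors at two
  points. Those of \<open>f\<close> agree with those of the pencil only up to scalars \<kappa> and
  \<mu>, which the automorphism absorbs.\<close>

lemma pencil_unique:
  fixes f :: "(complex^2) set \<Rightarrow> (complex^'n::finite) set"
  assumes f: "f \<in> rational_curves (Suc l) 1" and u: "basis_of l u A"
    and indep: "\<And>z :: complex^2. z \<noteq> 0 \<Longrightarrow> z $ 1 *s x + z $ 2 *s y \<notin> A"
    and p: "p \<in> P1" "f p = vsum A (vec.span {x})"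
    and q: "q \<in> P1" "f q = vsum A (vec.span {y})" and pq: "p \<noteq> q"
  shows "\<exists>\<phi> \<in> P1_automorphisms. pencil A x y = compose P1 f \<phi>"
proof -
  obtain C0 C1 where C: "\<And>w. w \<noteq> 0 \<Longrightarrow> \<exists>v. basis_of (Suc l) v (f (vec.span {w})) \<and>
      (\<forall>I. length I = Suc l \<longrightarrow> plucker (Suc l) v I = w $ 1 * C1 I + w $ 2 * C0 I)"
    by (rule degree_1_linear[OF f]) (rule that)
  obtain wp wq where w: "wp \<noteq> 0" "p = vec.span {wp}" "wq \<noteq> 0" "q = vec.span {wq}"
    using p(1) q(1) P1_iff by metis
  have "axis 1 1 \<noteq> (0 :: complex^2)" by (simp add: axis_eq_0_iff)
  from indep[OF this] have xA: "x \<notin> A" by (simp add: axis_def)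
  have "axis 2 1 \<noteq> (0 :: complex^2)" by (simp add: axis_eq_0_iff)
  from indep[OF this] have yA: "y \<notin> A" by (simp add: axis_def)
  have point: "\<exists>\<kappa>. \<kappa> \<noteq> 0 \<and> (\<forall>I. length I = Suc l \<longrightarrow> w $ 1 * C1 I + w $ 2 * C0 I = \<kappa> * plucker (Suc l) (case_nat b u) I)"
    if wb: "w \<noteq> 0" "f (vec.span {w}) = vsum A (vec.span {b})" "b \<notin> A" for w b
  proof -
    obtain v where v: "basis_of (Suc l) v (f (vec.span {w}))"
      "\<forall>I. length I = Suc l \<longrightarrow> plucker (Suc l) v I = w $ 1 * C1 I + w $ 2 * C0 I"
      using C[OF wb(1)] by blast
    obtain \<kappa> where "\<kappa> \<noteq> 0" "\<forall>\<eta>. wedge (Suc l) v \<eta> = \<kappa> * wedge (Suc l) (case_nat b u) \<eta>"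
      using wedge_change_basis[OF basis_of_extend[OF u wb(3)] v(1)[unfolded wb(2)]] by blast
    then show ?thesis using v(2) by (intro exI[of _ \<kappa>]) (auto simp: plucker_eq_wedge)
  qed
  obtain \<kappa> where \<kappa>: "\<kappa> \<noteq> 0"
    "\<And>I. length I = Suc l \<Longrightarrow> wp $ 1 * C1 I + wp $ 2 * C0 I = \<kappa> * plucker (Suc l) (case_nat x u) I"
    using point[OF w(1) p(2)[unfolded w(2)] xA] by blast
  obtain \<mu> where \<mu>: "\<mu> \<noteq> 0"
    "\<And>I. length I = Suc l \<Longrightarrow> wq $ 1 * C1 I + wq $ 2 * C0 I = \<mu> * plucker (Suc l) (case_nat y u) I"
    using point[OF w(3) q(2)[unfolded w(4)] yA] by blast
  \<comment> \<open>The rescaled columns of the matrix make the Pluecker vectors of \<open>f\<close>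
    equal to those of the pencil at both points, so that linearity extends the equality to every
    \<open>z\<close>.\<close>
  define a where "a = inverse \<kappa> *s wp"
  define b where "b = inverse \<mu> *s wq"
  define M :: "complex^2^2" where "M = (\<chi> i j. if j = 1 then a $ i else b $ i)"
  have M: "M *v z = z $ 1 *s a + z $ 2 *s b" for z
    by (simp add: Finite_Cartesian_Product.vec_eq_iff matrix_vector_mult_def sum_2 M_def mult.commute)
  have Mnz: "M *v z \<noteq> 0" if "z \<noteq> 0" for z
  proof
    assume "M *v z = 0"
    then have e: "(z $ 1 * inverse \<kappa>) *s wp = - ((z $ 2 * inverse \<mu>) *s wq)"
      unfolding M a_def b_def by (simp add: eq_neg_iff_add_eq_0)
    have wq': "wq \<notin> vec.span {wp}"
    proof
      assume "wq \<in> vec.span {wp}"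
      then have "q \<subseteq> p" unfolding w(2,4) by (intro span_singleton_subset vec.subspace_span)
      then show False using subspaces_eq[OF _ q(1) p(1)] pq by blast
    qed
    have "z $ 2 = 0"
    proof (rule ccontr)
      assume "z $ 2 \<noteq> 0"
      then have nz: "z $ 2 * inverse \<mu> \<noteq> 0" using \<mu>(1) by simp
      have "(z $ 2 * inverse \<mu>) *s wq \<in> vec.span {wp}"
        using e by (metis minus_minus vec.span_base vec.span_neg vec.span_scale singletonI)
      then have "inverse (z $ 2 * inverse \<mu>) *s ((z $ 2 * inverse \<mu>) *s wq) \<in> vec.span {wp}"
        by (rule vec.span_scale)
      then show False using wq' nz by (simp only: vec.scale_scale left_inverse vec.scale_one not_False_eq_True)
    qed
    moreover from this e have "z $ 1 = 0" using w(1) \<kappa>(1) by simp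
    ultimately show False using that by (simp add: Finite_Cartesian_Product.vec_eq_iff forall_2)
  qed
  have inv: "invertible M"
    unfolding invertible_left_inverse matrix_left_invertible_ker using Mnz by blast
  have eq: "pencil A x y r = f ((\<lambda>w. M *v w) ` r)" if r: "r \<in> P1" for r
  proof -
    obtain z where z: "z \<noteq> 0" "r = vec.span {z}" using r P1_iff by blast
    obtain v where v: "basis_of (Suc l) v (f (vec.span {M *v z}))"
      "\<forall>I. length I = Suc l \<longrightarrow> plucker (Suc l) v I = (M *v z) $ 1 * C1 I + (M *v z) $ 2 * C0 I"
      using C[OF Mnz[OF z(1)]] by blast
    have "plucker (Suc l) v I = 1 * plucker (Suc l) (case_nat (z $ 1 *s x + z $ 2 *s y) u) I"
      if I: "length I = Suc l" for I
    proof -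
      have "plucker (Suc l) v I = z $ 1 * inverse \<kappa> * (wp $ 1 * C1 I + wp $ 2 * C0 I)
        + z $ 2 * inverse \<mu> * (wq $ 1 * C1 I + wq $ 2 * C0 I)"
        using v(2) I by (simp add: M a_def b_def algebra_simps)
      also have "\<dots> = 1 * plucker (Suc l) (case_nat (z $ 1 *s x + z $ 2 *s y) u) I"
        unfolding \<kappa>(2)[OF I] \<mu>(2)[OF I] plucker_linear using \<kappa>(1) \<mu>(1) by (simp add: field_simps)
      finally show ?thesis .
    qed
    then have "vsum A (vec.span {z $ 1 *s x + z $ 2 *s y}) = f (vec.span {M *v z})"
      by (rule plucker_injective[OF basis_of_extend[OF u indep[OF z(1)]] v(1)])
    then show ?thesis unfolding z(2) image_span_singleton pencil_span[OF z(1)] .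
  qed
  have "pencil A x y = compose P1 f (\<lambda>p. (\<lambda>w. M *v w) ` p)"
  proof
    fix r
    show "pencil A x y r = compose P1 f (\<lambda>p. (\<lambda>w. M *v w) ` p) r"
    proof (cases "r \<in> P1")
      case True
      show ?thesis unfolding compose_def restrict_apply'[OF True] by (rule eq[OF True])
    next
      case False
      show ?thesis unfolding compose_def pencil_def restrict_def if_not_P[OF False] by (rule refl)
    qed
  qed
  then show ?thesis using matrix_automorphism[OF inv] by blast
qed

text \<open>Contracting the Pluecker vector of the curve with a functional \<open>\<phi>\<close> that vanishes on the
  hyperplane \<open>K\<close> kills the point contained in \<open>K\<close>; so by linearity the contractions at the two
  other points are proportional.\<close>

lemma degree_1_contraction:
  fixes f :: "(complex^2) set \<Rightarrow> (complex^'n::finite) set"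
  assumes f: "f \<in> rational_curves (Suc l) 1" and u: "basis_of l u A" and K: "vec.subspace K" "A \<subseteq> K"
    and x: "x \<notin> K"
    and p: "p \<in> P1" "f p = vsum A (vec.span {x})"
    and q: "q \<in> P1" "\<not> f q \<subseteq> K" and r: "r \<in> P1" "f r \<subseteq> K" and pq: "p \<noteq> q"
  shows "A \<subseteq> f q"
proof -
  obtain C0 C1 where C: "\<And>w. w \<noteq> 0 \<Longrightarrow> \<exists>v. basis_of (Suc l) v (f (vec.span {w})) \<and>
      (\<forall>I. length I = Suc l \<longrightarrow> plucker (Suc l) v I = w $ 1 * C1 I + w $ 2 * C0 I)"
    by (rule degree_1_linear[OF f]) (rule that)
  \<comment> \<open>The alternating form along \<open>f\<close>, evaluated at arbitrary functionals
    and linear in the parameter \<open>w\<close>.\<close>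
  define E where "E w \<eta> = (\<Sum>I | length I = Suc l. (\<Prod>j<Suc l. \<eta> j $ (I ! j)) * (w $ 1 * C1 I + w $ 2 * C0 I))" for w :: "complex^2" and \<eta>
  have E_lin: "E (s *s w + t *s w') \<eta> = s * E w \<eta> + t * E w' \<eta>" for s t w w' \<eta>
    unfolding E_def sum_distrib_left sum.distrib[symmetric] by (intro sum.cong refl) (simp add: algebra_simps)
  have E: "\<exists>v. basis_of (Suc l) v (f (vec.span {w})) \<and> (\<forall>\<eta>. wedge (Suc l) v \<eta> = E w \<eta>)" if w: "w \<noteq> 0" for w
  proof -
    obtain v where v: "basis_of (Suc l) v (f (vec.span {w}))"
      "\<forall>I. length I = Suc l \<longrightarrow> plucker (Suc l) v I = w $ 1 * C1 I + w $ 2 * C0 I" using C[OF w] by blast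
    have "wedge (Suc l) v \<eta> = E w \<eta>" for \<eta>
      unfolding wedge_plucker E_def using v(2) by (intro sum.cong) auto
    then show ?thesis using v(1) by blast
  qed
  obtain wp wq wr where w: "wp \<noteq> 0" "p = vec.span {wp}" "wq \<noteq> 0" "q = vec.span {wq}" "wr \<noteq> 0" "r = vec.span {wr}"
    using p(1) q(1) r(1) P1_iff by metis
  have wq': "wq \<notin> vec.span {wp}"
  proof
    assume "wq \<in> vec.span {wp}"
    then have "q \<subseteq> p" unfolding w(2,4) by (intro span_singleton_subset vec.subspace_span)
    then show False using subspaces_eq[OF _ q(1) p(1)] pq by blast
  qed
  obtain s t where st: "wr = s *s wp + t *s wq" using plane_coordinates[OF w(1) wq'] by blast
  \<comment> \<open>\<open>s = 0\<close> would give \<open>r = q\<close>, but \<open>f r\<close>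
    lies in \<open>K\<close> and \<open>f q\<close> does not.\<close>
  have "s \<noteq> 0"
  proof
    assume "s = 0"
    then have "r \<subseteq> q" unfolding w(4,6) st
      by (intro span_singleton_subset vec.subspace_span) (auto simp: span_singleton_iff)
    then have "r = q" using subspaces_eq[OF _ r(1) q(1)] by blast
    then show False using q(2) r(2) by blast
  qed
  have xA: "x \<notin> A" using x K by blast
  let ?b = "case_nat x u"
  have b: "basis_of (Suc l) ?b (f p)" unfolding p(2) by (rule basis_of_extend[OF u xA])
  obtain vp where vp: "basis_of (Suc l) vp (f p)" "\<forall>\<eta>. wedge (Suc l) vp \<eta> = E wp \<eta>" using E[OF w(1)] w(2) by blast
  obtain vq where vq: "basis_of (Suc l) vq (f q)" "\<forall>\<eta>. wedge (Suc l) vq \<eta> = E wq \<eta>" using E[OF w(3)] w(4) by blast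
  obtain vr where vr: "basis_of (Suc l) vr (f r)" "\<forall>\<eta>. wedge (Suc l) vr \<eta> = E wr \<eta>" using E[OF w(5)] w(6) by blast
  obtain \<kappa> where \<kappa>: "\<kappa> \<noteq> 0" "\<forall>\<eta>. wedge (Suc l) vp \<eta> = \<kappa> * wedge (Suc l) ?b \<eta>"
    using wedge_change_basis[OF b vp(1)] by blast
  obtain \<phi> where \<phi>: "\<forall>s \<in> K. pairing s \<phi> = 0" "pairing x \<phi> = 1" using exists_separating[OF K(1) x] by blast
  obtain \<eta>0 where \<eta>0: "\<forall>i<Suc l. \<forall>j<Suc l. pairing (?b i) (\<eta>0 j) = (if i = j then 1 else 0)"
    using exists_dual_family[OF b] by blast
  \<comment> \<open>With \<phi> in slot 0 the family is still dual to \<open>?b\<close>, because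
    \<phi> vanishes on \<open>A \<subseteq> K\<close> and is 1 on \<open>x\<close>; in addition slot
    0 now vanishes on all of \<open>f r\<close>.\<close>
  define \<eta> where "\<eta> = \<eta>0(0 := \<phi>)"
  have \<eta>: "pairing (?b i) (\<eta> j) = (if i = j then 1 else 0)" if ij: "i < Suc l" "j < Suc l" for i j
  proof (cases "j = 0")
    case True
    show ?thesis
    proof (cases i)
      case 0
      then show ?thesis using True \<phi>(2) by (simp add: \<eta>_def)
    next
      case (Suc i')
      then have "u i' \<in> K" using basis_of_mem[OF u, of i'] K(2) ij by auto
      then show ?thesis using True Suc \<phi>(1) by (simp add: \<eta>_def)
    qed
  qed (use \<eta>0 ij in \<open>simp add: \<eta>_def\<close>)
  have sq: "vec.subspace (f q)" using basis_of_Gr[OF vq(1)] by (simp add: Gr_def)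
  have "u i \<in> f q" if i: "i < l" for i
  proof (rule ccontr)
    assume "u i \<notin> f q"
    then obtain \<psi> where \<psi>: "\<forall>s \<in> f q. pairing s \<psi> = 0" "pairing (u i) \<psi> = 1"
      using exists_separating[OF sq] by blast
    \<comment> \<open>With \<psi> in slot \<open>Suc i\<close> the value at \<open>q\<close> is 0,
      since \<psi> kills \<open>f q\<close>, and the value at \<open>r\<close> is 0 because of slot
      0, whereas the value at \<open>p\<close> is \<kappa>. Linearity then gives
      \<open>s * \<kappa> = 0\<close>.\<close>
    let ?\<eta> = "\<eta>(Suc i := \<psi>)"
    have "wedge (Suc l) ?b ?\<eta> = 1"
      using wedge_dual_replaced[of "Suc i" "Suc l" ?b \<eta> \<psi>] i \<eta> \<psi>(2) by simp
    then have Ep: "E wp ?\<eta> = \<kappa>" using \<kappa>(2) vp(2) by simp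
    have "wedge (Suc l) vq ?\<eta> = 0"
      using wedge_zero_column[of "Suc i" "Suc l" vq ?\<eta>] i \<psi>(1) basis_of_mem[OF vq(1)] by simp
    moreover have "wedge (Suc l) vr ?\<eta> = 0"
    proof (rule wedge_zero_column[of 0])
      fix j assume "j < Suc l"
      then have "vr j \<in> K" using basis_of_mem[OF vr(1)] r(2) by blast
      then show "pairing (vr j) (?\<eta> 0) = 0" using \<phi>(1) by (simp add: \<eta>_def)
    qed simp
    ultimately have "E wq ?\<eta> = 0" "E wr ?\<eta> = 0" using vq(2) vr(2) by simp_all
    then have "s * \<kappa> = 0" using E_lin[of s wp t wq ?\<eta>] Ep unfolding st by simp
    then show False using \<open>s \<noteq> 0\<close> \<kappa>(1) by simp
  qed
  then have "vec.span (u ` {..<l}) \<subseteq> f q" using sq by (intro vec.span_minimal) auto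
  then show ?thesis using u by (simp add: basis_of_def)
qed

section \<open>The unique curve of degree 1\<close>

context general_flags
begin

lemma schubert_full: "V \<in> schubert_variety l k (replicate l k) H \<longleftrightarrow> V = H l"
proof
  assume "V \<in> schubert_variety l k (replicate l k) H"
  then have V: "V \<in> Gr l" "\<forall>i \<in> {1..l}. i \<le> vec.dim (V \<inter> H (k + i - replicate l k ! (i - 1)))"
    unfolding schubert_variety_def by blast+
  have "l \<le> vec.dim (V \<inter> H l)" using bspec[OF V(2), of l] l by simp
  then have "V \<inter> H l = H l"
    using V(1) subspaces(3)[of l] dims(3)[of l] by (intro vec.subspace_dim_equal vec.subspace_inter) (auto simp: Gr_def)
  then have "H l \<subseteq> V" by blast
  then show "V = H l" using subspaces_eq[of "H l" V] V(1) subspaces(3)[of l] dims(3)[of l] by (simp add: Gr_def)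
next
  assume V: "V = H l"
  have "i \<le> vec.dim (H l \<inter> H (k + i - replicate l k ! (i - 1)))" if "i \<in> {1..l}" for i
  proof -
    have "H i \<subseteq> H l" using H_mono[of i l] that by simp
    then have "H l \<inter> H i = H i" by blast
    moreover have "i - 1 < l" using that by auto
    then have "replicate l k ! (i - 1) = k" by (rule nth_replicate)
    ultimately show ?thesis using that dims(3)[of i] by simp
  qed
  then show "V \<in> schubert_variety l k (replicate l k) H"
    using V subspaces(3)[of l] dims(3)[of l] by (auto simp: schubert_variety_def Gr_def)
qed

text \<open>The curve has to pass through the point \<open>H l\<close>, have a member containing the
  line \<open>G 1\<close>, and have a member inside the hyperplane \<open>F (k + l - 1)\<close>. By
  \<open>degree_1_contraction\<close> the second member contains \<open>?A\<close>; so the curve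
  shares two points with the pencil, and \<open>pencil_unique\<close> applies.\<close>

lemma degree_1_curves:
  defines "C \<equiv> curves_meeting l 1 (schubert_variety l k (replicate l 1) F)
    (schubert_variety l k (hook l k 1) G) (schubert_variety l k (replicate l k) H)"
  shows "\<exists>f0 \<in> C. \<forall>f \<in> C. reparametrization `` {f} = reparametrization `` {f0}"
proof -
  let ?K = "F (k + l - 1)"
  let ?A = "?K \<inter> H l"
  have ll: "1 \<le> l" "l \<le> l" and kk: "1 \<le> k" "k \<le> k" using l k by simp_all
  obtain l' where l': "l = Suc l'" using l by (cases l) auto
  have sK: "vec.subspace ?K" "vec.dim ?K = k + l - 1" using subspaces(1) dims(1) by simp_all
  have sH: "vec.subspace (H l)" "vec.dim (H l) = l" using subspaces(3) dims(3) by simp_all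
  have dA: "vec.dim ?A = l'" using dim_P[OF ll kk] l' by simp
  have sA: "vec.subspace ?A" using sK sH by (intro vec.subspace_inter)
  have HGr: "H l \<in> Gr l" using sH by (simp add: Gr_def)
  obtain u where u: "basis_of l' u ?A" using exists_basis_of[of ?A l'] sA dA by (auto simp: Gr_def)
  have "\<not> H l \<subseteq> ?A" using vec.dim_subset[of "H l" ?A] dA sH(2) l' by auto
  then obtain x where x: "x \<in> H l" "x \<notin> ?K" by blast
  have "1 \<le> vec.dim (G 1)" using dims(2)[of 1] l by simp
  then obtain y where y: "y \<in> G 1" "y \<noteq> 0" by (rule dim_ge_1_obtains)
  have "G 1 \<inter> H l \<subseteq> {0}" by (rule GH) (use k in simp)
  then have yH: "y \<notin> H l" using y by blast
  have "H (l - l) \<subseteq> vsum ?K (H (l - l))" using sK subset_vsum2 by blast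
  \<comment> \<open>The condition on all three flags for \<open>i = l\<close> and
    \<open>m = k\<close>, where the line is \<open>G 1\<close> and the hyperplane is
    \<open>?K\<close>.\<close>
  have yK: "y \<notin> ?K"
  proof
    assume "y \<in> ?K"
    then have "y \<in> vsum ?K (H (l - l))" using subset_vsum1[of "H (l - l)" ?K] subspaces(3)[of 0] by auto
    moreover have "y \<in> G (k + 1 - k) \<inter> H (l + k)" using y(1) top[of H] by simp
    ultimately show False using Q_zero[OF ll kk, of y] y(2) by blast
  qed
  have xA: "x \<notin> ?A" and yA: "y \<notin> ?A" using x yH by auto
  have indep: "z $ 1 *s x + z $ 2 *s y \<notin> ?A" if "z \<noteq> 0" for z :: "complex^2"
  proof
    assume zA: "z $ 1 *s x + z $ 2 *s y \<in> ?A"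
    have "z $ 2 = 0"
    proof (rule ccontr)
      assume z2: "z $ 2 \<noteq> 0"
      have "(z $ 1 *s x + z $ 2 *s y) - z $ 1 *s x \<in> H l"
        using zA x(1) sH(1) by (intro vec.subspace_diff vec.subspace_scale) auto
      then have "z $ 2 *s y \<in> H l" by simp
      then have "inverse (z $ 2) *s (z $ 2 *s y) \<in> H l" using sH(1) by (rule vec.subspace_scale[rotated])
      then show False using yH z2 by simp
    qed
    moreover from this have "z $ 1 \<noteq> 0" using that by (auto simp: Finite_Cartesian_Product.vec_eq_iff forall_2)
    moreover have "z $ 1 *s x \<in> ?A" using zA \<open>z $ 2 = 0\<close> by simp
    then have "inverse (z $ 1) *s (z $ 1 *s x) \<in> ?A" by (rule vec.subspace_scale[OF sA])
    ultimately show False using xA by simp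
  qed
  have Ax: "vsum ?A (vec.span {x}) = H l"
  proof (rule subspaces_eq[OF vsum_subset[OF sH(1)] _ HGr])
    show "vsum ?A (vec.span {x}) \<in> Gr l" using basis_of_Gr[OF basis_of_extend[OF u xA]] l' by simp
  qed (use x sH in \<open>auto intro: span_singleton_subset[THEN subsetD]\<close>)
  have V_eq: "vsum ?A (vec.span {b}) = V" if "V \<in> Gr l" "?A \<subseteq> V" "b \<in> V" "b \<notin> ?A" for V b
  proof (rule subspaces_eq[OF _ _ that(1)])
    have "vec.subspace V" using that(1) by (simp add: Gr_def)
    then show "vsum ?A (vec.span {b}) \<subseteq> V" using that by (intro vsum_subset span_singleton_subset)
    show "vsum ?A (vec.span {b}) \<in> Gr l" using basis_of_Gr[OF basis_of_extend[OF u that(4)]] l' by simp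
  qed
  have e1: "axis 1 1 \<noteq> (0 :: complex^2)" and e2: "axis 2 1 \<noteq> (0 :: complex^2)" by (simp_all add: axis_eq_0_iff)
  let ?f0 = "pencil ?A x y"
  have f0r: "?f0 \<in> rational_curves l 1" by (rule pencil_rational[OF u indep, folded l'])
  have inGr: "?f0 p \<in> Gr l" if "p \<in> P1" for p using f0r that unfolding rational_curves_def by blast
  have f0x: "?f0 (vec.span {axis 1 1}) = H l" using pencil_span[OF e1, of ?A x y] Ax by (simp add: axis_def)
  have f0y: "?f0 (vec.span {axis 2 1}) = vsum ?A (vec.span {y})" unfolding pencil_span[OF e2] by (simp add: axis_def)
  have col: "V \<in> schubert_variety l k (replicate l 1) F \<longleftrightarrow> V \<in> Gr l \<and> V \<subseteq> ?K" for V
  proof -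
    have "V \<in> schubert_variety l k (replicate l 1) F \<longleftrightarrow> V \<in> Gr l \<and> l \<le> vec.dim (V \<inter> ?K)"
      using schubert_column[OF ll, of V] by simp
    also have "\<dots> \<longleftrightarrow> V \<in> Gr l \<and> V \<subseteq> ?K"
    proof (intro conj_cong refl iffI)
      assume V: "V \<in> Gr l" "l \<le> vec.dim (V \<inter> ?K)"
      then have "V \<inter> ?K = V" using sK(1) by (intro vec.subspace_dim_equal vec.subspace_inter) (auto simp: Gr_def)
      then show "V \<subseteq> ?K" by blast
    next
      assume V: "V \<in> Gr l" "V \<subseteq> ?K"
      then have "V \<inter> ?K = V" by blast
      then show "l \<le> vec.dim (V \<inter> ?K)" using V(1) by (simp add: Gr_def)
    qed
    finally show ?thesis .
  qed
  have spany: "vec.span {y} = G 1"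
    using y dims(2)[of 1] subspaces(2)[of 1] l by (intro vec.subspace_dim_equal span_singleton_subset) auto
  have row: "V \<in> schubert_variety l k (hook l k 1) G \<longleftrightarrow> V \<in> Gr l \<and> y \<in> V" for V
  proof -
    have "V \<in> schubert_variety l k (hook l k 1) G \<longleftrightarrow> V \<in> Gr l \<and> 1 \<le> vec.dim (V \<inter> G 1)"
      using schubert_row[OF kk, of V] by simp
    also have "\<dots> \<longleftrightarrow> V \<in> Gr l \<and> y \<in> V"
    proof (intro conj_cong refl iffI)
      assume V: "V \<in> Gr l" "1 \<le> vec.dim (V \<inter> G 1)"
      obtain y' where y': "y' \<in> V \<inter> G 1" "y' \<noteq> 0" using V(2) by (rule dim_ge_1_obtains)
      then obtain c where c: "y' = c *s y" unfolding spany[symmetric] by (auto simp: span_singleton_iff)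
      then have "y = inverse c *s y'" using y'(2) by auto
      then show "y \<in> V" using y'(1) V(1) by (auto simp: Gr_def intro: vec.subspace_scale)
    next
      assume V: "V \<in> Gr l" "y \<in> V"
      then have "vec.span {y} \<subseteq> V \<inter> G 1" unfolding spany[symmetric]
        by (auto simp: Gr_def intro: span_singleton_subset[THEN subsetD])
      then have "vec.dim (vec.span {y}) \<le> vec.dim (V \<inter> G 1)" by (rule vec.dim_subset)
      then show "1 \<le> vec.dim (V \<inter> G 1)" using y(2) by simp
    qed
    finally show ?thesis .
  qed
  have "?f0 \<in> C"
  proof -
    have P1e: "vec.span {axis 1 1} \<in> P1" "vec.span {axis 2 1} \<in> P1" using span_singleton_in_Gr e1 e2 by blast+
    have 3: "?f0 ` P1 \<inter> schubert_variety l k (replicate l k) H \<noteq> {}"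
      using P1e(1) f0x schubert_full by blast
    have "y \<in> ?f0 (vec.span {axis 2 1})"
      unfolding f0y using subset_vsum2[OF sA, of "vec.span {y}"] vec.span_base[of y "{y}"] by blast
    then have 2: "?f0 ` P1 \<inter> schubert_variety l k (hook l k 1) G \<noteq> {}"
      using P1e(2) row inGr by blast
    have "vec.dim (vsum ?K (vec.span {x})) = l + k" using dim_vsum_singleton[OF sK(1) x(2)] sK(2) l by simp
    then have "vsum ?K (vec.span {x}) = UNIV" using sK(1) by (intro full_dim subspace_vsum) auto
    then obtain y' c where yc: "y = y' + c *s x" "y' \<in> ?K" unfolding vsum_def span_singleton_iff by blast
    \<comment> \<open>The combination \<open>y - c x\<close> lies in \<open>?K\<close>, so this
      member of the pencil is contained in \<open>?K\<close>.\<close>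
    define z :: "complex^2" where "z = vector [- c, 1]"
    have z: "z $ 1 = - c" "z $ 2 = 1" by (simp_all add: z_def)
    then have "z \<noteq> 0" by (metis zero_index zero_neq_one)
    have "z $ 1 *s x + z $ 2 *s y = y'" unfolding z yc(1) by (simp add: vec.scale_minus_left)
    then have "?f0 (vec.span {z}) = vsum ?A (vec.span {y'})" using pencil_span[OF \<open>z \<noteq> 0\<close>, of ?A x y] by simp
    also have "\<dots> \<subseteq> ?K" using sK yc(2) by (intro vsum_subset span_singleton_subset) auto
    finally have "?f0 (vec.span {z}) \<in> schubert_variety l k (replicate l 1) F"
      using col inGr span_singleton_in_Gr[OF \<open>z \<noteq> 0\<close>] by blast
    then have 1: "?f0 ` P1 \<inter> schubert_variety l k (replicate l 1) F \<noteq> {}"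
      using span_singleton_in_Gr[OF \<open>z \<noteq> 0\<close>] by blast
    show ?thesis unfolding C_def curves_meeting_def using f0r 1 2 3 by blast
  qed
  moreover have "reparametrization `` {f} = reparametrization `` {?f0}" if f: "f \<in> C" for f
  proof -
    have fr: "f \<in> rational_curves l 1" using f unfolding C_def curves_meeting_def by blast
    have meets: "\<exists>p \<in> P1. f p \<in> schubert_variety l k (replicate l 1) F"
      "\<exists>p \<in> P1. f p \<in> schubert_variety l k (hook l k 1) G"
      "\<exists>p \<in> P1. f p \<in> schubert_variety l k (replicate l k) H"
      using f unfolding C_def curves_meeting_def by blast+
    obtain r where r: "r \<in> P1" "f r \<subseteq> ?K" using meets(1) col by blast
    obtain q where q: "q \<in> P1" "f q \<in> Gr l" "y \<in> f q" using meets(2) row by blast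
    obtain p where p: "p \<in> P1" "f p = H l" using meets(3) schubert_full by blast
    have pq: "p \<noteq> q" using p(2) q(3) yH by blast
    have "?A \<subseteq> f q"
    proof (rule degree_1_contraction[OF fr[unfolded l'] u sK(1) _ x(2) p(1) _ q(1) _ r pq])
      show "\<not> f q \<subseteq> ?K" using q(3) yK by blast
    qed (use p(2) Ax in auto)
    then have "f q = vsum ?A (vec.span {y})" using V_eq[OF q(2) _ q(3) yA] by simp
    then obtain \<phi> where "\<phi> \<in> P1_automorphisms" "?f0 = compose P1 f \<phi>"
      using pencil_unique[OF fr[unfolded l'] u indep p(1) _ q(1) _ pq] p(2) Ax by blast
    then show ?thesis using reparametrization_class_eq by metis
  qed
  ultimately show ?thesis by blast
qed

end

text \<open>The coefficient of q in the product of c_l and sigma_k: \<open>replicate l k\<close> is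
  dual to the empty partition.\<close>

lemma gromov_witten_degree_1:
  assumes n: "CARD('n::finite) = l + k" and l: "1 \<le> l" and k: "1 \<le> k"
  shows "gromov_witten TYPE('n) l k 1 (replicate l 1) (hook l k 1) (replicate l k) = 1"
proof (rule gromov_witten_eqI[OF n])
  show "sum_list (replicate l 1) + sum_list (hook l k 1) + sum_list (replicate l k) = l * k + 1 * (l + k)"
    by (simp add: hook_def sum_list_replicate)
next
  fix F G H :: "nat \<Rightarrow> (complex^'n) set" assume gp: "in_general_position l k F G H"
  interpret general_flags l k F G H using gp n l k by unfold_locales
  let ?C = "curves_meeting l 1 (schubert_variety l k (replicate l 1) F)
    (schubert_variety l k (hook l k 1) G) (schubert_variety l k (replicate l k) H)"
  obtain f0 where f0: "f0 \<in> ?C" "\<And>f. f \<in> ?C \<Longrightarrow> reparametrization `` {f} = reparametrization `` {f0}"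
    using degree_1_curves by blast
  have "?C // reparametrization = (\<lambda>f. reparametrization `` {f}) ` ?C" unfolding quotient_def by blast
  also have "\<dots> = {reparametrization `` {f0}}" using f0 by blast
  finally show "finite (?C // reparametrization) \<and> card (?C // reparametrization) = 1" by simp
qed

section \<open>Determinants over a ring with carrier\<close>

context cring
begin

text \<open>Signs are kept as truth values, so that \<open>evenperm\<close> and parities of indices
  enter directly.\<close>

definition signed :: "bool \<Rightarrow> 'a \<Rightarrow> 'a" where
  "signed b x = (if b then x else \<ominus> x)"

lemma ring_det_signed:
  "ring_det R p M = (\<Oplus>\<pi>\<in>{\<pi>. \<pi> permutes {..<p}}. signed (evenperm \<pi>) (\<Otimes>i\<in>{..<p}. M i (\<pi> i)))"
  unfolding ring_det_def signed_def ..

lemma signed_closed [simp]: "x \<in> carrier R \<Longrightarrow> signed b x \<in> carrier R"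
  by (simp add: signed_def)

lemma entries_closed:
  assumes "\<And>i j. i < p \<Longrightarrow> j < p \<Longrightarrow> M i j \<in> carrier R" "\<pi> permutes {..<p}"
  shows "(\<Otimes>i\<in>{..<p}. M i (\<pi> i)) \<in> carrier R"
  using assms(1) permutes_in_image[OF assms(2)] by (intro finprod_closed) auto

lemma ring_det_closed:
  assumes "\<And>i j. i < p \<Longrightarrow> j < p \<Longrightarrow> M i j \<in> carrier R"
  shows "ring_det R p M \<in> carrier R"
  unfolding ring_det_signed using entries_closed[of p M, OF assms] by (intro finsum_closed) auto

lemma ring_det_cong:
  assumes "\<And>i j. i < p \<Longrightarrow> j < p \<Longrightarrow> M i j = N i j" "\<And>i j. i < p \<Longrightarrow> j < p \<Longrightarrow> N i j \<in> carrier R"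
  shows "ring_det R p M = ring_det R p N"
  unfolding ring_det_signed
proof (rule finsum_cong')
  fix \<pi> assume "\<pi> \<in> {\<pi>. \<pi> permutes {..<p}}"
  then have \<pi>: "\<pi> permutes {..<p}" by simp
  have "(\<Otimes>i\<in>{..<p}. M i (\<pi> i)) = (\<Otimes>i\<in>{..<p}. N i (\<pi> i))"
    using assms permutes_in_image[OF \<pi>] by (intro finprod_cong') auto
  then show "signed (evenperm \<pi>) (\<Otimes>i\<in>{..<p}. M i (\<pi> i)) = signed (evenperm \<pi>) (\<Otimes>i\<in>{..<p}. N i (\<pi> i))"
    by simp
qed (use entries_closed[of p N, OF assms(2)] in auto)

lemma ring_det_scale_rows:
  assumes M: "\<And>i j. i < p \<Longrightarrow> j < p \<Longrightarrow> M i j \<in> carrier R" and a: "\<And>i. i < p \<Longrightarrow> a i \<in> carrier R"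
  shows "ring_det R p (\<lambda>i j. a i \<otimes> M i j) = (\<Otimes>i\<in>{..<p}. a i) \<otimes> ring_det R p M"
proof -
  have ac: "(\<Otimes>i\<in>{..<p}. a i) \<in> carrier R" using a by (intro finprod_closed) auto
  have "ring_det R p (\<lambda>i j. a i \<otimes> M i j) = (\<Oplus>\<pi>\<in>{\<pi>. \<pi> permutes {..<p}}.
      (\<Otimes>i\<in>{..<p}. a i) \<otimes> signed (evenperm \<pi>) (\<Otimes>i\<in>{..<p}. M i (\<pi> i)))"
    unfolding ring_det_signed
  proof (rule finsum_cong')
    fix \<pi> assume "\<pi> \<in> {\<pi>. \<pi> permutes {..<p}}"
    then have \<pi>: "\<pi> permutes {..<p}" by simp
    have "(\<Otimes>i\<in>{..<p}. a i \<otimes> M i (\<pi> i)) = (\<Otimes>i\<in>{..<p}. a i) \<otimes> (\<Otimes>i\<in>{..<p}. M i (\<pi> i))"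
      using M a permutes_in_image[OF \<pi>] by (intro finprod_multf) auto
    then show "signed (evenperm \<pi>) (\<Otimes>i\<in>{..<p}. a i \<otimes> M i (\<pi> i)) =
        (\<Otimes>i\<in>{..<p}. a i) \<otimes> signed (evenperm \<pi>) (\<Otimes>i\<in>{..<p}. M i (\<pi> i))"
      using ac entries_closed[of p M, OF M \<pi>] by (simp add: signed_def r_minus)
  qed (use entries_closed[of p M, OF M] ac in auto)
  also have "\<dots> = (\<Otimes>i\<in>{..<p}. a i) \<otimes> ring_det R p M"
    unfolding ring_det_signed using entries_closed[of p M, OF M] ac
    by (intro finsum_rdistr[symmetric]) (auto simp: finite_permutations)
  finally show ?thesis .
qed

text \<open>One term of the Laplace expansion along column 0. The permutations with
  \<open>\<pi> i0 = 0\<close> arise from permutations of \<open>p\<close> elements by inserting this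
  value, which multiplies the sign by \<open>(-1)^i0\<close>.\<close>

lemma ring_det_column_part:
  assumes M: "\<And>i j. i < Suc p \<Longrightarrow> j < Suc p \<Longrightarrow> M i j \<in> carrier R" and i0: "i0 < Suc p"
  shows "(\<Oplus>\<pi>\<in>{\<pi>. \<pi> permutes {..<Suc p} \<and> \<pi> i0 = 0}. signed (evenperm \<pi>) (\<Otimes>i\<in>{..<Suc p}. M i (\<pi> i))) =
    signed (even i0) (M i0 0) \<otimes> ring_det R p (\<lambda>i j. M (insert_index i0 i) (Suc j))"
proof -
  let ?N = "\<lambda>i j. M (insert_index i0 i) (Suc j)"
  let ?P = "{\<sigma>. \<sigma> permutes {..<p}}"
  have ins: "insert_index i0 i < Suc p" if "i < p" for i using that by (auto simp: insert_index_def)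
  have N: "\<And>i j. i < p \<Longrightarrow> j < p \<Longrightarrow> ?N i j \<in> carrier R" using M ins by simp
  have S: "{\<pi>. \<pi> permutes {..<Suc p} \<and> \<pi> i0 = 0} = permutation_insert i0 0 ` ?P"
    using permutation_fix[of i0 p 0] i0 by (simp add: lessThan_atLeast0)
  have inj: "inj_on (permutation_insert i0 0) ?P"
    using permutation_insert_inj_on[of i0 p 0] i0 by (simp add: lessThan_atLeast0)
  have perm: "\<pi> permutes {..<Suc p}" if "\<pi> \<in> permutation_insert i0 0 ` ?P" for \<pi>
    using that S by blast
  have "(\<Oplus>\<pi>\<in>permutation_insert i0 0 ` ?P. signed (evenperm \<pi>) (\<Otimes>i\<in>{..<Suc p}. M i (\<pi> i))) =
    (\<Oplus>\<sigma>\<in>?P. signed (evenperm (permutation_insert i0 0 \<sigma>))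
      (\<Otimes>i\<in>{..<Suc p}. M i (permutation_insert i0 0 \<sigma> i)))"
    using entries_closed[of "Suc p" M, OF M perm] inj by (intro finsum_reindex) auto
  also have "\<dots> = (\<Oplus>\<sigma>\<in>?P. signed (even i0) (M i0 0) \<otimes> signed (evenperm \<sigma>) (\<Otimes>i\<in>{..<p}. ?N i (\<sigma> i)))"
  proof (rule finsum_cong')
    show "(\<lambda>\<sigma>. signed (even i0) (M i0 0) \<otimes> signed (evenperm \<sigma>) (\<Otimes>i\<in>{..<p}. ?N i (\<sigma> i))) \<in> ?P \<rightarrow> carrier R"
      using M i0 entries_closed[of p ?N, OF N] by auto
    fix \<sigma> assume "\<sigma> \<in> ?P"
    then have \<sigma>: "\<sigma> permutes {..<p}" by simp
    let ?\<pi> = "permutation_insert i0 0 \<sigma>"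
    have "sign ?\<pi> = (- 1) ^ i0 * (sign \<sigma> :: int)"
      using signof_permutation_insert[of \<sigma> p i0 0, where 'a = int] \<sigma> i0 by (simp add: lessThan_atLeast0)
    then have par: "evenperm ?\<pi> \<longleftrightarrow> (even i0 \<longleftrightarrow> evenperm \<sigma>)"
      by (auto simp: sign_def minus_one_power_iff split: if_splits)
    have dom: "{..<Suc p} = insert i0 (insert_index i0 ` {..<p})"
    proof (intro equalityI subsetI)
      fix i assume i: "i \<in> {..<Suc p}"
      show "i \<in> insert i0 (insert_index i0 ` {..<p})"
      proof (cases "i = i0")
        case False
        then have "i = insert_index i0 (delete_index i0 i)" by (simp add: insert_delete_index)
        moreover have "delete_index i0 i < p" using False i i0 by (auto simp: delete_index_def)
        ultimately show ?thesis by blast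
      qed simp
    qed (use ins i0 in auto)
    have nin: "i0 \<notin> insert_index i0 ` {..<p}" by (auto simp: insert_index_def split: if_splits)
    have inji: "inj_on (insert_index i0) {..<p}" by (metis delete_insert_index inj_onI)
    have val: "?\<pi> (insert_index i0 i) = Suc (\<sigma> i)" for i
      by (auto simp: permutation_insert_expand insert_index_def)
    have cl: "M i (?\<pi> i) \<in> carrier R" if "i < Suc p" for i
      using M that perm[of ?\<pi>] \<sigma> permutes_in_image[of ?\<pi> "{..<Suc p}" i] by auto
    have "(\<Otimes>i\<in>{..<Suc p}. M i (?\<pi> i)) = M i0 0 \<otimes> (\<Otimes>i\<in>insert_index i0 ` {..<p}. M i (?\<pi> i))"
      unfolding dom using nin cl ins i0 M[of i0 0] by (subst finprod_insert) auto
    also have "(\<Otimes>i\<in>insert_index i0 ` {..<p}. M i (?\<pi> i)) = (\<Otimes>i\<in>{..<p}. M (insert_index i0 i) (?\<pi> (insert_index i0 i)))"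
      using inji cl ins by (intro finprod_reindex) auto
    finally have "(\<Otimes>i\<in>{..<Suc p}. M i (?\<pi> i)) = M i0 0 \<otimes> (\<Otimes>i\<in>{..<p}. ?N i (\<sigma> i))"
      unfolding val .
    then show "signed (evenperm ?\<pi>) (\<Otimes>i\<in>{..<Suc p}. M i (?\<pi> i)) =
      signed (even i0) (M i0 0) \<otimes> signed (evenperm \<sigma>) (\<Otimes>i\<in>{..<p}. ?N i (\<sigma> i))"
      using M[of i0 0] i0 entries_closed[of p ?N, OF N \<sigma>] par by (auto simp: signed_def l_minus r_minus)
  qed simp
  also have "\<dots> = signed (even i0) (M i0 0) \<otimes> ring_det R p ?N"
    unfolding ring_det_signed using entries_closed[of p ?N, OF N] M i0
    by (intro finsum_rdistr[symmetric]) (auto simp: finite_permutations)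
  finally show ?thesis unfolding S .
qed

text \<open>Only rows 0 and 1 can be nonzero in column 0, so a permutation contributes only if it
  sends one of them to 0. Deleting row 1 leaves the rows 0, 2, 3, and so on, which explains the
  index in the last determinant.\<close>

lemma ring_det_hessenberg:
  assumes M: "\<And>i j. i < Suc (Suc p) \<Longrightarrow> j < Suc (Suc p) \<Longrightarrow> M i j \<in> carrier R"
    and z: "\<And>i. 2 \<le> i \<Longrightarrow> i < Suc (Suc p) \<Longrightarrow> M i 0 = \<zero>"
  shows "ring_det R (Suc (Suc p)) M = M 0 0 \<otimes> ring_det R (Suc p) (\<lambda>i j. M (Suc i) (Suc j)) \<ominus>
    M 1 0 \<otimes> ring_det R (Suc p) (\<lambda>i j. M (if i = 0 then 0 else Suc i) (Suc j))"
proof -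
  let ?S = "{\<pi>. \<pi> permutes {..<Suc (Suc p)}}"
  let ?T = "\<lambda>\<pi>. signed (evenperm \<pi>) (\<Otimes>i\<in>{..<Suc (Suc p)}. M i (\<pi> i))"
  let ?A = "\<lambda>i0. {\<pi>. \<pi> permutes {..<Suc (Suc p)} \<and> \<pi> i0 = 0}"
  let ?C = "{\<pi> \<in> ?S. \<pi> 0 \<noteq> 0 \<and> \<pi> 1 \<noteq> 0}"
  have fin: "finite ?S" by (simp add: finite_permutations)
  have cl: "?T \<in> ?S \<rightarrow> carrier R" using entries_closed[of "Suc (Suc p)" M, OF M] by auto
  have S: "?S = (?A 0 \<union> ?A 1) \<union> ?C" by blast
  have disj: "?A 0 \<inter> ?A 1 = {}"
  proof (rule ccontr)
    assume "?A 0 \<inter> ?A 1 \<noteq> {}"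
    then obtain \<pi> where \<pi>: "\<pi> permutes {..<Suc (Suc p)}" "\<pi> 0 = 0" "\<pi> 1 = 0" by blast
    then show False using injD[OF permutes_inj[OF \<pi>(1)], of 0 1] by simp
  qed
  have C0: "finsum R ?T ?C = \<zero>"
  proof (rule add.finprod_one_eqI)
    fix \<pi> assume "\<pi> \<in> ?C"
    then have \<pi>: "\<pi> permutes {..<Suc (Suc p)}" "\<pi> 0 \<noteq> 0" "\<pi> 1 \<noteq> 0" by auto
    obtain i where i: "\<pi> i = 0" using permutes_surj[OF \<pi>(1)] by (metis surj_def)
    then have i2: "2 \<le> i" using \<pi>(2,3) by (cases i; cases "i - 1") (auto simp: numeral_2_eq_2)
    have ilt: "i < Suc (Suc p)" using i permutes_in_image[OF \<pi>(1), of i] by simp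
    have "(\<Otimes>j\<in>insert i ({..<Suc (Suc p)} - {i}). M j (\<pi> j)) =
        M i (\<pi> i) \<otimes> (\<Otimes>j\<in>{..<Suc (Suc p)} - {i}. M j (\<pi> j))"
      using M permutes_in_image[OF \<pi>(1)] ilt by (intro finprod_insert) auto
    also have "\<dots> = \<zero>"
      using M permutes_in_image[OF \<pi>(1)] z[OF i2 ilt] i by (auto intro!: l_null finprod_closed)
    also have "insert i ({..<Suc (Suc p)} - {i}) = {..<Suc (Suc p)}" using ilt by blast
    finally show "?T \<pi> = \<zero>" by (simp add: signed_def)
  qed
  have N: "ring_det R (Suc p) (\<lambda>i j. M (insert_index i0 i) (Suc j)) \<in> carrier R" for i0
    using M by (intro ring_det_closed) (auto simp: insert_index_def)
  have e0: "insert_index 0 i = Suc i" for i by simp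
  have e1: "insert_index 1 i = (if i = 0 then 0 else Suc i)" for i by (simp add: insert_index_def)
  have "ring_det R (Suc (Suc p)) M = finsum R ?T ((?A 0 \<union> ?A 1) \<union> ?C)"
    unfolding ring_det_signed S[symmetric] ..
  also have "\<dots> = finsum R ?T (?A 0 \<union> ?A 1) \<oplus> finsum R ?T ?C"
    using cl fin by (intro finsum_Un_disjoint) (auto intro: finite_subset[OF _ fin])
  also have "finsum R ?T (?A 0 \<union> ?A 1) = finsum R ?T (?A 0) \<oplus> finsum R ?T (?A 1)"
    using cl fin disj by (intro finsum_Un_disjoint) (auto intro: finite_subset[OF _ fin])
  also have "finsum R ?T (?A 0) = M 0 0 \<otimes> ring_det R (Suc p) (\<lambda>i j. M (insert_index 0 i) (Suc j))"
    using ring_det_column_part[of "Suc p" M, OF M, of 0] by (simp add: signed_def)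
  also have "finsum R ?T (?A 1) = (\<ominus> M 1 0) \<otimes> ring_det R (Suc p) (\<lambda>i j. M (insert_index 1 i) (Suc j))"
    using ring_det_column_part[of "Suc p" M, OF M, of 1] by (simp add: signed_def)
  finally show ?thesis
    unfolding C0 e0 e1 using N[of 0] N[of 1] M[of 0 0] M[of 1 0]
    unfolding e0 e1 by (simp add: minus_eq l_minus)
qed

lemma ring_det_0: "ring_det R 0 M = \<one>"
proof -
  have "{\<pi>. \<pi> permutes {..<0::nat}} = {id}" by auto
  moreover have "evenperm (id :: nat \<Rightarrow> nat)" by simp
  ultimately show ?thesis unfolding ring_det_def by simp
qed

lemma ring_det_1:
  assumes "M 0 0 \<in> carrier R"
  shows "ring_det R (Suc 0) M = M 0 0"
proof -
  have "{\<pi>. \<pi> permutes {..<Suc 0}} = {id}" by (auto simp: lessThan_Suc)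
  moreover have "evenperm (id :: nat \<Rightarrow> nat)" by simp
  ultimately show ?thesis unfolding ring_det_def using assms by (simp add: lessThan_Suc)
qed

text \<open>For \<open>r = 1\<close> this is the determinant defining \<open>\<sigma>\<^sub>p\<close>; in general it is the Giambelli determinant
  of the hook \<open>(p, 1\<^bsup>r-1\<^esup>)\<close>.\<close>

definition hook_det :: "(int \<Rightarrow> 'a) \<Rightarrow> nat \<Rightarrow> nat \<Rightarrow> 'a" where
  "hook_det c r p = ring_det R p (\<lambda>i j. if i = 0 then c (int r + int j) else c (1 + int j - int i))"

definition row_det :: "(int \<Rightarrow> 'a) \<Rightarrow> int \<Rightarrow> 'a" where
  "row_det c p = (if p < 0 then \<zero> else hook_det c 1 (nat p))"

context
  fixes c :: "int \<Rightarrow> 'a"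
  assumes c: "\<And>i. c i \<in> carrier R" and c0: "c 0 = \<one>" and cneg: "\<And>i. i < 0 \<Longrightarrow> c i = \<zero>"
begin

lemma hook_det_closed: "hook_det c r p \<in> carrier R"
  unfolding hook_det_def by (intro ring_det_closed) (simp add: c)

lemma row_det_closed: "row_det c p \<in> carrier R"
  unfolding row_det_def using hook_det_closed by simp

lemma hook_det_1: "hook_det c r 1 = c (int r)"
  unfolding hook_det_def using ring_det_1[of "\<lambda>i j. if i = 0 then c (int r + int j) else c (1 + int j - int i)"]
  by (simp add: c)

lemma hook_det_row: "ring_det R p (\<lambda>i j. c (1 + int j - int i)) = hook_det c 1 p"
  unfolding hook_det_def by (intro ring_det_cong) (auto simp: c)

text \<open>The first column is \<open>c r\<close>, 1, 0, 0, and so on. Deleting row 0 leaves the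
  matrix of sigma_p; deleting row 1 leaves a first row that starts one step later. At
  \<open>p = 0\<close> the determinant is \<open>c r\<close>, while the right-hand side would be
  \<open>c r\<close> minus 1.\<close>

lemma hook_det_Suc:
  assumes "p \<ge> 1"
  shows "hook_det c r (Suc p) = c (int r) \<otimes> hook_det c 1 p \<ominus> hook_det c (Suc r) p"
proof -
  obtain p' where p: "p = Suc p'" using assms by (cases p) auto
  let ?M = "\<lambda>i j. if i = 0 then c (int r + int j) else c (1 + int j - int i)"
  have "ring_det R (Suc (Suc p')) ?M = ?M 0 0 \<otimes> ring_det R (Suc p') (\<lambda>i j. ?M (Suc i) (Suc j)) \<ominus>
    ?M 1 0 \<otimes> ring_det R (Suc p') (\<lambda>i j. ?M (if i = 0 then 0 else Suc i) (Suc j))"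
    by (rule ring_det_hessenberg) (auto simp: c cneg)
  also have "ring_det R (Suc p') (\<lambda>i j. ?M (Suc i) (Suc j)) = hook_det c 1 (Suc p')"
    unfolding hook_det_def by (intro ring_det_cong) (auto simp: c intro!: arg_cong[where f = c])
  also have "ring_det R (Suc p') (\<lambda>i j. ?M (if i = 0 then 0 else Suc i) (Suc j)) = hook_det c (Suc r) (Suc p')"
    unfolding hook_det_def by (intro ring_det_cong) (auto simp: c intro!: arg_cong[where f = c])
  finally show ?thesis using hook_det_closed[of "Suc r" "Suc p'"] unfolding p hook_det_def[of c r] by (simp add: c0)
qed

text \<open>The quantum Pieri rule for hooks makes the sequence of the \<open>\<sigma>\<^sub>p\<close> periodic up to the factor
  \<open>(-1)\<^bsup>l-1\<^esup> q\<close>.\<close>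

context
  fixes l k :: nat and h :: "nat \<Rightarrow> nat \<Rightarrow> 'a" and q :: 'a
  assumes l: "l \<ge> 1" and k: "k \<ge> 1" and cl: "\<And>i. i > int l \<Longrightarrow> c i = \<zero>"
    and h: "\<And>r p. h r p \<in> carrier R" and h1: "\<And>r. 1 \<le> r \<Longrightarrow> r \<le> l \<Longrightarrow> h r 1 = c (int r)"
    and hout: "\<And>r p. l < r \<or> k < p \<Longrightarrow> h r p = \<zero>" and q: "q \<in> carrier R"
    and pieri: "\<And>i m. 1 \<le> i \<Longrightarrow> i \<le> l \<Longrightarrow> 1 \<le> m \<Longrightarrow> m \<le> k \<Longrightarrow>
      c (int i) \<otimes> h 1 m = h i (Suc m) \<oplus> h (Suc i) m \<oplus> (if i = l \<and> m = k then q else \<zero>)"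
begin

lemma cancel_minus: "x \<in> carrier R \<Longrightarrow> y \<in> carrier R \<Longrightarrow> z \<in> carrier R \<Longrightarrow> (x \<oplus> y \<oplus> z) \<ominus> y = x \<oplus> z"
  by algebra

text \<open>Pieri and the recursion fit together: removing the hook \<open>(p, 1^r)\<close> from the
  product of c_r and sigma_p leaves \<open>(p + 1, 1^(r-1))\<close>. There is no q term as long as
  \<open>p < k\<close>.\<close>

lemma hook_det_eq:
  assumes "1 \<le> p" "p \<le> k" "1 \<le> r"
  shows "hook_det c r p = h r p"
  using assms
proof (induction p arbitrary: r rule: nat_induct_at_least)
  case base
  show ?case
  proof (cases "r \<le> l")
    case True
    then show ?thesis using h1 base hook_det_1 by simp
  next
    case False
    then show ?thesis using hook_det_1 hout[of r 1] cl[of "int r"] by simp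
  qed
next
  case (Suc p)
  have IH: "hook_det c 1 p = h 1 p" "hook_det c (Suc r) p = h (Suc r) p" using Suc by auto
  show ?case
  proof (cases "r \<le> l")
    case True
    have "c (int r) \<otimes> h 1 p = h r (Suc p) \<oplus> h (Suc r) p \<oplus> \<zero>" using pieri[of r p] Suc True by simp
    then show ?thesis
      unfolding hook_det_Suc[OF Suc(1)] IH using cancel_minus[of "h r (Suc p)" "h (Suc r) p" \<zero>] h by simp
  next
    case False
    then show ?thesis
      unfolding hook_det_Suc[OF Suc(1)] IH using hout cl[of "int r"] h by (simp add: minus_eq)
  qed
qed

text \<open>The step from \<open>k\<close> to \<open>k + 1\<close> leaves q at \<open>r = l\<close>
  only. From then on sigma_(k+t) vanishes for \<open>t < l\<close>, so each step moves q to the next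
  smaller \<open>r\<close> and changes its sign; it reaches \<open>r = 1\<close> at
  \<open>t = l\<close>, that is at \<open>p = n\<close>.\<close>

lemma hook_det_beyond:
  assumes "1 \<le> t" "t \<le> l" "1 \<le> r"
  shows "hook_det c r (k + t) = (if r + t = l + 1 then signed (odd t) q else \<zero>)"
  using assms
proof (induction t arbitrary: r rule: nat_induct_at_least)
  case base
  have IH: "hook_det c 1 k = h 1 k" "hook_det c (Suc r) k = h (Suc r) k" using hook_det_eq k by auto
  have S: "hook_det c r (k + 1) = c (int r) \<otimes> h 1 k \<ominus> h (Suc r) k"
    using hook_det_Suc[OF k] IH by simp
  show ?case
  proof (cases "r \<le> l")
    case True
    have "c (int r) \<otimes> h 1 k = \<zero> \<oplus> h (Suc r) k \<oplus> (if r = l then q else \<zero>)"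
      using pieri[of r k] base True k hout[of r "Suc k"] by simp
    then show ?thesis
      unfolding S using cancel_minus[of \<zero> "h (Suc r) k" "if r = l then q else \<zero>"] h q by (simp add: signed_def)
  next
    case False
    then show ?thesis unfolding S using hout cl[of "int r"] h by (simp add: minus_eq)
  qed
next
  case (Suc t)
  have "hook_det c 1 (k + t) = \<zero>" using Suc.IH[of 1] Suc.prems by simp
  moreover have "hook_det c (Suc r) (k + t) = (if r + Suc t = l + 1 then signed (odd t) q else \<zero>)"
    using Suc.IH[of "Suc r"] Suc.prems by simp
  ultimately have "hook_det c r (Suc (k + t)) = c (int r) \<otimes> \<zero> \<ominus> (if r + Suc t = l + 1 then signed (odd t) q else \<zero>)"
    using hook_det_Suc[of "k + t" r] k by simp
  then show ?case using c q by (simp add: minus_eq signed_def)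
qed

text \<open>Both sides obey the same linear recursion. The induction starts at \<open>p = 1\<close>,
  because for \<open>p = 0\<close> and \<open>r > 1\<close> the left side is 0 and the right side is
  the factor itself.\<close>

lemma hook_det_periodic:
  assumes "1 \<le> p" "1 \<le> r"
  shows "hook_det c r (l + k + p) = signed (odd l) q \<otimes> hook_det c r p"
  using assms
proof (induction p arbitrary: r rule: nat_induct_at_least)
  case base
  have "hook_det c 1 (l + k) = signed (odd l) q" "hook_det c (Suc r) (l + k) = \<zero>"
    using hook_det_beyond[of l 1] hook_det_beyond[of l "Suc r"] l base by (auto simp: add.commute)
  then show ?case
    using hook_det_Suc[of "l + k" r] k c q hook_det_1[of r] by (simp add: minus_eq m_comm)
next
  case (Suc p)
  have "signed (odd l) q \<in> carrier R" using q by simp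
  then have "c (int r) \<otimes> (signed (odd l) q \<otimes> hook_det c 1 p) \<ominus> signed (odd l) q \<otimes> hook_det c (Suc r) p =
      signed (odd l) q \<otimes> (c (int r) \<otimes> hook_det c 1 p \<ominus> hook_det c (Suc r) p)"
    using c[of "int r"] hook_det_closed[of 1 p] hook_det_closed[of "Suc r" p] by algebra
  then show ?case
    using hook_det_Suc[of "l + k + p" r] hook_det_Suc[OF Suc(1), of r] Suc.IH[of 1] Suc.IH[of "Suc r"] Suc.prems k by simp
qed

text \<open>For negative \<open>p\<close> both sides are 0, since \<open>p > - l\<close> puts
  \<open>p + n\<close> into the gap between \<open>k\<close> and \<open>n\<close>. For
  \<open>p = 0\<close> this is the value of sigma_n.\<close>

lemma row_det_shift:
  assumes "p > - int l"
  shows "row_det c (p + int (l + k)) = signed (odd l) q \<otimes> row_det c p"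
proof -
  consider "p < 0" | "p = 0" | "p > 0" by linarith
  then show ?thesis
  proof cases
    case 1
    define t where "t = nat (p + int l)"
    have t: "1 \<le> t" "t < l" "nat (p + int (l + k)) = k + t" using 1 assms by (auto simp: t_def)
    have "hook_det c 1 (k + t) = \<zero>" using hook_det_beyond[of t 1] t by simp
    then show ?thesis using 1 assms t(3) q by (simp add: row_det_def)
  next
    case 2
    have "hook_det c 1 0 = \<one>" unfolding hook_det_def by (rule ring_det_0)
    moreover have "hook_det c 1 (l + k) = signed (odd l) q"
      using hook_det_beyond[of l 1] l by (simp add: add.commute)
    ultimately show ?thesis using 2 q by (simp add: row_det_def nat_add_distrib)
  next
    case 3
    then have "nat (p + int (l + k)) = l + k + nat p" by simp
    then show ?thesis using 3 hook_det_periodic[of "nat p" 1] by (simp add: row_det_def)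
  qed
qed

lemma row_det_shifts:
  assumes "p > - int l"
  shows "row_det c (p + int (l + k) * int d) = signed (odd l) q [^] d \<otimes> row_det c p"
proof (induction d)
  case 0
  then show ?case using row_det_closed by simp
next
  case (Suc d)
  have "int (l + k) * int d \<ge> 0" by simp
  with assms have "p + int (l + k) * int d > - int l" by linarith
  moreover have "p + int (l + k) * int (Suc d) = p + int (l + k) * int d + int (l + k)"
    by (simp add: algebra_simps)
  ultimately have "row_det c (p + int (l + k) * int (Suc d)) = signed (odd l) q \<otimes> row_det c (p + int (l + k) * int d)"
    using row_det_shift by metis
  also have "\<dots> = signed (odd l) q \<otimes> signed (odd l) q [^] d \<otimes> row_det c p"
    unfolding Suc using row_det_closed q by (simp add: m_assoc)
  finally show ?case using q by (simp add: m_comm)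
qed

text \<open>The factor of row \<open>i\<close> is the same in every column, so it can be taken out.
  The bound on \<open>J i - int i\<close> concerns column 0, and indices only grow along a
  row.\<close>

lemma det_reduction:
  assumes len: "\<And>i. i < p \<Longrightarrow> - int l < J i - int i" and L: "\<And>i. i < p \<Longrightarrow> L i = J i + int (l + k) * int (d i)"
  shows "ring_det R p (\<lambda>i j. row_det c (L i + int j - int i)) =
    signed (odd l) q [^] (\<Sum>i<p. d i) \<otimes> ring_det R p (\<lambda>i j. row_det c (J i + int j - int i))"
proof -
  let ?\<kappa> = "signed (odd l) q"
  have \<kappa>: "?\<kappa> \<in> carrier R" using q by simp
  have "ring_det R p (\<lambda>i j. row_det c (L i + int j - int i)) =
      ring_det R p (\<lambda>i j. ?\<kappa> [^] d i \<otimes> row_det c (J i + int j - int i))"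
  proof (rule ring_det_cong)
    fix i j assume ij: "i < p" "j < p"
    have "L i + int j - int i = (J i + int j - int i) + int (l + k) * int (d i)" using L[OF ij(1)] by simp
    moreover have "J i + int j - int i > - int l" using len[OF ij(1)] by simp
    ultimately show "row_det c (L i + int j - int i) = ?\<kappa> [^] d i \<otimes> row_det c (J i + int j - int i)"
      using row_det_shifts by metis
  qed (use \<kappa> row_det_closed in simp)
  also have "\<dots> = (\<Otimes>i\<in>{..<p}. ?\<kappa> [^] d i) \<otimes> ring_det R p (\<lambda>i j. row_det c (J i + int j - int i))"
    using \<kappa> row_det_closed by (intro ring_det_scale_rows) auto
  also have "(\<Otimes>i\<in>{..<p}. ?\<kappa> [^] d i) = ?\<kappa> [^] (\<Sum>i<p. d i)"
  proof (induction p)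
    case (Suc p)
    have "(\<Otimes>i\<in>{..<Suc p}. ?\<kappa> [^] d i) = ?\<kappa> [^] d p \<otimes> (\<Otimes>i\<in>{..<p}. ?\<kappa> [^] d i)"
      unfolding lessThan_Suc using \<kappa> by (intro finprod_insert) auto
    then show ?case using Suc \<kappa> by (simp add: nat_pow_mult add.commute)
  qed simp
  finally show ?thesis .
qed

end

end

end

section \<open>The quantum cohomology ring\<close>

lemma finite_rect_partitions: "finite (rect_partitions l k)"
proof (rule finite_subset)
  show "rect_partitions l k \<subseteq> {xs. set xs \<subseteq> {..k} \<and> length xs = l}"
    by (auto simp: rect_partitions_def partitions_def)
qed (simp add: finite_lists_length_eq)

lemma sorted_wrt_replicate: "sorted_wrt (\<ge>) (replicate n (x :: nat))"
  by (induction n) auto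

lemma hook_rect_partitions:
  assumes "1 \<le> s" "s \<le> l" "1 \<le> a" "a \<le> k"
  shows "hook l a s \<in> rect_partitions l k"
  using assms by (auto simp: hook_def rect_partitions_def partitions_def sorted_wrt_append
      intro: sorted_wrt_replicate[simplified])

lemma sum_list_hook: "1 \<le> s \<Longrightarrow> sum_list (hook l a s) = a + s - 1"
  by (simp add: hook_def sum_list_replicate)

lemma hook_column: "1 \<le> i \<Longrightarrow> replicate i 1 @ replicate (l - i) 0 = hook l 1 i"
  by (cases i) (simp_all add: hook_def)

lemma structure_constant_hook:
  assumes n: "CARD('n::finite) = l + k" and i: "1 \<le> i" "i \<le> l" and m: "1 \<le> m" "m \<le> k"
    and \<nu>: "\<nu> \<in> rect_partitions l k"
  shows "structure_constant TYPE('n) l k (hook l 1 i) (hook l m 1) \<nu> =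
    (if \<nu> = hook l (m + 1) i \<or> \<nu> = hook l m (i + 1) then 1 else 0) +
    (if i = l \<and> m = k \<and> \<nu> = replicate l 0 then monom 1 1 else 0)"
proof -
  let ?D = "sum_list (hook l 1 i) + sum_list (hook l m 1) + sum_list (dual_partition k \<nu>)"
  let ?g = "\<lambda>d. gromov_witten TYPE('n) l k d (hook l 1 i) (hook l m 1) (dual_partition k \<nu>)"
  have D: "?D + sum_list \<nu> = i + m + l * k"
    using sum_list_dual_partition[OF \<nu>] i by (simp add: sum_list_hook)
  have g0: "?g d = 0" if "sum_list \<nu> + d * (l + k) \<noteq> i + m" for d
    using D that unfolding gromov_witten_def by (intro if_not_P) linarith
  have hooks: "sum_list \<nu> = i + m" if "\<nu> = hook l (m + 1) i \<or> \<nu> = hook l m (i + 1)"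
    using that i m by (auto simp: sum_list_hook)
  have zero: "replicate l 0 = \<nu>" if "sum_list \<nu> = 0"
  proof -
    have "\<forall>x\<in>set \<nu>. x = 0" using that by simp
    moreover have "length \<nu> = l" using \<nu> by (simp add: rect_partitions_def partitions_def)
    ultimately show ?thesis by (metis replicate_length_same)
  qed
  \<comment> \<open>In the first case only \<open>d = 0\<close> contributes, in the second only
    \<open>d = 1\<close>; in the third the size equation has no solution.\<close>
  consider (classical) "sum_list \<nu> = i + m" | (quantum) "sum_list \<nu> = 0" "i = l" "m = k"
    | (other) "sum_list \<nu> \<noteq> i + m" "\<not> (sum_list \<nu> = 0 \<and> i = l \<and> m = k)" by metis
  then show ?thesis
  proof cases
    case classical
    have "structure_constant TYPE('n) l k (hook l 1 i) (hook l m 1) \<nu> = (\<Sum>d\<in>{0}. monom (int (?g d)) d)"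
      unfolding structure_constant_def
    proof (rule sum.mono_neutral_right)
      show "\<forall>d\<in>{..?D} - {0}. monom (int (?g d)) d = 0"
        using g0 classical i by auto
    qed auto
    also have "\<dots> = monom (int (?g 0)) 0" by simp
    also have "?g 0 = (if \<nu> = hook l (m + 1) i \<or> \<nu> = hook l m (i + 1) then 1 else 0)"
      using gromov_witten_hook[OF n i m \<nu> classical] unfolding hook_column[OF i(1)] .
    finally have "structure_constant TYPE('n) l k (hook l 1 i) (hook l m 1) \<nu> =
      (if \<nu> = hook l (m + 1) i \<or> \<nu> = hook l m (i + 1) then 1 else 0)" by auto
    moreover have "\<nu> \<noteq> replicate l 0" using classical i by (auto simp: sum_list_replicate)
    ultimately show ?thesis by simp
  next
    case quantum
    have "structure_constant TYPE('n) l k (hook l 1 i) (hook l m 1) \<nu> = (\<Sum>d\<in>{1}. monom (int (?g d)) d)"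
      unfolding structure_constant_def
    proof (rule sum.mono_neutral_right)
      show "{1} \<subseteq> {..?D}" using D quantum i by auto
      show "\<forall>d\<in>{..?D} - {1}. monom (int (?g d)) d = 0"
      proof
        fix d assume "d \<in> {..?D} - {1}"
        then have "d * (l + k) \<noteq> 1 * (l + k)" using i by (subst mult_cancel2) auto
        then show "monom (int (?g d)) d = 0" using g0[of d] quantum by simp
      qed
    qed auto
    also have "\<dots> = monom (int (?g 1)) 1" by simp
    also have "?g 1 = 1"
      using gromov_witten_degree_1[OF n] i m hook_column[of l l] zero[OF quantum(1)] quantum(2,3)
      by (auto simp: dual_partition_def)
    finally show ?thesis using hooks quantum zero i by auto
  next
    case other
    have "?g d = 0" for d
    proof (cases "d = 0 \<or> 2 \<le> d")
      case True
      moreover have "2 * (l + k) \<le> d * (l + k)" if "2 \<le> d" using that by (rule mult_le_mono1)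
      ultimately show ?thesis using other(1) i m by (intro g0) auto
    next
      case False
      then have "d = 1" by simp
      show ?thesis
      proof (rule g0, rule notI)
        assume "sum_list \<nu> + d * (l + k) = i + m"
        then have "sum_list \<nu> + (l + k) = i + m" using \<open>d = 1\<close> by simp
        then have "sum_list \<nu> = 0" "i = l" "m = k" using i m by linarith+
        then show False using other(2) by blast
      qed
    qed
    then have "structure_constant TYPE('n) l k (hook l 1 i) (hook l m 1) \<nu> = 0"
      unfolding structure_constant_def by simp
    moreover have "\<not> (i = l \<and> m = k \<and> \<nu> = replicate l 0)" using other(2) by (auto simp: sum_list_replicate)
    ultimately show ?thesis using hooks other(1) by auto
  qed
qed

text \<open>Being a commutative ring says nothing about the action of the polynomials in q; its
  compatibility with the product is read off from the coefficients.\<close>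

lemma QH_smult_mult:
  "x \<in> carrier (QH T l k) \<Longrightarrow> (a \<odot>\<^bsub>QH T l k\<^esub> x) \<otimes>\<^bsub>QH T l k\<^esub> y = a \<odot>\<^bsub>QH T l k\<^esub> (x \<otimes>\<^bsub>QH T l k\<^esub> y)"
  by (auto simp: QH_def fun_eq_iff sum_distrib_left mult.assoc)

lemma QH_smult_smult: "a \<odot>\<^bsub>QH T l k\<^esub> (b \<odot>\<^bsub>QH T l k\<^esub> x) = (a * b) \<odot>\<^bsub>QH T l k\<^esub> x"
  by (simp add: QH_def mult.assoc)

lemma QH_smult_one: "1 \<odot>\<^bsub>QH T l k\<^esub> x = x"
  by (simp add: QH_def)

lemma QH_smult_closed: "x \<in> carrier (QH T l k) \<Longrightarrow> a \<odot>\<^bsub>QH T l k\<^esub> x \<in> carrier (QH T l k)"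
  by (simp add: QH_def)

lemma QH_a_inv:
  assumes "cring (QH T l k)" "x \<in> carrier (QH T l k)"
  shows "\<ominus>\<^bsub>QH T l k\<^esub> x = (- 1) \<odot>\<^bsub>QH T l k\<^esub> x"
proof -
  interpret R: cring "QH T l k" by fact
  show ?thesis
  proof (rule R.minus_equality)
    show "(- 1) \<odot>\<^bsub>QH T l k\<^esub> x \<oplus>\<^bsub>QH T l k\<^esub> x = \<zero>\<^bsub>QH T l k\<^esub>" by (simp add: QH_def)
  qed (use assms QH_smult_closed in auto)
qed

lemma schubert_class_closed: "lam \<in> rect_partitions l k \<Longrightarrow> schubert_class lam \<in> carrier (QH T l k)"
  by (auto simp: QH_def schubert_class_def)

lemma schubert_class_mult:
  assumes "lam \<in> rect_partitions l k" "\<mu> \<in> rect_partitions l k"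
  shows "schubert_class lam \<otimes>\<^bsub>QH T l k\<^esub> schubert_class \<mu> =
    (\<lambda>\<nu>. if \<nu> \<in> rect_partitions l k then structure_constant T l k lam \<mu> \<nu> else 0)"
proof
  fix \<nu>
  have "(\<Sum>a\<in>rect_partitions l k. \<Sum>b\<in>rect_partitions l k.
      schubert_class lam a * schubert_class \<mu> b * structure_constant T l k a b \<nu>) =
    (\<Sum>a\<in>rect_partitions l k. if a = lam then \<Sum>b\<in>rect_partitions l k. if b = \<mu> then structure_constant T l k a b \<nu> else 0 else 0)"
    by (intro sum.cong refl) (auto simp: schubert_class_def intro!: sum.cong)
  also have "\<dots> = structure_constant T l k lam \<mu> \<nu>"
    using assms finite_rect_partitions by simp
  finally show "(schubert_class lam \<otimes>\<^bsub>QH T l k\<^esub> schubert_class \<mu>) \<nu> =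
      (if \<nu> \<in> rect_partitions l k then structure_constant T l k lam \<mu> \<nu> else 0)"
    by (simp add: QH_def)
qed

text \<open>Set to 0 outside of the rectangle, so that one Pieri formula includes the boundary
  cases.\<close>

definition hook_class :: "nat \<Rightarrow> nat \<Rightarrow> nat \<Rightarrow> nat \<Rightarrow> nat list \<Rightarrow> int poly" where
  "hook_class l k r p = (if 1 \<le> r \<and> r \<le> l \<and> 1 \<le> p \<and> p \<le> k then schubert_class (hook l p r) else (\<lambda>_. 0))"

lemma chern_hook:
  assumes "1 \<le> i" "i \<le> l"
  shows "chern T l k (int i) = schubert_class (hook l 1 i)"
  using assms hook_column[OF assms(1), of l] by (simp add: chern_def)

text \<open>Compares coefficients with the structure constants; the two hooks have different first
  parts, so their contributions never fall on the same \<nu>.\<close>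

lemma quantum_pieri:
  assumes n: "CARD('n::finite) = l + k" and i: "1 \<le> i" "i \<le> l" and m: "1 \<le> m" "m \<le> k"
  shows "chern TYPE('n) l k (int i) \<otimes>\<^bsub>QH TYPE('n) l k\<^esub> hook_class l k 1 m =
    hook_class l k i (Suc m) \<oplus>\<^bsub>QH TYPE('n) l k\<^esub> hook_class l k (Suc i) m \<oplus>\<^bsub>QH TYPE('n) l k\<^esub>
    (if i = l \<and> m = k then monom 1 1 \<odot>\<^bsub>QH TYPE('n) l k\<^esub> \<one>\<^bsub>QH TYPE('n) l k\<^esub> else \<zero>\<^bsub>QH TYPE('n) l k\<^esub>)"
proof -
  have l: "1 \<le> l" and k: "1 \<le> k" using i m by auto
  have r: "hook l 1 i \<in> rect_partitions l k" "hook l m 1 \<in> rect_partitions l k"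
    using hook_rect_partitions i m l k by auto
  have ne: "hook l (Suc m) i \<noteq> hook l m (Suc i)" by (simp add: hook_def)
  have out: "hook l a s \<notin> rect_partitions l k" if "k < a \<or> l < s" "1 \<le> s" for a s
    using that by (auto simp: hook_def rect_partitions_def partitions_def)
  have z: "replicate l 0 \<in> rect_partitions l k"
    by (auto simp: rect_partitions_def partitions_def sorted_wrt_iff_nth_less)
  show ?thesis
    unfolding chern_hook[OF i]
  proof
    fix \<nu>
    have hc: "hook_class l k 1 m = schubert_class (hook l m 1)" using l m by (simp add: hook_class_def)
    have A: "hook_class l k i (Suc m) \<nu> = (if \<nu> \<in> rect_partitions l k \<and> \<nu> = hook l (Suc m) i then 1 else 0)"
      using i m hook_rect_partitions[of i l "Suc m" k] out[of "Suc m" i]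
      by (auto simp: hook_class_def schubert_class_def)
    have B: "hook_class l k (Suc i) m \<nu> = (if \<nu> \<in> rect_partitions l k \<and> \<nu> = hook l m (Suc i) then 1 else 0)"
      using i m hook_rect_partitions[of "Suc i" l m k] out[of m "Suc i"]
      by (auto simp: hook_class_def schubert_class_def)
    have C: "(if i = l \<and> m = k then monom 1 1 \<odot>\<^bsub>QH TYPE('n) l k\<^esub> \<one>\<^bsub>QH TYPE('n) l k\<^esub> else \<zero>\<^bsub>QH TYPE('n) l k\<^esub>) \<nu>
      = (if \<nu> \<in> rect_partitions l k \<and> i = l \<and> m = k \<and> \<nu> = replicate l 0 then monom 1 1 else 0)"
      using z by (auto simp: QH_def schubert_class_def)
    have add: "(x \<oplus>\<^bsub>QH TYPE('n) l k\<^esub> y) \<nu> = x \<nu> + y \<nu>" for x y by (simp add: QH_def)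
    show "(schubert_class (hook l 1 i) \<otimes>\<^bsub>QH TYPE('n) l k\<^esub> hook_class l k 1 m) \<nu> =
      (hook_class l k i (Suc m) \<oplus>\<^bsub>QH TYPE('n) l k\<^esub> hook_class l k (Suc i) m \<oplus>\<^bsub>QH TYPE('n) l k\<^esub>
      (if i = l \<and> m = k then monom 1 1 \<odot>\<^bsub>QH TYPE('n) l k\<^esub> \<one>\<^bsub>QH TYPE('n) l k\<^esub> else \<zero>\<^bsub>QH TYPE('n) l k\<^esub>)) \<nu>"
      unfolding add A B C hc schubert_class_mult[OF r]
      using structure_constant_hook[OF n i m, of \<nu>] ne by auto
  qed
qed

text \<open>\<open>(-1)^(l-1)\<close> is 1 exactly for odd \<open>l\<close>, so the ring element is
  \<open>(-1)^(l-1) q\<close>, and multiplication by it is a scalar action.\<close>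

lemma signed_power_action:
  assumes R: "cring (QH T l k)" and l: "l \<ge> 1" and x: "x \<in> carrier (QH T l k)"
  shows "cring.signed (QH T l k) (odd l) (monom 1 1 \<odot>\<^bsub>QH T l k\<^esub> \<one>\<^bsub>QH T l k\<^esub>) [^]\<^bsub>QH T l k\<^esub> d
    \<otimes>\<^bsub>QH T l k\<^esub> x = monom ((- 1) ^ (d * (l - 1))) d \<odot>\<^bsub>QH T l k\<^esub> x"
proof -
  interpret R: cring "QH T l k" by fact
  let ?\<kappa> = "R.signed (odd l) (monom 1 1 \<odot>\<^bsub>QH T l k\<^esub> \<one>\<^bsub>QH T l k\<^esub>)"
  have \<kappa>: "?\<kappa> = monom ((- 1) ^ (l - 1)) 1 \<odot>\<^bsub>QH T l k\<^esub> \<one>\<^bsub>QH T l k\<^esub>"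
    using l QH_a_inv[OF R QH_smult_closed[OF R.one_closed], of "monom 1 1"]
    by (auto simp: R.signed_def QH_smult_smult minus_monom)
  have \<kappa>c: "?\<kappa> \<in> carrier (QH T l k)" unfolding \<kappa> by (intro QH_smult_closed R.one_closed)
  have act: "?\<kappa> \<otimes>\<^bsub>QH T l k\<^esub> y = monom ((- 1) ^ (l - 1)) 1 \<odot>\<^bsub>QH T l k\<^esub> y" if "y \<in> carrier (QH T l k)" for y
    unfolding \<kappa> using that by (simp add: QH_smult_mult)
  show ?thesis
    using x
  proof (induction d arbitrary: x)
    case 0
    then show ?case by (simp add: QH_smult_one one_poly_eq_simps(1)[symmetric] monom_0 flip: one_pCons)
  next
    case (Suc d)
    have "?\<kappa> [^]\<^bsub>QH T l k\<^esub> Suc d \<otimes>\<^bsub>QH T l k\<^esub> x = ?\<kappa> [^]\<^bsub>QH T l k\<^esub> d \<otimes>\<^bsub>QH T l k\<^esub> (?\<kappa> \<otimes>\<^bsub>QH T l k\<^esub> x)"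
      using \<kappa>c Suc.prems by (simp add: R.m_assoc)
    also have "\<dots> = monom ((- 1) ^ (d * (l - 1))) d \<odot>\<^bsub>QH T l k\<^esub> (monom ((- 1) ^ (l - 1)) 1 \<odot>\<^bsub>QH T l k\<^esub> x)"
      unfolding act[OF Suc.prems] using Suc.IH[OF QH_smult_closed[OF Suc.prems]] .
    also have "\<dots> = monom ((- 1) ^ (Suc d * (l - 1))) (Suc d) \<odot>\<^bsub>QH T l k\<^esub> x"
      by (simp add: QH_smult_smult mult_monom power_add mult.commute)
    finally show ?case .
  qed
qed

theorem corollary1:
  fixes l k :: nat and lam :: "nat list" and I :: "int list"
  assumes "l \<ge> 1" and "k \<ge> 1" and "CARD('n::finite) = l + k"
    and "cring (QH TYPE('n) l k)"
    and "lam \<in> partitions l"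
    and "length I = l"
    and "\<And>j. 1 \<le> j \<Longrightarrow> j \<le> l \<Longrightarrow>
      [I ! (j - 1) = int (lam ! (j - 1))] (mod int (l + k)) \<and>
      int j - int l \<le> I ! (j - 1) \<and> I ! (j - 1) < int j - int l + int (l + k)"
  shows "\<exists>d :: nat. int (l + k) * int d = int (sum_list lam) - sum_list I \<and>
    sigma TYPE('n) l k (map int lam) =
      monom ((- 1) ^ (d * (l - 1))) d \<odot>\<^bsub>QH TYPE('n) l k\<^esub> sigma TYPE('n) l k I"
proof -
  let ?R = "QH TYPE('n) l k"
  let ?c = "chern TYPE('n) l k"
  let ?q = "monom 1 1 \<odot>\<^bsub>?R\<^esub> \<one>\<^bsub>?R\<^esub>"
  interpret R: cring ?R by fact
  have len: "length lam = l" using assms(5) by (simp add: partitions_def)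
  have c: "?c i \<in> carrier ?R" for i
  proof -
    consider "i < 0 \<or> int l < i" | "i = 0" | j where "i = int j" "1 \<le> j" "j \<le> l"
      by (metis int_one_le_iff_zero_less linorder_not_less nat_0_le nat_le_iff of_nat_1 of_nat_le_iff order_le_less)
    then show ?thesis
    proof cases
      case 1
      then show ?thesis using R.zero_closed by (auto simp: chern_def)
    next
      case 2
      then show ?thesis using R.one_closed by (simp add: chern_def QH_def)
    next
      case 3
      then show ?thesis
        unfolding 3(1) chern_hook[OF 3(2,3)]
        using schubert_class_closed[OF hook_rect_partitions[OF 3(2,3) order.refl assms(2)], of "TYPE('n)"] by simp
    qed
  qed
  have c0: "?c 0 = \<one>\<^bsub>?R\<^esub>" by (simp add: chern_def QH_def)
  have cneg: "?c i = \<zero>\<^bsub>?R\<^esub>" if "i < 0" for i using that by (simp add: chern_def)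
  have cbig: "?c i = \<zero>\<^bsub>?R\<^esub>" if "i > int l" for i using that by (simp add: chern_def)
  have zero: "\<zero>\<^bsub>?R\<^esub> = (\<lambda>_. 0)" by (simp add: QH_def)
  have h: "hook_class l k r p \<in> carrier ?R" for r p
    using schubert_class_closed[OF hook_rect_partitions, of r l p k "TYPE('n)"] R.zero_closed zero by (simp add: hook_class_def)
  have h1: "hook_class l k r 1 = ?c (int r)" if "1 \<le> r" "r \<le> l" for r
    using that chern_hook[OF that, of "TYPE('n)" k] assms(2) by (simp add: hook_class_def)
  have hout: "hook_class l k r p = \<zero>\<^bsub>?R\<^esub>" if "l < r \<or> k < p" for r p
    using that by (auto simp: hook_class_def zero)
  have q: "?q \<in> carrier ?R" by (intro QH_smult_closed R.one_closed)
  have hd: "ring_det ?R p (\<lambda>i j. ?c (1 + int j - int i)) = R.hook_det ?c 1 p" for p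
    by (rule R.hook_det_row) (use c c0 cneg in auto)
  have row_closed: "R.row_det ?c p \<in> carrier ?R" for p
    unfolding R.row_det_def hd[symmetric] using R.ring_det_closed c R.zero_closed by simp
  have sigma: "sigma TYPE('n) l k J = ring_det ?R l (\<lambda>i j. R.row_det ?c (J ! i + int j - int i))"
    if "length J = l" for J
  proof -
    have "sigma1 TYPE('n) l k p = R.row_det ?c p" for p
      unfolding sigma1_def R.row_det_def hd ..
    then show ?thesis by (simp add: sigma_def that)
  qed
  \<comment> \<open>The number of periods \<open>n\<close> taken out of row \<open>i\<close>; the
    sum over all rows is the exponent of q.\<close>
  define d where "d i = nat ((int (lam ! i) - I ! i) div int (l + k))" for i
  have bounds: "[I ! i = int (lam ! i)] (mod int (l + k))" "int i + 1 - int l \<le> I ! i" "I ! i < int i + 1 + int k"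
    if "i < l" for i
    using assms(7)[of "Suc i"] that by auto
  have d: "int (lam ! i) = I ! i + int (l + k) * int (d i)" if i: "i < l" for i
  proof -
    have "int (l + k) dvd int (lam ! i) - I ! i"
      using bounds(1)[OF i] by (metis cong_iff_dvd_diff cong_sym)
    then obtain t where t: "int (lam ! i) - I ! i = int (l + k) * t" by blast
    \<comment> \<open>For negative \<open>t\<close> the nonnegativity of the parts would give
      \<open>I ! i \<ge> n\<close>, but \<open>I ! i < i + 1 + k\<close> and
      \<open>i < l\<close>.\<close>
    have "t \<ge> 0"
    proof (rule ccontr)
      assume "\<not> t \<ge> 0"
      then have "t \<le> - 1" by simp
      then have "int (l + k) * t \<le> int (l + k) * (- 1)" by (intro mult_left_mono) auto
      then have "int (l + k) * t \<le> - int l - int k" by (simp add: algebra_simps)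
      then show False using t bounds(3)[OF i] i by linarith
    qed
    moreover have "(int (l + k) * t) div int (l + k) = t"
      using assms(1) by (intro nonzero_mult_div_cancel_left) simp
    ultimately have "int (d i) = t" unfolding d_def t by simp
    then show ?thesis using t by simp
  qed
  let ?d = "\<Sum>i<l. d i"
  have "int (sum_list lam) = (\<Sum>i<l. int (lam ! i))"
    by (simp add: sum_list_sum_nth len lessThan_atLeast0)
  also have "\<dots> = (\<Sum>i<l. I ! i + int (l + k) * int (d i))" using d by (intro sum.cong) auto
  also have "\<dots> = sum_list I + int (l + k) * int ?d"
    by (simp add: sum.distrib sum_distrib_left sum_list_sum_nth assms(6) lessThan_atLeast0)
  finally have size: "int (l + k) * int ?d = int (sum_list lam) - sum_list I" by simp
  have "ring_det ?R l (\<lambda>i j. R.row_det ?c (map int lam ! i + int j - int i)) =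
      R.signed (odd l) ?q [^]\<^bsub>?R\<^esub> ?d \<otimes>\<^bsub>?R\<^esub> ring_det ?R l (\<lambda>i j. R.row_det ?c (I ! i + int j - int i))"
  proof (rule R.det_reduction[where c = ?c and l = l and k = k and h = "hook_class l k" and q = ?q])
    \<comment> \<open>In 0-based form the lower bound on \<open>I\<close> reads
      \<open>i + 1 - l \<le> I ! i\<close>, which is exactly what the leftmost entry of the row
      requires.\<close>
    show "- int l < I ! i - int i" if "i < l" for i using bounds(2)[OF that] by linarith
    show "map int lam ! i = I ! i + int (l + k) * int (d i)" if "i < l" for i
      using d[OF that] that len by simp
    show "?c (int i) \<otimes>\<^bsub>?R\<^esub> hook_class l k 1 m = hook_class l k i (Suc m) \<oplus>\<^bsub>?R\<^esub> hook_class l k (Suc i) m \<oplus>\<^bsub>?R\<^esub>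
      (if i = l \<and> m = k then ?q else \<zero>\<^bsub>?R\<^esub>)" if "1 \<le> i" "i \<le> l" "1 \<le> m" "m \<le> k" for i m
      by (rule quantum_pieri[OF assms(3) that])
  qed (use assms(1,2) c c0 cneg cbig h h1 hout q in auto)
  also have "\<dots> = monom ((- 1) ^ (?d * (l - 1))) ?d \<odot>\<^bsub>?R\<^esub> sigma TYPE('n) l k I"
    unfolding sigma[OF assms(6)]
    by (intro signed_power_action[OF assms(4,1)] R.ring_det_closed row_closed)
  finally have red: "sigma TYPE('n) l k (map int lam) =
      monom ((- 1) ^ (?d * (l - 1))) ?d \<odot>\<^bsub>?R\<^esub> sigma TYPE('n) l k I"
    using sigma[of "map int lam"] len by simp
  show ?thesis by (rule exI[of _ ?d], rule conjI, rule size, rule red)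
qed

end
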